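(* If $\gamma$ is a discrete distribution with only $k$ atoms, then $\{\Phi^{(0)},\Phi^{(1)},\dots,\Phi^{(k-1)}\}$ is a $k$-dimensional Markovian sufficient statistic for the problem of minimizing $R_\tau(\pi)$ over $\tau\in\mathcal{S}$.
   Context: Setting. $\pi\in[0,1)$, $\lambda>0$, $\mu>0$, $c>0$. On $(\Omega,\mathcal{F},\mathbb{P}_0)$ there are mutually independent: a Poisson process $N$ with rate $\mu$; i.i.d. strictly positive random variables $Y_1,Y_2,\dots$ with common distribution $\beta_0$ on $\mathbb{R}^d$; a random time $\theta$ with $\mathbb{P}_0\{\theta=0\}=\pi$, $\mathbb{P}_0\{\theta>t\mid\theta>0\}=e^{-\lambda t}$; and a random variable $\Lambda$ with distribution $\gamma$ on the positive reals such that $m^{(j)}=\int(v-\mu)^j\gamma(dv)$ is finite for all $j\ge0$. $X_t=X_0+\sum_{k=1}^{N_t}Y_k$, $\mathbb{F}=(\mathcal{F}_t)$ is the natural filtration of $X$, $\mathcal{S}$ the set of $\mathbb{F}$-stopping times, and $\mathcal{G}_t=\mathcal{F}_t\vee\sigma\{\theta,\Lambda\}$. $\beta_1\ll\beta_0$ is a probability measure, $r=d\beta_1/d\beta_0$. The measure $\mathbb{P}$ is defined on each $\mathcal{G}_t$ by $\frac{d\mathbb{P}}{d\mathbb{P}_0}\big|_{\mathcal{G}_t}=Z_t=\frac{L_t}{L_\theta}1_{\{\theta\le t\}}+1_{\{\theta>t\}}$, where $L_t=e^{-(\Lambda-\mu)t}\prod_{k=1}^{N_t}\left[\frac{\Lambda}{\mu}r(Y_k)\right]$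 (under $\mathbb{P}$ the rate and jump law of $X$ change at $\theta$ from $\mu,\beta_0$ to $\Lambda,\beta_1$). Let $\Pi_t=\mathbb{P}\{\theta\le t\mid\mathcal{F}_t\}$ and $\Phi^{(j)}_t=\frac{\mathbb{E}[(\Lambda-\mu)^j1_{\{\theta\le t\}}\mid\mathcal{F}_t]}{1-\Pi_t}$, $j=0,1,2,\dots$ The penalty is $R_\tau(\pi)=\mathbb{P}\{\tau<\theta\}+c\,\mathbb{E}[(\tau-\theta)^+]$, and it can be written as $R_\tau(\pi)=1-\pi+c(1-\pi)\mathbb{E}_0\left[\int_0^\tau e^{-\lambda t}\left(\Phi^{(0)}_t-\frac{\lambda}{c}\right)dt\right]$. A finite family of $\mathbb{F}$-adapted processes is called here a Markovian sufficient statistic if, jointly, it is a Markov process with respect to $\mathbb{F}$ under $\mathbb{P}_0$ and the penalty $R_\tau(\pi)$ is, up to constants depending only on $\pi$ and $c$, the $\mathbb{P}_0$-expected discounted running cost up to $\tau$ of a function of this process, so that minimizing $R_\tau(\pi)$ is an optimal stopping problem for that Markov process. *)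

theory Defs
  imports "HOL-Probability.Probability"
begin

definition generated_algebra ::
  "'a set \<Rightarrow> 'i set \<Rightarrow> ('i \<Rightarrow> 'a \<Rightarrow> 'b) \<Rightarrow> 'b measure \<Rightarrow> 'a measure" where
  "generated_algebra \<Omega> I X S = sigma \<Omega> (\<Union>i\<in>I. {X i -` A \<inter> \<Omega> | A. A \<in> sets S})"

text \<open>
  Processes are indexed by \<^typ>\<open>real\<close> and only looked at for times \<open>t \<ge> 0\<close>. Filtrations are
  indexed by \<^typ>\<open>ennreal\<close>, so that the library's \<^const>\<open>stopping_time\<close> applies to
  stopping times with values in \<open>[0, \<infinity>]\<close>; the \<open>\<sigma>\<close>-algebra at index \<open>\<infinity>\<close> is
  generated by the union of the \<open>\<sigma>\<close>-algebras at finite times. No completion is taken.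
\<close>

definition natural_filtration ::
  "'a set \<Rightarrow> (real \<Rightarrow> 'a \<Rightarrow> 'b::topological_space) \<Rightarrow> ennreal \<Rightarrow> 'a measure" where
  "natural_filtration \<Omega> X t = generated_algebra \<Omega> {s. 0 \<le> s \<and> ennreal s \<le> t} X borel"

definition enlarged_filtration ::
  "'a set \<Rightarrow> (ennreal \<Rightarrow> 'a measure) \<Rightarrow> ('a \<Rightarrow> real) \<Rightarrow> ('a \<Rightarrow> real) \<Rightarrow> ennreal \<Rightarrow> 'a measure" where
  "enlarged_filtration \<Omega> F \<theta> \<Lambda> t =
     sigma \<Omega> (sets (F t) \<union> {\<theta> -` A \<inter> \<Omega> | A. A \<in> sets borel} \<union> {\<Lambda> -` A \<inter> \<Omega> | A. A \<in> sets borel})"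

definition poisson_process :: "'a measure \<Rightarrow> real \<Rightarrow> (real \<Rightarrow> 'a \<Rightarrow> nat) \<Rightarrow> bool" where
  "poisson_process M \<mu> N \<longleftrightarrow>
     (\<forall>t\<ge>0. N t \<in> M \<rightarrow>\<^sub>M count_space UNIV) \<and>
     (\<forall>\<omega>\<in>space M. N 0 \<omega> = 0 \<and> mono_on {0..} (\<lambda>t. N t \<omega>) \<and>
        (\<forall>t\<ge>0. continuous (at_right t) (\<lambda>s. real (N s \<omega>)))) \<and>
     (\<forall>s t. 0 \<le> s \<longrightarrow> s < t \<longrightarrow>
        distr M (count_space UNIV) (\<lambda>\<omega>. N t \<omega> - N s \<omega>) = measure_pmf (poisson_pmf (\<mu> * (t - s)))) \<and>
     (\<forall>n (t :: nat \<Rightarrow> real). 0 \<le> t 0 \<longrightarrow> mono_on {..n} t \<longrightarrow>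
        prob_space.indep_vars M (\<lambda>_. count_space UNIV) (\<lambda>i \<omega>. N (t (Suc i)) \<omega> - N (t i) \<omega>) {..<n})"

definition compound_process ::
  "('a \<Rightarrow> 'b) \<Rightarrow> (real \<Rightarrow> 'a \<Rightarrow> nat) \<Rightarrow> (nat \<Rightarrow> 'a \<Rightarrow> 'b) \<Rightarrow> real \<Rightarrow> 'a \<Rightarrow> 'b::comm_monoid_add" where
  "compound_process X\<^sub>0 N Y t \<omega> = X\<^sub>0 \<omega> + (\<Sum>k = 1..N t \<omega>. Y k \<omega>)"

definition likelihood ::
  "real \<Rightarrow> ('b \<Rightarrow> real) \<Rightarrow> (real \<Rightarrow> 'a \<Rightarrow> nat) \<Rightarrow> (nat \<Rightarrow> 'a \<Rightarrow> 'b) \<Rightarrow> ('a \<Rightarrow> real) \<Rightarrow> real \<Rightarrow> 'a \<Rightarrow> real" where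
  "likelihood \<mu> r N Y \<Lambda> t \<omega> =
     exp (- (\<Lambda> \<omega> - \<mu>) * t) * (\<Prod>k = 1..N t \<omega>. \<Lambda> \<omega> / \<mu> * r (Y k \<omega>))"

text \<open>
  The quotient \<open>L\<^sub>t / L\<^sub>s\<close> for \<open>s \<le> t\<close>. Since \<open>r\<close> may vanish on a set of positive
  \<open>\<beta>\<^sub>0\<close>-measure, \<open>L\<^sub>s\<close> may be zero; the quotient is therefore written with the
  common factors cancelled, which is what is meant when it reads \<open>0 / 0\<close> (with the convention
  \<open>0 / 0 = 0\<close> the density below would not have expectation one). Where \<open>L\<^sub>s\<close> does not
  vanish it is the literal quotient, see \<open>likelihood_quotient_eq\<close>.
\<close>

definition likelihood_quotient ::
  "real \<Rightarrow> ('b \<Rightarrow> real) \<Rightarrow> (real \<Rightarrow> 'a \<Rightarrow> nat) \<Rightarrow> (nat \<Rightarrow> 'a \<Rightarrow> 'b) \<Rightarrow> ('a \<Rightarrow> real)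
     \<Rightarrow> real \<Rightarrow> real \<Rightarrow> 'a \<Rightarrow> real" where
  "likelihood_quotient \<mu> r N Y \<Lambda> s t \<omega> =
     exp (- (\<Lambda> \<omega> - \<mu>) * (t - s)) * (\<Prod>k\<in>{N s \<omega><..N t \<omega>}. \<Lambda> \<omega> / \<mu> * r (Y k \<omega>))"

lemma likelihood_quotient_eq:
  assumes "N s \<omega> \<le> N t \<omega>" and nz: "likelihood \<mu> r N Y \<Lambda> s \<omega> \<noteq> 0"
  shows "likelihood_quotient \<mu> r N Y \<Lambda> s t \<omega> =
         likelihood \<mu> r N Y \<Lambda> t \<omega> / likelihood \<mu> r N Y \<Lambda> s \<omega>"
proof -
  have split: "{1..N t \<omega>} = {1..N s \<omega>} \<union> {N s \<omega><..N t \<omega>}"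
    using assms(1) by auto
  have prod: "(\<Prod>k = 1..N t \<omega>. \<Lambda> \<omega> / \<mu> * r (Y k \<omega>)) =
      (\<Prod>k = 1..N s \<omega>. \<Lambda> \<omega> / \<mu> * r (Y k \<omega>)) * (\<Prod>k\<in>{N s \<omega><..N t \<omega>}. \<Lambda> \<omega> / \<mu> * r (Y k \<omega>))"
    unfolding split by (rule prod.union_disjoint) auto
  have exps: "exp (- (\<Lambda> \<omega> - \<mu>) * t) = exp (- (\<Lambda> \<omega> - \<mu>) * s) * exp (- (\<Lambda> \<omega> - \<mu>) * (t - s))"
    by (simp flip: exp_add add: algebra_simps)
  have "likelihood \<mu> r N Y \<Lambda> t \<omega> =
      likelihood \<mu> r N Y \<Lambda> s \<omega> * likelihood_quotient \<mu> r N Y \<Lambda> s t \<omega>"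
    unfolding likelihood_def likelihood_quotient_def prod exps by (simp only: ac_simps)
  then show ?thesis
    using nz by simp
qed

definition disorder_density ::
  "real \<Rightarrow> ('b \<Rightarrow> real) \<Rightarrow> (real \<Rightarrow> 'a \<Rightarrow> nat) \<Rightarrow> (nat \<Rightarrow> 'a \<Rightarrow> 'b) \<Rightarrow> ('a \<Rightarrow> real) \<Rightarrow> ('a \<Rightarrow> real)
     \<Rightarrow> real \<Rightarrow> 'a \<Rightarrow> real" where
  "disorder_density \<mu> r N Y \<Lambda> \<theta> t \<omega> =
     (if \<theta> \<omega> \<le> t then likelihood_quotient \<mu> r N Y \<Lambda> (\<theta> \<omega>) t \<omega> else 1)"

datatype source = Start | Count | Mark nat | Change | Rate

text \<open>
  \<open>M\<close> carries the reference measure \<open>P\<^sub>0\<close>. The starting value \<open>X\<^sub>0\<close> may be random,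
  independently of everything else; this contains the case of a constant. The marks are
  \<open>Y 1, Y 2, \<dots>\<close> (the value \<open>Y 0\<close> is never used). The measure \<open>P\<close> lives on the
  \<open>\<sigma>\<close>-algebra generated by all \<open>G\<^sub>t\<close>, \<open>t < \<infinity>\<close>.
\<close>

locale poisson_disorder = prob_space M
  for M :: "'a measure" +
  fixes P :: "'a measure"
    and p lam \<mu> c :: real
    and \<gamma> :: "real measure"
    and \<beta>\<^sub>0 \<beta>\<^sub>1 :: "(real ^ 'd) measure"
    and X\<^sub>0 :: "'a \<Rightarrow> real ^ 'd"
    and N :: "real \<Rightarrow> 'a \<Rightarrow> nat"
    and Y :: "nat \<Rightarrow> 'a \<Rightarrow> real ^ 'd"
    and \<theta> \<Lambda> :: "'a \<Rightarrow> real"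
  assumes p: "0 \<le> p" "p < 1"
    and lam_pos: "0 < lam" and \<mu>_pos: "0 < \<mu>" and c_pos: "0 < c"
    and N: "poisson_process M \<mu> N"
    and X\<^sub>0: "X\<^sub>0 \<in> borel_measurable M"
    and Y: "\<And>k. 1 \<le> k \<Longrightarrow> Y k \<in> borel_measurable M"
    and Y_distr: "\<And>k. 1 \<le> k \<Longrightarrow> distr M borel (Y k) = \<beta>\<^sub>0"
    and Y_pos: "AE y in \<beta>\<^sub>0. \<forall>i. 0 < y $ i"
    and \<theta>: "\<theta> \<in> borel_measurable M" "\<And>\<omega>. \<omega> \<in> space M \<Longrightarrow> 0 \<le> \<theta> \<omega>"
    and \<theta>_zero: "\<P>(\<omega> in M. \<theta> \<omega> = 0) = p"
    and \<theta>_exp: "\<And>t. 0 \<le> t \<Longrightarrow> \<P>(\<omega> in M. t < \<theta> \<omega> \<bar> 0 < \<theta> \<omega>) = exp (- lam * t)"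
    and \<Lambda>: "\<Lambda> \<in> borel_measurable M"
    and \<Lambda>_distr: "distr M borel \<Lambda> = \<gamma>"
    and \<Lambda>_pos: "AE v in \<gamma>. 0 < v"
    and \<Lambda>_moments: "\<And>j :: nat. integrable \<gamma> (\<lambda>v. (v - \<mu>) ^ j)"
    and indep: "indep_sets
          (\<lambda>i. case i of
                 Start \<Rightarrow> sets (vimage_algebra (space M) X\<^sub>0 borel)
               | Count \<Rightarrow> sets (generated_algebra (space M) {0..} N (count_space UNIV))
               | Mark k \<Rightarrow> sets (vimage_algebra (space M) (Y k) borel)
               | Change \<Rightarrow> sets (vimage_algebra (space M) \<theta> borel)
               | Rate \<Rightarrow> sets (vimage_algebra (space M) \<Lambda> borel))
          ({Start, Count, Change, Rate} \<union> Mark ` {1..})"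
    and \<beta>\<^sub>1: "prob_space \<beta>\<^sub>1" "sets \<beta>\<^sub>1 = sets borel" "absolutely_continuous \<beta>\<^sub>0 \<beta>\<^sub>1"
    and P_space: "space P = space M"
    and P_sets: "sets P = sets (enlarged_filtration (space M)
          (natural_filtration (space M) (compound_process X\<^sub>0 N Y)) \<theta> \<Lambda> \<infinity>)"
    and P_density: "\<And>t A. 0 \<le> t \<Longrightarrow>
          A \<in> sets (enlarged_filtration (space M)
                (natural_filtration (space M) (compound_process X\<^sub>0 N Y)) \<theta> \<Lambda> (ennreal t)) \<Longrightarrow>
          emeasure P A = (\<integral>\<^sup>+\<omega>\<in>A. ennreal (disorder_density \<mu> (\<lambda>y. enn2real (RN_deriv \<beta>\<^sub>0 \<beta>\<^sub>1 y)) N Y \<Lambda> \<theta> t \<omega>) \<partial>M)"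

definition posterior ::
  "'a measure \<Rightarrow> (ennreal \<Rightarrow> 'a measure) \<Rightarrow> ('a \<Rightarrow> real) \<Rightarrow> real \<Rightarrow> 'a \<Rightarrow> real" where
  "posterior P F \<theta> t = real_cond_exp P (F (ennreal t)) (\<lambda>\<omega>. indicator {\<omega>. \<theta> \<omega> \<le> t} \<omega>)"

text \<open>
  The defining formula determines \<open>\<Phi>\<^sup>(\<^sup>j\<^sup>)\<^sub>t\<close> only almost surely for each fixed \<open>t\<close>;
  joint measurability is what makes integrals over time along paths meaningful.
\<close>

definition odds_moment_version ::
  "'a measure \<Rightarrow> 'a measure \<Rightarrow> (ennreal \<Rightarrow> 'a measure) \<Rightarrow> real \<Rightarrow> ('a \<Rightarrow> real) \<Rightarrow> ('a \<Rightarrow> real)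
     \<Rightarrow> nat \<Rightarrow> (real \<Rightarrow> 'a \<Rightarrow> real) \<Rightarrow> bool" where
  "odds_moment_version M P F \<mu> \<Lambda> \<theta> j \<phi> \<longleftrightarrow>
     (\<lambda>(t, \<omega>). \<phi> t \<omega>) \<in> borel_measurable (restrict_space borel {0..} \<Otimes>\<^sub>M M) \<and>
     (\<forall>t\<ge>0. \<phi> t \<in> borel_measurable (F (ennreal t)) \<and>
        (AE \<omega> in P. \<phi> t \<omega> =
           real_cond_exp P (F (ennreal t)) (\<lambda>\<omega>. (\<Lambda> \<omega> - \<mu>) ^ j * indicator {\<omega>. \<theta> \<omega> \<le> t} \<omega>) \<omega>
             / (1 - posterior P F \<theta> t \<omega>)))"

text \<open>
  \<open>R\<^sub>\<tau>\<close>; truncated subtraction on \<^typ>\<open>ennreal\<close> is the positive part \<open>(\<tau> - \<theta>)\<^sup>+\<close>.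
\<close>

definition penalty ::
  "'a measure \<Rightarrow> real \<Rightarrow> ('a \<Rightarrow> real) \<Rightarrow> ('a \<Rightarrow> ennreal) \<Rightarrow> ennreal" where
  "penalty P c \<theta> \<tau> =
     emeasure P {\<omega> \<in> space P. \<tau> \<omega> < ennreal (\<theta> \<omega>)}
       + ennreal c * (\<integral>\<^sup>+\<omega>. (\<tau> \<omega> - ennreal (\<theta> \<omega>)) \<partial>P)"

definition markov_process ::
  "'a measure \<Rightarrow> (ennreal \<Rightarrow> 'a measure) \<Rightarrow> 'b measure \<Rightarrow> (real \<Rightarrow> 'a \<Rightarrow> 'b) \<Rightarrow> bool" where
  "markov_process M F S Z \<longleftrightarrow>
     (\<forall>t\<ge>0. Z t \<in> F (ennreal t) \<rightarrow>\<^sub>M S) \<and>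
     (\<forall>s t B. 0 \<le> s \<longrightarrow> s \<le> t \<longrightarrow> B \<in> sets S \<longrightarrow>
        (AE \<omega> in M.
           real_cond_exp M (F (ennreal s)) (\<lambda>\<omega>. indicator B (Z t \<omega>)) \<omega> =
           real_cond_exp M (vimage_algebra (space M) (Z s) S) (\<lambda>\<omega>. indicator B (Z t \<omega>)) \<omega>))"

text \<open>
  The expected value of \<open>\<integral>\<^sub>0\<^sup>\<tau> e\<^sup>-\<^sup>\<rho>\<^sup>t g(Z\<^sub>t) dt\<close> is the difference of the contributions of the
  positive and of the negative part of \<open>g\<close> (\<^const>\<open>ennreal\<close> maps negative numbers to zero).
  It is well defined, with values in \<open>(-\<infinity>, \<infinity>]\<close>, if the second one is finite.
\<close>

definition cost_part ::
  "'a measure \<Rightarrow> real \<Rightarrow> ('b \<Rightarrow> real) \<Rightarrow> (real \<Rightarrow> 'a \<Rightarrow> 'b) \<Rightarrow> ('a \<Rightarrow> ennreal) \<Rightarrow> ennreal" where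
  "cost_part M \<rho> g Z \<tau> =
     (\<integral>\<^sup>+\<omega>. (\<integral>\<^sup>+t\<in>{t. 0 \<le> t \<and> ennreal t < \<tau> \<omega>}. ennreal (exp (- \<rho> * t) * g (Z t \<omega>)) \<partial>lborel) \<partial>M)"

definition running_cost ::
  "'a measure \<Rightarrow> real \<Rightarrow> ('b \<Rightarrow> real) \<Rightarrow> (real \<Rightarrow> 'a \<Rightarrow> 'b) \<Rightarrow> ('a \<Rightarrow> ennreal) \<Rightarrow> ereal" where
  "running_cost M \<rho> g Z \<tau> =
     enn2ereal (cost_part M \<rho> g Z \<tau>) - enn2ereal (cost_part M \<rho> (\<lambda>z. - g z) Z \<tau>)"

definition joint_process :: "nat \<Rightarrow> (nat \<Rightarrow> real \<Rightarrow> 'a \<Rightarrow> real) \<Rightarrow> real \<Rightarrow> 'a \<Rightarrow> nat \<Rightarrow> real" where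
  "joint_process k \<Phi> t \<omega> = (\<lambda>j\<in>{..<k}. \<Phi> j t \<omega>)"

text \<open>
  The family \<open>\<Phi> 0, \<dots>, \<Phi> (k - 1)\<close>. The functions \<open>a\<close> and \<open>b\<close> are the constants that may depend
  on the prior probability \<open>p\<close> and the delay cost \<open>c\<close> only; \<open>b p c > 0\<close> ensures that minimizing
  the penalty amounts to minimizing the running cost.
\<close>

definition markovian_sufficient_statistic ::
  "'a measure \<Rightarrow> 'a measure \<Rightarrow> (ennreal \<Rightarrow> 'a measure) \<Rightarrow> real \<Rightarrow> real \<Rightarrow> real \<Rightarrow> ('a \<Rightarrow> real)
     \<Rightarrow> (real \<Rightarrow> real \<Rightarrow> real) \<Rightarrow> (real \<Rightarrow> real \<Rightarrow> real) \<Rightarrow> nat \<Rightarrow> (nat \<Rightarrow> real \<Rightarrow> 'a \<Rightarrow> real) \<Rightarrow> bool" where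
  "markovian_sufficient_statistic M P F p lam c \<theta> a b k \<Phi> \<longleftrightarrow>
     (\<forall>j<k. \<forall>t\<ge>0. \<Phi> j t \<in> borel_measurable (F (ennreal t))) \<and>
     markov_process M F (Pi\<^sub>M {..<k} (\<lambda>_. borel)) (joint_process k \<Phi>) \<and>
     0 < b p c \<and>
     (\<exists>g \<in> borel_measurable (Pi\<^sub>M {..<k} (\<lambda>_. borel)).
        \<forall>\<tau>. stopping_time F \<tau> \<longrightarrow>
          cost_part M lam (\<lambda>z. - g z) (joint_process k \<Phi>) \<tau> < \<infinity> \<and>
          enn2ereal (penalty P c \<theta> \<tau>) =
            ereal (a p c) + ereal (b p c) * running_cost M lam g (joint_process k \<Phi>) \<tau>)"

definition atoms :: "'b measure \<Rightarrow> 'b set" where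
  "atoms \<gamma> = {x \<in> space \<gamma>. 0 < measure \<gamma> {x}}"

definition discrete_with_atoms :: "'b measure \<Rightarrow> nat \<Rightarrow> bool" where
  "discrete_with_atoms \<gamma> k \<longleftrightarrow> finite (atoms \<gamma>) \<and> card (atoms \<gamma>) = k \<and> (AE x in \<gamma>. x \<in> atoms \<gamma>)"

end

theory Submission
  imports Defs "HOL-Computational_Algebra.Polynomial"
begin

text \<open>
Let \<open>V\<close> be the finite set of atoms of \<open>\<gamma>\<close>, and for \<open>v \<in> V\<close> let \<open>L\<^sup>v\<close> be the likelihood process
with \<open>\<Lambda>\<close> replaced by the constant \<open>v\<close>. Under the reference measure the pair \<open>\<theta>\<close>, \<open>\<Lambda>\<close> is independent
of the observations, so integrating it out of the density shows that \<open>P(A, \<theta> \<le> t, \<Lambda> = v)\<close>, for an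
event \<open>A\<close> observed by time \<open>t\<close>, is the integral over \<open>A\<close> of
\<open>a\<^sub>v(t) = \<gamma>{v} \<integral> L\<^sup>v\<^sub>t / L\<^sup>v\<^sub>u law(\<theta>)(du)\<close>, the integral running over \<open>u \<in> [0, t]\<close>, whereas
\<open>P(A, t < \<theta>)\<close> is the reference probability of \<open>A\<close> times that of \<open>t < \<theta>\<close>, because the density is one there. The
natural filtration sees only \<open>X\<close>, not \<open>N\<close> and the marks. Since almost surely all marks are nonzero
and \<open>N\<close> has unit jumps, the jumps of \<open>X\<close> reveal the marks in order, and \<open>a\<^sub>v(t)\<close> is almost surely a
functional of the path of \<open>X\<close> up to \<open>t\<close>. Bayes' formula then gives
\<open>\<Phi>\<^sup>(\<^sup>j\<^sup>)\<^sub>t = (\<Sum>v\<in>V. (v - \<mu>)^j * a\<^sub>v(t)) / survival t\<close>, see \<open>odds_moment_formula\<close>.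

Finiteness of \<open>V\<close> enters here: the map from the \<open>k\<close> numbers \<open>a\<^sub>v(t)\<close> to the first \<open>k\<close> statistics is a
Vandermonde matrix with distinct nodes \<open>v - \<mu>\<close>, hence invertible (\<open>moments_invertible\<close>). So it
suffices to understand the \<open>a\<^sub>v\<close>. The multiplicativity of \<open>L\<^sup>v\<close> makes \<open>a\<^sub>v(t)\<close> an affine function of
\<open>a\<^sub>v(s)\<close> (\<open>odds_mass_recursion\<close>) whose coefficients depend only on what happens after \<open>s\<close>, and
that future is independent of the observed past (\<open>future_functional\<close>). A process updated from its
present value by independent noise is Markov (\<open>markov_step\<close>).

For the penalty, \<open>P\<close> and the reference measure agree on \<open>{\<tau> < \<theta>}\<close>, and there the independence of
\<open>\<theta>\<close> and the observations gives the discount factor \<open>e\<^sup>-\<^sup>\<lambda>\<^sup>\<tau>\<close>; the expected delay is the time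
integral of \<open>P(\<theta> \<le> t < \<tau>)\<close>, which is \<open>\<Sum>v. a\<^sub>v(t)\<close> integrated over \<open>{t < \<tau>}\<close>, that is
\<open>survival t * \<Phi>\<^sup>(\<^sup>0\<^sup>)\<^sub>t\<close> integrated over \<open>{t < \<tau>}\<close> (\<open>penalty_eq_running_cost\<close>).
\<close>

section \<open>Generated algebras, freezing and conditional expectations\<close>

lemma space_generated_algebra [simp]: "space (generated_algebra \<Omega> I X S) = \<Omega>"
  unfolding generated_algebra_def by (rule space_measure_of) auto

lemma sets_generated_algebra:
  "sets (generated_algebra \<Omega> I X S) = sigma_sets \<Omega> (\<Union>i\<in>I. {X i -` A \<inter> \<Omega> | A. A \<in> sets S})"
  unfolding generated_algebra_def by (rule sets_measure_of) auto

lemma measurable_generated_algebra: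
  assumes "i \<in> I" "X i \<in> \<Omega> \<rightarrow> space S"
  shows "X i \<in> generated_algebra \<Omega> I X S \<rightarrow>\<^sub>M S"
proof (rule measurableI)
  fix A assume "A \<in> sets S"
  with assms(1) show "X i -` A \<inter> space (generated_algebra \<Omega> I X S) \<in> sets (generated_algebra \<Omega> I X S)"
    by (auto simp: sets_generated_algebra intro!: sigma_sets.Basic)
qed (use assms in auto)

lemma sets_generated_algebra_subset:
  assumes "space B = \<Omega>" "\<And>i. i \<in> I \<Longrightarrow> X i \<in> B \<rightarrow>\<^sub>M S"
  shows "sets (generated_algebra \<Omega> I X S) \<subseteq> sets B"
proof -
  have "sigma_sets (space B) (\<Union>i\<in>I. {X i -` A \<inter> \<Omega> | A. A \<in> sets S}) \<subseteq> sets B"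
    using assms by (intro sets.sigma_sets_subset) (auto simp: measurable_sets)
  then show ?thesis
    using assms(1) by (simp add: sets_generated_algebra)
qed

lemma measurable_mono_sets:
  "f \<in> A \<rightarrow>\<^sub>M S \<Longrightarrow> space A = space B \<Longrightarrow> sets A \<subseteq> sets B \<Longrightarrow> f \<in> B \<rightarrow>\<^sub>M S"
  unfolding measurable_def by auto

context prob_space
begin

text \<open>
Fubini for independent randomness. The sub-\<open>\<sigma>\<close>-algebra \<open>A\<close> is treated as the law of the identity
map into \<open>(\<Omega>, A)\<close>, so that independence says that the pair \<open>(\<omega>, X \<omega>)\<close> has a product law.
The integrand may then depend on \<open>\<omega>\<close> through anything that \<open>A\<close> knows, without naming the
random variables involved.
\<close>

lemma nn_integral_indep_freeze:
  assumes sub: "subalgebra M A" and X [measurable]: "X \<in> M \<rightarrow>\<^sub>M S"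
    and ind: "\<And>E C. E \<in> sets A \<Longrightarrow> C \<in> sets S \<Longrightarrow>
      prob (E \<inter> (X -` C \<inter> space M)) = prob E * prob (X -` C \<inter> space M)"
    and f: "f \<in> borel_measurable (A \<Otimes>\<^sub>M S)"
  shows "(\<integral>\<^sup>+\<omega>. f (\<omega>, X \<omega>) \<partial>M) = (\<integral>\<^sup>+\<omega>. (\<integral>\<^sup>+x. f (\<omega>, x) \<partial>distr M S X) \<partial>M)"
proof -
  have spA: "space A = space M" and setsA: "sets A \<subseteq> sets M"
    using sub by (auto simp: subalgebra_def)
  have id [measurable]: "(\<lambda>\<omega>. \<omega>) \<in> M \<rightarrow>\<^sub>M A"
    using spA setsA by (intro measurable_mono_sets[OF measurable_ident_sets[OF refl]]) auto
  note f [measurable]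
  interpret D: prob_space "distr M S X" by (rule prob_space_distr) simp
  interpret I: prob_space "distr M A (\<lambda>\<omega>. \<omega>)" by (rule prob_space_distr) simp
  have pair: "distr M A (\<lambda>\<omega>. \<omega>) \<Otimes>\<^sub>M distr M S X = distr M (A \<Otimes>\<^sub>M S) (\<lambda>\<omega>. (\<omega>, X \<omega>))"
  proof (rule pair_measure_eqI)
    show "sigma_finite_measure (distr M A (\<lambda>\<omega>. \<omega>))" "sigma_finite_measure (distr M S X)"
      by unfold_locales
    show "sets (distr M A (\<lambda>\<omega>. \<omega>) \<Otimes>\<^sub>M distr M S X) = sets (distr M (A \<Otimes>\<^sub>M S) (\<lambda>\<omega>. (\<omega>, X \<omega>)))"
      by (simp cong: sets_pair_measure_cong)
    fix E C assume "E \<in> sets (distr M A (\<lambda>\<omega>. \<omega>))" "C \<in> sets (distr M S X)"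
    then have E [measurable]: "E \<in> sets A" and C [measurable]: "C \<in> sets S" by auto
    have EM: "E \<inter> space M = E" using E sets.sets_into_space[of E A] spA by auto
    have "(\<lambda>\<omega>. (\<omega>, X \<omega>)) -` (E \<times> C) \<inter> space M = E \<inter> (X -` C \<inter> space M)"
      using EM by auto
    moreover have "(\<lambda>\<omega>. \<omega>) -` E \<inter> space M = E" using EM by auto
    ultimately show "emeasure (distr M A (\<lambda>\<omega>. \<omega>)) E * emeasure (distr M S X) C
        = emeasure (distr M (A \<Otimes>\<^sub>M S) (\<lambda>\<omega>. (\<omega>, X \<omega>))) (E \<times> C)"
      using ind[OF E C]
      by (simp add: emeasure_distr emeasure_eq_measure ennreal_mult)
  qed
  have "(\<integral>\<^sup>+\<omega>. f (\<omega>, X \<omega>) \<partial>M) = (\<integral>\<^sup>+z. f z \<partial>distr M (A \<Otimes>\<^sub>M S) (\<lambda>\<omega>. (\<omega>, X \<omega>)))"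
    by (subst nn_integral_distr) auto
  also have "\<dots> = (\<integral>\<^sup>+\<omega>. (\<integral>\<^sup>+x. f (\<omega>, x) \<partial>distr M S X) \<partial>distr M A (\<lambda>\<omega>. \<omega>))"
    unfolding pair[symmetric] by (subst D.nn_integral_fst[symmetric]) auto
  also have "\<dots> = (\<integral>\<^sup>+\<omega>. (\<integral>\<^sup>+x. f (\<omega>, x) \<partial>distr M S X) \<partial>M)"
    by (subst nn_integral_distr) auto
  finally show ?thesis .
qed

lemma subalgebra_sigma_finite: "subalgebra M A \<Longrightarrow> sigma_finite_subalgebra M A"
  by (rule finite_measure_subalgebra_is_sigma_finite)
    (simp add: finite_measure_subalgebra_def finite_measure_subalgebra_axioms_def finite_measure_axioms)

lemma set_lebesgue_integral_indicator:
  assumes "A \<in> sets M" "f \<in> borel_measurable M" "\<And>\<omega>. 0 \<le> f \<omega>"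
  shows "(LINT \<omega>:A|M. f \<omega>) = enn2real (\<integral>\<^sup>+\<omega>. ennreal (f \<omega>) * indicator A \<omega> \<partial>M)"
proof -
  have "(LINT \<omega>:A|M. f \<omega>) = enn2real (\<integral>\<^sup>+\<omega>. ennreal (indicator A \<omega> * f \<omega>) \<partial>M)"
    unfolding set_lebesgue_integral_def real_scaleR_def
    using assms by (intro integral_eq_nn_integral) auto
  also have "(\<integral>\<^sup>+\<omega>. ennreal (indicator A \<omega> * f \<omega>) \<partial>M) = (\<integral>\<^sup>+\<omega>. ennreal (f \<omega>) * indicator A \<omega> \<partial>M)"
    by (intro nn_integral_cong) (auto split: split_indicator)
  finally show ?thesis .
qed

text \<open>
If the new state is a function of the old one and of noise independent of the whole past, then
averaging over the noise with the old state frozen gives a version \<open>h (Z \<omega>)\<close> of the conditional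
probability given the past; as it depends on the present state only, it is also a version of
the conditional probability given the present.
\<close>

lemma markov_step:
  assumes sub: "subalgebra M A" and Z: "Z \<in> A \<rightarrow>\<^sub>M S" and Z' [measurable]: "Z' \<in> M \<rightarrow>\<^sub>M S"
    and B [measurable]: "B \<in> sets S"
    and \<xi> [measurable]: "\<xi> \<in> M \<rightarrow>\<^sub>M T"
    and ind: "\<And>E C. E \<in> sets A \<Longrightarrow> C \<in> sets T \<Longrightarrow>
      prob (E \<inter> (\<xi> -` C \<inter> space M)) = prob E * prob (\<xi> -` C \<inter> space M)"
    and G [measurable]: "G \<in> S \<Otimes>\<^sub>M T \<rightarrow>\<^sub>M S"
    and eq: "AE \<omega> in M. Z' \<omega> = G (Z \<omega>, \<xi> \<omega>)"
  shows "AE \<omega> in M. real_cond_exp M A (\<lambda>\<omega>. indicator B (Z' \<omega>)) \<omega> =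
           real_cond_exp M (vimage_algebra (space M) Z S) (\<lambda>\<omega>. indicator B (Z' \<omega>)) \<omega>"
proof -
  define A' where "A' = vimage_algebra (space M) Z S"
  have spA: "space A = space M" and setsA: "sets A \<subseteq> sets M"
    using sub by (auto simp: subalgebra_def)
  have Zsp: "Z \<in> space M \<rightarrow> space S"
    using Z spA by (auto simp: measurable_def)
  have ZA' [measurable]: "Z \<in> A' \<rightarrow>\<^sub>M S"
    unfolding A'_def using Zsp by (rule measurable_vimage_algebra1)
  have subA': "subalgebra A A'"
    unfolding subalgebra_def A'_def using Z spA Zsp
    by (auto simp: sets_vimage_algebra2 dest: measurable_sets)
  have subM: "subalgebra M A'"
    using sub subA' by (auto simp: subalgebra_def)
  have ZM [measurable]: "Z \<in> M \<rightarrow>\<^sub>M S"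
    using Z measurable_from_subalg[OF sub] by blast
  interpret D: prob_space "distr M T \<xi>" by (rule prob_space_distr) simp
  define h where "h z = enn2real (\<integral>\<^sup>+x. indicator B (G (z, x)) \<partial>distr M T \<xi>)" for z
  have meas1 [measurable]: "(\<lambda>z. \<integral>\<^sup>+x. indicator B (G (z, x)) \<partial>distr M T \<xi>) \<in> borel_measurable S"
    by (rule D.borel_measurable_nn_integral) (simp add: split_beta')
  have h [measurable]: "h \<in> borel_measurable S"
    unfolding h_def by measurable
  have fin: "(\<integral>\<^sup>+x. indicator B (G (z, x)) \<partial>distr M T \<xi>) \<le> 1" for z
  proof -
    have "(\<integral>\<^sup>+x. indicator B (G (z, x)) \<partial>distr M T \<xi>) \<le> (\<integral>\<^sup>+x. 1 \<partial>distr M T \<xi>)"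
      by (intro nn_integral_mono) (auto split: split_indicator)
    then show ?thesis using D.emeasure_space_1 by simp
  qed
  have h_enn: "ennreal (h z) = (\<integral>\<^sup>+x. indicator B (G (z, x)) \<partial>distr M T \<xi>)" for z
    unfolding h_def using le_less_trans[OF fin[of z] ennreal_one_less_top] by simp
  have h01: "0 \<le> h z" "h z \<le> 1" for z
    using fin[of z] unfolding h_enn[symmetric] by (auto simp: h_def)
  have key: "(LINT \<omega>:E|M. indicator B (Z' \<omega>)) = (LINT \<omega>:E|M. h (Z \<omega>))" if E: "E \<in> sets A" for E
  proof -
    have EM [measurable]: "E \<in> sets M" using E setsA by auto
    note E [measurable]
    note Z [measurable]
    have "(\<integral>\<^sup>+\<omega>. ennreal (indicator B (Z' \<omega>)) * indicator E \<omega> \<partial>M)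
        = (\<integral>\<^sup>+\<omega>. (\<lambda>(\<omega>, x). indicator B (G (Z \<omega>, x)) * indicator E \<omega>) (\<omega>, \<xi> \<omega>) \<partial>M)"
      using eq by (intro nn_integral_cong_AE) (auto split: split_indicator)
    also have "\<dots> = (\<integral>\<^sup>+\<omega>. (\<integral>\<^sup>+x. (\<lambda>(\<omega>, x). indicator B (G (Z \<omega>, x)) * indicator E \<omega>) (\<omega>, x) \<partial>distr M T \<xi>) \<partial>M)"
      using ind by (intro nn_integral_indep_freeze[OF sub]) (auto simp: split_beta')
    also have "\<dots> = (\<integral>\<^sup>+\<omega>. ennreal (h (Z \<omega>)) * indicator E \<omega> \<partial>M)"
    proof (intro nn_integral_cong)
      fix \<omega> assume "\<omega> \<in> space M"
      then have [measurable]: "Z \<omega> \<in> space S" using Zsp by auto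
      show "(\<integral>\<^sup>+x. (\<lambda>(\<omega>, x). indicator B (G (Z \<omega>, x)) * indicator E \<omega>) (\<omega>, x) \<partial>distr M T \<xi>)
        = ennreal (h (Z \<omega>)) * indicator E \<omega>"
        unfolding h_enn by (simp add: nn_integral_multc)
    qed
    finally show ?thesis
      using h01 by (subst (1 2) set_lebesgue_integral_indicator) auto
  qed
  have int1: "integrable M (\<lambda>\<omega>. indicator B (Z' \<omega>) :: real)"
    by (rule integrable_const_bound[where B = 1]) (auto split: split_indicator)
  have int2: "integrable M (\<lambda>\<omega>. h (Z \<omega>))"
    by (rule integrable_const_bound[where B = 1]) (auto simp: h01)
  interpret A: sigma_finite_subalgebra M A by (rule subalgebra_sigma_finite[OF sub])
  interpret A': sigma_finite_subalgebra M A' by (rule subalgebra_sigma_finite[OF subM])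
  have "AE \<omega> in M. real_cond_exp M A (\<lambda>\<omega>. indicator B (Z' \<omega>)) \<omega> = h (Z \<omega>)"
    using key int1 int2 measurable_compose[OF Z h] by (rule A.real_cond_exp_charact)
  moreover have "AE \<omega> in M. real_cond_exp M A' (\<lambda>\<omega>. indicator B (Z' \<omega>)) \<omega> = h (Z \<omega>)"
    using key subA' int1 int2 measurable_compose[OF ZA' h]
    by (intro A'.real_cond_exp_charact) (auto simp: subalgebra_def)
  ultimately show ?thesis unfolding A'_def by auto
qed

end

section \<open>Interpolation and Poisson tails\<close>

text \<open>
The Vandermonde system with distinct nodes is invertible: the row \<open>q\<close> that picks out \<open>v\<close> consists of the
coefficients of the Lagrange basis polynomial at \<open>v\<close>, whose degree is \<open>card V - 1\<close>.
\<close>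

lemma moments_invertible:
  fixes x :: "'b \<Rightarrow> real"
  assumes V: "finite V" "inj_on x V" and v: "v \<in> V"
  shows "\<exists>q :: nat \<Rightarrow> real. \<forall>w\<in>V. (\<Sum>l<card V. q l * x w ^ l) = (if w = v then 1 else 0)"
proof -
  define q where "q = (\<Prod>w\<in>V - {v}. smult (inverse (x v - x w)) [:- x w, 1:])"
  have "degree q \<le> (\<Sum>w\<in>V - {v}. degree (smult (inverse (x v - x w)) [:- x w, 1:]))"
    unfolding q_def using degree_prod_sum_le[of "V - {v}" "\<lambda>w. smult (inverse (x v - x w)) [:- x w, 1:]"] V
    by (simp add: comp_def)
  also have "\<dots> \<le> (\<Sum>w\<in>V - {v}. 1)"
    by (intro sum_mono) (auto intro: order_trans[OF degree_smult_le])
  also have "\<dots> = card V - 1"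
    using V v by simp
  finally have deg: "degree q \<le> card V - 1" .
  have card: "0 < card V" using V v by (auto simp: card_gt_0_iff)
  have "(\<Sum>l<card V. coeff q l * x w ^ l) = (if w = v then 1 else 0)" if w: "w \<in> V" for w
  proof -
    have "(\<Sum>l<card V. coeff q l * x w ^ l) = poly q (x w)"
      unfolding poly_altdef using deg card
      by (intro sum.mono_neutral_right) (auto simp: coeff_eq_0)
    also have "\<dots> = (\<Prod>u\<in>V - {v}. inverse (x v - x u) * (x w - x u))"
      unfolding q_def poly_prod by (simp add: algebra_simps)
    also have "\<dots> = (if w = v then 1 else 0)"
    proof (cases "w = v")
      case True
      have "inverse (x v - x u) * (x v - x u) = 1" if "u \<in> V - {v}" for u
        using that V(2) v by (intro left_inverse) (auto simp: inj_on_def)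
      then show ?thesis using True by (simp add: prod.neutral)
    next
      case False
      then show ?thesis using V(1) w by (auto intro!: prod_zero)
    qed
    finally show ?thesis .
  qed
  then show ?thesis by blast
qed

text \<open>
The bound is quadratic in the rate, so a sum over \<open>2\<^sup>n\<close> intervals of length \<open>t / 2\<^sup>n\<close> vanishes as
\<open>n\<close> grows; this is what excludes multiple jumps of the counting process.
\<close>

lemma poisson_two_or_more:
  assumes "0 < x"
  shows "measure (measure_pmf (poisson_pmf x)) {2..} \<le> x\<^sup>2"
proof -
  have "measure (measure_pmf (poisson_pmf x)) {2..} = 1 - measure (measure_pmf (poisson_pmf x)) {0, 1}"
  proof -
    have "{2..} = UNIV - {0, 1::nat}" by auto
    then show ?thesis
      using measure_pmf.prob_compl[of "{0, 1}" "poisson_pmf x"] by simp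
  qed
  also have "measure (measure_pmf (poisson_pmf x)) {0, 1} = exp (- x) + x * exp (- x)"
    using assms by (subst measure_measure_pmf_finite) auto
  also have "1 - (exp (- x) + x * exp (- x)) = 1 - (1 + x) * exp (- x)"
    by (simp add: algebra_simps)
  also have "\<dots> \<le> 1 - (1 + x) * (1 - x)"
    using assms exp_ge_add_one_self[of "- x"] by (intro diff_left_mono mult_left_mono) auto
  also have "\<dots> = x\<^sup>2" by (simp add: algebra_simps power2_eq_square)
  finally show ?thesis .
qed

context poisson_disorder
begin

section \<open>The independent sources\<close>

definition src :: "source \<Rightarrow> 'a measure" where
  "src i = (case i of
      Start \<Rightarrow> vimage_algebra (space M) X\<^sub>0 borel
    | Count \<Rightarrow> generated_algebra (space M) {0..} N (count_space UNIV)
    | Mark k \<Rightarrow> vimage_algebra (space M) (Y k) borel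
    | Change \<Rightarrow> vimage_algebra (space M) \<theta> borel
    | Rate \<Rightarrow> vimage_algebra (space M) \<Lambda> borel)"

definition all_sources :: "source set" where
  "all_sources = {Start, Count, Change, Rate} \<union> Mark ` {1..}"

text \<open>
What a set of sources generates jointly; disjoint sets of sources give independent \<open>\<sigma>\<close>-algebras.
\<close>

definition alg :: "source set \<Rightarrow> 'a measure" where
  "alg J = sigma (space M) (\<Union>i\<in>J. sets (src i))"

lemma indep_src: "indep_sets (\<lambda>i. sets (src i)) all_sources"
proof -
  have eq: "(\<lambda>i. sets (src i)) = (\<lambda>i. case i of
                 Start \<Rightarrow> sets (vimage_algebra (space M) X\<^sub>0 borel)
               | Count \<Rightarrow> sets (generated_algebra (space M) {0..} N (count_space UNIV))
               | Mark k \<Rightarrow> sets (vimage_algebra (space M) (Y k) borel)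
               | Change \<Rightarrow> sets (vimage_algebra (space M) \<theta> borel)
               | Rate \<Rightarrow> sets (vimage_algebra (space M) \<Lambda> borel))"
    by (auto simp: src_def fun_eq_iff split: source.split)
  show ?thesis
    unfolding eq all_sources_def by (rule indep)
qed

lemma space_src [simp]: "space (src i) = space M"
  by (simp add: src_def split: source.split)

lemma sets_src_subset: "i \<in> all_sources \<Longrightarrow> sets (src i) \<subseteq> events"
  using indep_src by (auto simp: indep_sets_def)

lemma space_alg [simp]: "space (alg J) = space M"
  unfolding alg_def using sets.sets_into_space[of _ "src _"] by (intro space_measure_of) auto

lemma sets_alg: "sets (alg J) = sigma_sets (space M) (\<Union>i\<in>J. sets (src i))"
  unfolding alg_def using sets.sets_into_space[of _ "src _"] by (intro sets_measure_of) auto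

lemma subalgebra_alg: "J \<subseteq> all_sources \<Longrightarrow> subalgebra M (alg J)"
  unfolding subalgebra_def sets_alg using sets_src_subset
  by (intro conjI space_alg sets.sigma_sets_subset) blast

lemma sets_alg_mono: "J \<subseteq> J' \<Longrightarrow> sets (alg J) \<subseteq> sets (alg J')"
  unfolding sets_alg by (intro sigma_sets_mono') auto

lemma indep_alg:
  assumes J: "J \<subseteq> all_sources" "J' \<subseteq> all_sources" "J \<inter> J' = {}"
    and A: "A \<in> sets (alg J)" and B: "B \<in> sets (alg J')"
  shows "prob (A \<inter> B) = prob A * prob B"
proof -
  let ?I = "case_bool J J'"
  have "indep_sets (\<lambda>b. sigma_sets (space M) (\<Union>i\<in>?I b. sets (src i))) UNIV"
  proof (rule indep_sets_collect_sigma)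
    show "indep_sets (\<lambda>i. sets (src i)) (\<Union>b\<in>UNIV. ?I b)"
      using indep_src J by (auto intro: indep_sets_mono_index simp: UNIV_bool)
    show "disjoint_family_on ?I UNIV"
      using J by (auto simp: disjoint_family_on_def split: bool.splits)
  qed (auto intro: sets.Int_stable)
  from indep_setsD[OF this, of UNIV "case_bool A B"] A B
  show ?thesis
    by (simp add: UNIV_bool sets_alg Int_commute mult.commute)
qed

lemma measurable_from_alg:
  "f \<in> src i \<rightarrow>\<^sub>M S \<Longrightarrow> i \<in> J \<Longrightarrow> f \<in> alg J \<rightarrow>\<^sub>M S"
  by (rule measurable_mono_sets[of f "src i"]) (auto simp: sets_alg)

lemma measurable_Start: "Start \<in> J \<Longrightarrow> X\<^sub>0 \<in> borel_measurable (alg J)"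
  by (rule measurable_from_alg) (auto simp: src_def intro: measurable_vimage_algebra1)

lemma measurable_Mark: "Mark k \<in> J \<Longrightarrow> Y k \<in> borel_measurable (alg J)"
  by (rule measurable_from_alg) (auto simp: src_def intro: measurable_vimage_algebra1)

lemma measurable_Change: "Change \<in> J \<Longrightarrow> \<theta> \<in> borel_measurable (alg J)"
  by (rule measurable_from_alg) (auto simp: src_def intro: measurable_vimage_algebra1)

lemma measurable_Rate: "Rate \<in> J \<Longrightarrow> \<Lambda> \<in> borel_measurable (alg J)"
  by (rule measurable_from_alg) (auto simp: src_def intro: measurable_vimage_algebra1)

lemma measurable_Count: "Count \<in> J \<Longrightarrow> 0 \<le> t \<Longrightarrow> N t \<in> alg J \<rightarrow>\<^sub>M count_space UNIV"
  by (rule measurable_from_alg) (auto simp: src_def intro: measurable_generated_algebra)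

text \<open>
Everything that does not concern the change: it contains the observed filtration, and \<open>N\<close> and the
marks are exactly measurable for it, not just up to null sets.
\<close>

definition obs :: "'a measure" where
  "obs = alg ({Start, Count} \<union> Mark ` {1..})"

lemma subalgebra_obs: "subalgebra M obs"
  unfolding obs_def by (rule subalgebra_alg) (auto simp: all_sources_def)

lemma space_obs [simp]: "space obs = space M"
  by (simp add: obs_def)

lemma obs_events: "sets obs \<subseteq> events"
  using subalgebra_obs by (simp add: subalgebra_def)

abbreviation X where "X \<equiv> compound_process X\<^sub>0 N Y"
abbreviation F where "F \<equiv> natural_filtration (space M) X"

lemma measurable_X_sources:
  assumes "N t \<in> A \<rightarrow>\<^sub>M count_space UNIV" "X\<^sub>0 \<in> borel_measurable A"
    "\<And>k. 1 \<le> k \<Longrightarrow> Y k \<in> borel_measurable A"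
  shows "X t \<in> borel_measurable A"
proof -
  note assms(1,2) [measurable]
  have "(\<lambda>\<omega>. X\<^sub>0 \<omega> + (\<Sum>k = 1..n. Y k \<omega>)) \<in> borel_measurable A" for n
    using assms by (intro borel_measurable_add borel_measurable_sum) auto
  from measurable_compose_countable[OF this assms(1)] show ?thesis
    by (simp add: compound_process_def [abs_def])
qed

lemma measurable_X_obs: "0 \<le> t \<Longrightarrow> X t \<in> borel_measurable obs"
  unfolding obs_def
  by (intro measurable_X_sources measurable_Count measurable_Start measurable_Mark) auto

lemma space_F [simp]: "space (F t) = space M"
  by (simp add: natural_filtration_def)

lemma sets_F_subset_obs: "sets (F t) \<subseteq> sets obs"
  unfolding natural_filtration_def
  by (intro sets_generated_algebra_subset measurable_X_obs) auto

lemma subalgebra_F: "subalgebra M (F t)"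
  using sets_F_subset_obs obs_events by (auto simp: subalgebra_def)

lemma measurable_X: "0 \<le> s \<Longrightarrow> ennreal s \<le> t \<Longrightarrow> X s \<in> borel_measurable (F t)"
  unfolding natural_filtration_def by (intro measurable_generated_algebra) auto

lemma sets_F_mono: "s \<le> t \<Longrightarrow> sets (F s) \<subseteq> sets (F t)"
  unfolding natural_filtration_def [of _ _ s]
  by (intro sets_generated_algebra_subset measurable_X) auto

section \<open>Paths of the counting process\<close>

lemma N_meas: "0 \<le> t \<Longrightarrow> N t \<in> M \<rightarrow>\<^sub>M count_space UNIV"
  using N by (auto simp: poisson_process_def)

lemma N_zero: "\<omega> \<in> space M \<Longrightarrow> N 0 \<omega> = 0"
  using N by (auto simp: poisson_process_def)

lemma N_mono: "\<omega> \<in> space M \<Longrightarrow> 0 \<le> s \<Longrightarrow> s \<le> t \<Longrightarrow> N s \<omega> \<le> N t \<omega>"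
  using N by (auto simp: poisson_process_def mono_on_def)

lemma N_right_constant:
  assumes "\<omega> \<in> space M" "0 \<le> t"
  shows "\<exists>\<delta>>0. \<forall>s. t \<le> s \<and> s < t + \<delta> \<longrightarrow> N s \<omega> = N t \<omega>"
proof -
  have "continuous (at_right t) (\<lambda>s. real (N s \<omega>))"
    using N assms by (auto simp: poisson_process_def)
  then have "((\<lambda>s. real (N s \<omega>)) \<longlongrightarrow> real (N t \<omega>)) (at_right t)"
    by (simp add: continuous_within)
  then have "\<forall>\<^sub>F s in at_right t. dist (real (N s \<omega>)) (real (N t \<omega>)) < 1"
    by (rule tendstoD) simp
  then have "\<forall>\<^sub>F s in at_right t. N s \<omega> = N t \<omega>"
    by (rule eventually_mono) (auto simp: dist_real_def)
  then obtain b where b: "t < b" "\<And>s. t < s \<Longrightarrow> s < b \<Longrightarrow> N s \<omega> = N t \<omega>"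
    by (auto simp: eventually_at_right_field)
  have "N s \<omega> = N t \<omega>" if "t \<le> s" "s < t + (b - t)" for s
  proof (cases "s = t")
    case False
    with that show ?thesis by (intro b(2)) auto
  qed simp
  moreover have "0 < b - t" using b(1) by simp
  ultimately show ?thesis by blast
qed

text \<open>
Right continuity and monotonicity reduce the path of \<open>N\<close> to countably many times, which gives joint
measurability in time and outcome.
\<close>

lemma N_le_iff_rational:
  assumes "\<omega> \<in> space M" "0 \<le> u"
  shows "N u \<omega> \<le> m \<longleftrightarrow> (\<exists>q\<in>\<rat>. u < q \<and> N q \<omega> \<le> m)"
proof
  assume *: "N u \<omega> \<le> m"
  obtain \<delta> where \<delta>: "0 < \<delta>" "\<And>s. u \<le> s \<Longrightarrow> s < u + \<delta> \<Longrightarrow> N s \<omega> = N u \<omega>"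
    using N_right_constant[OF assms] by auto
  obtain q where "q \<in> \<rat>" "u < q" "q < u + \<delta>"
    using Rats_dense_in_real[of u "u + \<delta>"] \<delta> by auto
  with * \<delta>(2)[of q] show "\<exists>q\<in>\<rat>. u < q \<and> N q \<omega> \<le> m"
    by (intro bexI[of _ q]) auto
next
  assume "\<exists>q\<in>\<rat>. u < q \<and> N q \<omega> \<le> m"
  then show "N u \<omega> \<le> m"
    using N_mono[OF assms(1,2)] by (meson less_imp_le order_trans)
qed

lemma prob_two_jumps:
  assumes "0 \<le> s" "s < t"
  shows "prob {\<omega> \<in> space M. 2 \<le> N t \<omega> - N s \<omega>} \<le> (\<mu> * (t - s))\<^sup>2"
proof -
  have [measurable]: "N t \<in> M \<rightarrow>\<^sub>M count_space UNIV" "N s \<in> M \<rightarrow>\<^sub>M count_space UNIV"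
    using assms by (auto intro: N_meas)
  have "prob {\<omega> \<in> space M. 2 \<le> N t \<omega> - N s \<omega>}
      = measure (distr M (count_space UNIV) (\<lambda>\<omega>. N t \<omega> - N s \<omega>)) {2..}"
    by (subst measure_distr) (auto intro!: arg_cong[where f = prob])
  also have "distr M (count_space UNIV) (\<lambda>\<omega>. N t \<omega> - N s \<omega>) = measure_pmf (poisson_pmf (\<mu> * (t - s)))"
    using N assms by (auto simp: poisson_process_def)
  finally show ?thesis
    using poisson_two_or_more[of "\<mu> * (t - s)"] assms \<mu>_pos by simp
qed

abbreviation grid :: "real \<Rightarrow> nat \<Rightarrow> nat \<Rightarrow> real" where
  "grid t n i \<equiv> t * real i / 2 ^ n"

text \<open>
By Borel--Cantelli: at level \<open>n\<close> some dyadic increment is at least two with probability of order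
\<open>2\<^sup>-\<^sup>n\<close>. Stating this for the increments over the grid, rather than for the jumps of the path, is
the form in which it is used to read off the marks from \<open>X\<close>.
\<close>

lemma AE_unit_jumps:
  assumes "0 \<le> t"
  shows "AE \<omega> in M. \<forall>\<^sub>F n in sequentially. \<forall>i<2^n. N (grid t n (Suc i)) \<omega> \<le> Suc (N (grid t n i) \<omega>)"
proof (cases "t = 0")
  case True
  then show ?thesis by simp
next
  case False
  with assms have t: "0 < t" by simp
  define B where "B n i = {\<omega> \<in> space M. 2 \<le> N (grid t n (Suc i)) \<omega> - N (grid t n i) \<omega>}" for n i
  have [measurable]: "N (grid t n i) \<in> M \<rightarrow>\<^sub>M count_space UNIV" for n i
    using t by (intro N_meas) auto
  have B [measurable]: "B n i \<in> events" for n i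
    unfolding B_def by measurable
  have B_le: "prob (B n i) \<le> (\<mu> * t)\<^sup>2 * (1/4) ^ n" for n i
  proof -
    have "prob (B n i) \<le> (\<mu> * (grid t n (Suc i) - grid t n i))\<^sup>2"
      unfolding B_def using t by (intro prob_two_jumps) (auto simp: field_simps)
    also have "grid t n (Suc i) - grid t n i = t / 2 ^ n"
      by (simp add: field_simps)
    also have "(\<mu> * (t / 2 ^ n))\<^sup>2 = (\<mu> * t)\<^sup>2 * (1/4) ^ n"
      by (simp add: power_divide power_mult_distrib power_mult[symmetric] mult.commute[of n 2])
        (simp add: power_mult)
    finally show ?thesis .
  qed
  have U_le: "prob (\<Union>i<2^n. B n i) \<le> (\<mu> * t)\<^sup>2 * (1/2) ^ n" for n
  proof -
    have "prob (\<Union>i<2^n. B n i) \<le> (\<Sum>i<(2::nat)^n. prob (B n i))"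
      by (rule finite_measure_subadditive_finite) auto
    also have "\<dots> \<le> (\<Sum>i<(2::nat)^n. (\<mu> * t)\<^sup>2 * (1/4) ^ n)"
      by (intro sum_mono B_le)
    also have "\<dots> = (\<mu> * t)\<^sup>2 * (2 ^ n * (1/4) ^ n)"
      by simp
    also have "(2::real) ^ n * (1/4) ^ n = (1/2) ^ n"
      by (simp add: power_mult_distrib[symmetric])
    finally show ?thesis .
  qed
  have "summable (\<lambda>n. prob (\<Union>i<2^n. B n i))"
  proof (rule summable_comparison_test)
    show "summable (\<lambda>n. (\<mu> * t)\<^sup>2 * (1/2) ^ n)"
      by (intro summable_mult summable_geometric) auto
    show "\<exists>N. \<forall>n\<ge>N. norm (prob (\<Union>i<2^n. B n i)) \<le> (\<mu> * t)\<^sup>2 * (1/2) ^ n"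
      using U_le by auto
  qed
  then have "AE \<omega> in M. \<forall>\<^sub>F n in sequentially. \<omega> \<in> space M - (\<Union>i<2^n. B n i)"
    by (intro borel_cantelli_AE1) (auto simp: less_top[symmetric])
  then show ?thesis
  proof (rule AE_mp, intro AE_I2 impI)
    fix \<omega> assume \<omega>: "\<omega> \<in> space M" and *: "\<forall>\<^sub>F n in sequentially. \<omega> \<in> space M - (\<Union>i<2^n. B n i)"
    from * show "\<forall>\<^sub>F n in sequentially. \<forall>i<2^n. N (grid t n (Suc i)) \<omega> \<le> Suc (N (grid t n i) \<omega>)"
      by (rule eventually_mono) (use \<omega> in \<open>fastforce simp: B_def not_le\<close>)
  qed
qed

lemma AE_marks_pos: "AE \<omega> in M. \<forall>k\<ge>1. \<forall>i. 0 < Y k \<omega> $ i"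
proof -
  have "AE \<omega> in M. 1 \<le> k \<longrightarrow> (\<forall>i. 0 < Y k \<omega> $ i)" for k
  proof (cases "1 \<le> k")
    case True
    have "AE y in distr M borel (Y k). \<forall>i. 0 < y $ i"
      unfolding Y_distr[OF True] by (rule Y_pos)
    then show ?thesis
      using Y[OF True] by (subst (asm) AE_distr_iff) auto
  qed simp
  then show ?thesis by (simp add: AE_all_countable)
qed

section \<open>The likelihood quotient is determined by the observed path\<close>

definition r :: "real ^ 'd \<Rightarrow> real" where
  "r y = enn2real (RN_deriv \<beta>\<^sub>0 \<beta>\<^sub>1 y)"

lemma sets_\<beta>\<^sub>0 [measurable_cong]: "sets \<beta>\<^sub>0 = sets borel"
  using Y_distr[of 1] by auto

lemma r_meas [measurable]: "r \<in> borel_measurable borel"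
proof -
  have "r \<in> borel_measurable \<beta>\<^sub>0"
    unfolding r_def by measurable
  then show ?thesis by (simp add: measurable_cong_sets[OF sets_\<beta>\<^sub>0 refl])
qed

lemma r_nonneg: "0 \<le> r y"
  by (simp add: r_def)

text \<open>
The quotient \<open>L\<^sub>t / L\<^sub>u\<close> for a known post-change rate \<open>v\<close>; extended-valued, so that it can be integrated
over \<open>u\<close> before anything is known about integrability.
\<close>

definition ell :: "real \<Rightarrow> real \<Rightarrow> real \<Rightarrow> 'a \<Rightarrow> ennreal" where
  "ell v t u \<omega> = ennreal (likelihood_quotient \<mu> r N Y (\<lambda>_. v) u t \<omega>)"

definition jump_factor :: "real \<Rightarrow> real ^ 'd \<Rightarrow> real" where
  "jump_factor v x = (if x = 0 then 1 else v / \<mu> * r x)"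

text \<open>
An approximation of the likelihood quotient that looks at \<open>X\<close> only. An increment of \<open>X\<close> over a grid
interval with at most one jump is zero or a mark; a zero increment contributes the factor one. Only
intervals that start at or after \<open>u\<close> count, so the grid can be the same for all \<open>u\<close>, which keeps joint
measurability in \<open>u\<close> elementary.
\<close>

definition grid_quotient :: "real \<Rightarrow> real \<Rightarrow> nat \<Rightarrow> real \<Rightarrow> 'a \<Rightarrow> real" where
  "grid_quotient v t n u \<omega> = exp (- (v - \<mu>) * (t - u)) *
     (\<Prod>i<2^n. if u \<le> grid t n i then jump_factor v (X (grid t n (Suc i)) \<omega> - X (grid t n i) \<omega>) else 1)"

lemma X_increment:
  assumes "N s \<omega> \<le> N t \<omega>"
  shows "X t \<omega> - X s \<omega> = (\<Sum>k\<in>{N s \<omega><..N t \<omega>}. Y k \<omega>)"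
proof -
  have split: "{1..N t \<omega>} = {1..N s \<omega>} \<union> {N s \<omega><..N t \<omega>}"
    using assms by auto
  have "(\<Sum>k = 1..N t \<omega>. Y k \<omega>) = (\<Sum>k = 1..N s \<omega>. Y k \<omega>) + (\<Sum>k\<in>{N s \<omega><..N t \<omega>}. Y k \<omega>)"
    unfolding split by (rule sum.union_disjoint) auto
  then show ?thesis by (simp add: compound_process_def)
qed

text \<open>
On a path with nonzero marks and unit increments over fine grids, the product runs over the right marks.
The grid interval that contains \<open>u\<close> in its interior is left out, but by right continuity nothing happens
between \<open>u\<close> and the next grid point once the mesh is small.
\<close>

lemma grid_quotient_eventually:
  assumes \<omega>: "\<omega> \<in> space M" and u: "0 \<le> u" "u \<le> t"
    and unit: "\<forall>\<^sub>F n in sequentially. \<forall>i<2^n. N (grid t n (Suc i)) \<omega> \<le> Suc (N (grid t n i) \<omega>)"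
    and pos: "\<forall>k\<ge>1. \<forall>i. 0 < Y k \<omega> $ i"
  shows "\<forall>\<^sub>F n in sequentially. ennreal (grid_quotient v t n u \<omega>) = ell v t u \<omega>"
proof -
  obtain \<delta> where \<delta>: "0 < \<delta>" "\<And>s. u \<le> s \<Longrightarrow> s < u + \<delta> \<Longrightarrow> N s \<omega> = N u \<omega>"
    using N_right_constant[OF \<omega> u(1)] by auto
  have "(\<lambda>n. t * (1/2) ^ n) \<longlonglongrightarrow> t * 0"
    by (intro tendsto_mult tendsto_const LIMSEQ_power_zero) auto
  then have "\<forall>\<^sub>F n in sequentially. t * (1/2) ^ n < \<delta>"
    using \<delta>(1) by (intro order_tendstoD) auto
  with unit show ?thesis
  proof eventually_elim
    fix n assume unit: "\<forall>i<2^n. N (grid t n (Suc i)) \<omega> \<le> Suc (N (grid t n i) \<omega>)"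
      and mesh: "t * (1/2) ^ n < \<delta>"
    have g0: "0 \<le> grid t n i" for i using u by simp
    have g_step: "grid t n (Suc i) = grid t n i + t * (1/2) ^ n" for i
      by (simp add: field_simps power_divide)
    have t0: "0 \<le> t * (1/2) ^ n" using u by simp
    \<comment> \<open>After \<open>m\<close> grid intervals the product has collected the marks in \<open>(u, max u (grid t n m)]\<close>.\<close>
    have "(\<Prod>i<m. if u \<le> grid t n i then jump_factor v (X (grid t n (Suc i)) \<omega> - X (grid t n i) \<omega>) else 1)
       = (\<Prod>k\<in>{N u \<omega><..N (max u (grid t n m)) \<omega>}. v / \<mu> * r (Y k \<omega>))" if "m \<le> 2 ^ n" for m
      using that
    proof (induction m)
      case 0
      then show ?case using u by simp
    next
      case (Suc m)
      show ?case
      proof (cases "u \<le> grid t n m")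
        case True
        let ?a = "N (grid t n m) \<omega>" and ?b = "N (grid t n (Suc m)) \<omega>"
        have ab: "?a \<le> ?b" using \<omega> g0 g_step[of m] t0 by (intro N_mono) auto
        have ua: "N u \<omega> \<le> ?a" using True \<omega> u by (intro N_mono) auto
        have mx: "max u (grid t n m) = grid t n m" "max u (grid t n (Suc m)) = grid t n (Suc m)"
          using True g_step[of m] t0 by auto
        have b: "?b = ?a \<or> ?b = Suc ?a"
          using unit[rule_format, of m] Suc.prems ab by auto
        have "(\<Prod>k\<in>{N u \<omega><..?b}. v / \<mu> * r (Y k \<omega>))
            = (\<Prod>k\<in>{N u \<omega><..?a}. v / \<mu> * r (Y k \<omega>)) * jump_factor v (X (grid t n (Suc m)) \<omega> - X (grid t n m) \<omega>)"
          using b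
        proof
          assume "?b = ?a"
          then show ?thesis
            using X_increment[OF ab] by (simp add: jump_factor_def)
        next
          assume bS: "?b = Suc ?a"
          then have "{?a<..?b} = {Suc ?a}" by auto
          then have inc: "X (grid t n (Suc m)) \<omega> - X (grid t n m) \<omega> = Y (Suc ?a) \<omega>"
            using X_increment[OF ab] by simp
          have "Y (Suc ?a) \<omega> \<noteq> 0"
            using pos[rule_format, of "Suc ?a" undefined] by auto
          moreover have "{N u \<omega><..?b} = insert (Suc ?a) {N u \<omega><..?a}"
            using bS ua by auto
          ultimately show ?thesis
            unfolding inc by (simp add: jump_factor_def mult.commute)
        qed
        then show ?thesis
          using Suc True mx by simp
      next
        case False
        have "N (max u (grid t n (Suc m))) \<omega> = N u \<omega>"
          using False g_step[of m] mesh by (intro \<delta>(2)) (auto simp: max_def \<delta>(1))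
        moreover have "N (max u (grid t n m)) \<omega> = N u \<omega>"
          using False by (simp add: max_def)
        ultimately show ?thesis
          using Suc False by simp
      qed
    qed
    from this[of "2^n"] u show "ennreal (grid_quotient v t n u \<omega>) = ell v t u \<omega>"
      by (simp add: grid_quotient_def ell_def likelihood_quotient_def max_def)
  qed
qed

text \<open>
The lower limit always exists in \<^typ>\<open>ennreal\<close>, so this is defined on every path and measurable for the
filtration as it stands, without adding null sets.
\<close>

definition path_quotient :: "real \<Rightarrow> real \<Rightarrow> real \<Rightarrow> 'a \<Rightarrow> ennreal" where
  "path_quotient v t u \<omega> = liminf (\<lambda>n. ennreal (grid_quotient v t n u \<omega>))"

lemma AE_path_quotient:
  assumes "0 \<le> t"
  shows "AE \<omega> in M. \<forall>u\<in>{0..t}. \<forall>v. path_quotient v t u \<omega> = ell v t u \<omega>"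
  using AE_unit_jumps[OF assms] AE_marks_pos AE_space
proof eventually_elim
  fix \<omega> assume *: "\<forall>\<^sub>F n in sequentially. \<forall>i<2^n. N (grid t n (Suc i)) \<omega> \<le> Suc (N (grid t n i) \<omega>)"
    "\<forall>k\<ge>1. \<forall>i. 0 < Y k \<omega> $ i" "\<omega> \<in> space M"
  show "\<forall>u\<in>{0..t}. \<forall>v. path_quotient v t u \<omega> = ell v t u \<omega>"
  proof (intro ballI allI)
    fix u v assume "u \<in> {0..t}"
    then have "\<forall>\<^sub>F n in sequentially. ennreal (grid_quotient v t n u \<omega>) = ell v t u \<omega>"
      using * by (intro grid_quotient_eventually) auto
    then have "(\<lambda>n. ennreal (grid_quotient v t n u \<omega>)) \<longlonglongrightarrow> ell v t u \<omega>"
      by (rule tendsto_eventually)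
    then show "path_quotient v t u \<omega> = ell v t u \<omega>"
      unfolding path_quotient_def by (intro lim_imp_Liminf) auto
  qed
qed

lemma jump_factor_meas [measurable]: "jump_factor v \<in> borel_measurable borel"
proof -
  have "jump_factor v = (\<lambda>x. if x \<in> {0} then 1 else v / \<mu> * r x)"
    by (rule ext) (simp only: jump_factor_def singleton_iff)
  also have "\<dots> \<in> borel_measurable borel"
  proof (rule measurable_If_set)
    show "(\<lambda>x. v / \<mu> * r x) \<in> borel_measurable borel"
      by (intro borel_measurable_times borel_measurable_const r_meas)
    show "{0} \<inter> space borel \<in> sets (borel :: (real ^ 'd) measure)"
      by (simp only: space_borel Int_UNIV_right borel_singleton sets.empty_sets)
  qed (rule borel_measurable_const)
  finally show ?thesis .
qed

lemma measurable_path_quotient: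
  assumes "0 \<le> t"
  shows "(\<lambda>(\<omega>, u). path_quotient v t u \<omega>) \<in> borel_measurable (F (ennreal t) \<Otimes>\<^sub>M borel)"
proof -
  have X: "X (grid t n i) \<in> borel_measurable (F (ennreal t))" if "i \<le> 2 ^ n" for n i
  proof (rule measurable_X)
    have "real i \<le> real (2 ^ n)" using that by (simp only: of_nat_le_iff)
    then have "real i \<le> 2 ^ n" by simp
    then have "grid t n i \<le> t"
      using mult_left_mono[of "real i" "2 ^ n" t] assms by (simp add: field_simps)
    then show "ennreal (grid t n i) \<le> ennreal t" by (rule ennreal_leI)
  qed (use assms in auto)
  have G [measurable]: "(\<lambda>(\<omega>, u). grid_quotient v t n u \<omega>) \<in> borel_measurable (F (ennreal t) \<Otimes>\<^sub>M borel)" for n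
  proof -
    have *: "(\<lambda>z. if snd z \<le> grid t n i
           then jump_factor v (X (grid t n (Suc i)) (fst z) - X (grid t n i) (fst z)) else 1)
        \<in> borel_measurable (F (ennreal t) \<Otimes>\<^sub>M borel)" if "i \<in> {..<2^n}" for i
    proof -
      have [measurable]: "X (grid t n i) \<in> borel_measurable (F (ennreal t))"
        "X (grid t n (Suc i)) \<in> borel_measurable (F (ennreal t))"
        using that by (simp_all only: X lessThan_iff Suc_le_eq less_imp_le)
      show ?thesis by measurable
    qed
    have [measurable]: "(\<lambda>z. \<Prod>i<2^n. if snd z \<le> grid t n i
           then jump_factor v (X (grid t n (Suc i)) (fst z) - X (grid t n i) (fst z)) else 1)
        \<in> borel_measurable (F (ennreal t) \<Otimes>\<^sub>M borel)"
      by (rule borel_measurable_prod) (rule *)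
    show ?thesis
      unfolding grid_quotient_def split_beta' by measurable
  qed
  then show ?thesis
    unfolding path_quotient_def split_beta' by measurable
qed

end

section \<open>Joint measurability and multiplicativity of the likelihood quotient\<close>

lemma measurable_nat_le:
  fixes f :: "'z \<Rightarrow> nat"
  assumes "\<And>m. {z \<in> space A. f z \<le> m} \<in> sets A"
  shows "f \<in> A \<rightarrow>\<^sub>M count_space UNIV"
proof (subst measurable_count_space_eq2_countable, intro conjI ballI)
  fix n :: nat
  have "f -` {n} \<inter> space A = {z \<in> space A. f z \<le> n} - (\<Union>m<n. {z \<in> space A. f z \<le> m})"
    by (auto simp: le_less not_le)
  also have "\<dots> \<in> sets A"
    using assms by (intro sets.Diff sets.finite_UN) auto
  finally show "f -` {n} \<inter> space A \<in> sets A" .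
qed auto

context poisson_disorder
begin

text \<open>
Stated for increments after \<open>s\<close> and any \<open>\<sigma>\<close>-algebra that measures them, so that it serves both for the
full information (\<open>s = 0\<close>) and for the future after \<open>s\<close>.
\<close>

lemma measurable_count_joint:
  assumes A: "space A = space M" and s: "0 \<le> s"
    and N: "\<And>q. s \<le> q \<Longrightarrow> (\<lambda>\<omega>. N q \<omega> - N s \<omega>) \<in> A \<rightarrow>\<^sub>M count_space UNIV"
  shows "(\<lambda>(\<omega>, u). N (max s u) \<omega> - N s \<omega>) \<in> A \<Otimes>\<^sub>M borel \<rightarrow>\<^sub>M count_space UNIV"
proof (rule measurable_nat_le)
  fix m
  let ?B = "\<lambda>q. {\<omega> \<in> space A. N q \<omega> - N s \<omega> \<le> m} \<times> {u. max s u < q}"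
  have "{z \<in> space (A \<Otimes>\<^sub>M borel). (case z of (\<omega>, u) \<Rightarrow> N (max s u) \<omega> - N s \<omega>) \<le> m}
      = (\<Union>q\<in>\<rat> \<inter> {s<..}. ?B q)" (is "?L = ?R")
  proof (intro set_eqI iffI)
    fix z assume "z \<in> ?L"
    then obtain \<omega> u where z: "z = (\<omega>, u)" "\<omega> \<in> space M" "N (max s u) \<omega> \<le> m + N s \<omega>"
      using A by (auto simp: space_pair_measure)
    have "0 \<le> max s u" using s by simp
    then obtain q where "q \<in> \<rat>" "max s u < q" "N q \<omega> \<le> m + N s \<omega>"
      using iffD1[OF N_le_iff_rational[OF z(2)] z(3)] by blast
    then show "z \<in> ?R" using z(1,2) A by (intro UN_I[of q]) auto
  next
    fix z assume "z \<in> ?R"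
    then obtain \<omega> u q where z: "z = (\<omega>, u)" "\<omega> \<in> space M" "q \<in> \<rat>" "max s u < q" "N q \<omega> - N s \<omega> \<le> m"
      using A by auto
    then have "N (max s u) \<omega> \<le> N q \<omega>"
      using s by (intro N_mono) auto
    then show "z \<in> ?L" using z A by (auto simp: space_pair_measure)
  qed
  also have "\<dots> \<in> sets (A \<Otimes>\<^sub>M borel)"
  proof (intro sets.countable_UN'' pair_measureI)
    show "countable (\<rat> \<inter> {s<..})" using countable_rat by blast
    fix q assume "q \<in> \<rat> \<inter> {s<..}"
    then have [measurable]: "(\<lambda>\<omega>. N q \<omega> - N s \<omega>) \<in> A \<rightarrow>\<^sub>M count_space UNIV"
      by (intro N) auto
    show "{\<omega> \<in> space A. N q \<omega> - N s \<omega> \<le> m} \<in> sets A" by measurable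
    show "{u. max s u < q} \<in> sets borel" by measurable
  qed
  finally show "{z \<in> space (A \<Otimes>\<^sub>M borel). (case z of (\<omega>, u) \<Rightarrow> N (max s u) \<omega> - N s \<omega>) \<le> m}
    \<in> sets (A \<Otimes>\<^sub>M borel)" .
qed

lemma measurable_mark_product:
  assumes K1: "K1 \<in> A \<rightarrow>\<^sub>M count_space UNIV" and K2: "K2 \<in> A \<rightarrow>\<^sub>M count_space UNIV"
    and y: "\<And>i. y i \<in> borel_measurable A"
  shows "(\<lambda>z. \<Prod>i\<in>{K1 z..<K2 z :: nat}. w * r (y i z)) \<in> borel_measurable A"
proof -
  have "(\<lambda>z. \<Prod>i\<in>{a..<b}. w * r (y i z)) \<in> borel_measurable A" for a b
    by (intro borel_measurable_prod borel_measurable_times borel_measurable_const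
        measurable_compose[OF y r_meas])
  from measurable_compose_countable[OF this K1]
  have "(\<lambda>z. \<Prod>i\<in>{K1 z..<b}. w * r (y i z)) \<in> borel_measurable A" for b .
  from measurable_compose_countable[OF this K2] show ?thesis .
qed

lemma likelihood_quotient_shift:
  "likelihood_quotient \<mu> r N Y (\<lambda>_. v) u t \<omega> =
     exp (- (v - \<mu>) * (t - u)) * (\<Prod>i\<in>{N u \<omega>..<N t \<omega>}. v / \<mu> * r (Y (Suc i) \<omega>))"
proof -
  have "{N u \<omega><..N t \<omega>} = Suc ` {N u \<omega>..<N t \<omega>}"
    by (simp only: image_Suc_atLeastLessThan atLeastLessThanSuc_atLeastAtMost[symmetric]) auto
  then show ?thesis
    unfolding likelihood_quotient_def by (simp only: prod.reindex inj_Suc comp_def)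
qed

lemma likelihood_quotient_nonneg: "0 \<le> v \<Longrightarrow> 0 \<le> likelihood_quotient \<mu> r N Y (\<lambda>_. v) u t \<omega>"
  unfolding likelihood_quotient_def using \<mu>_pos r_nonneg
  by (intro mult_nonneg_nonneg prod_nonneg) auto

text \<open>
The marks in \<open>(u, t]\<close> split into those in \<open>(u, s]\<close> and those in \<open>(s, t]\<close>. With cancelled quotients
this holds even where the likelihood at \<open>s\<close> vanishes.
\<close>

lemma ell_chain:
  assumes "\<omega> \<in> space M" "0 \<le> u" "u \<le> s" "s \<le> t" "0 \<le> v"
  shows "ell v t u \<omega> = ell v t s \<omega> * ell v s u \<omega>"
proof -
  have le: "N u \<omega> \<le> N s \<omega>" "N s \<omega> \<le> N t \<omega>"
    using assms by (auto intro: N_mono)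
  have "{N u \<omega><..N t \<omega>} = {N u \<omega><..N s \<omega>} \<union> {N s \<omega><..N t \<omega>}"
    using le by auto
  then have "(\<Prod>k\<in>{N u \<omega><..N t \<omega>}. v / \<mu> * r (Y k \<omega>)) =
      (\<Prod>k\<in>{N u \<omega><..N s \<omega>}. v / \<mu> * r (Y k \<omega>)) * (\<Prod>k\<in>{N s \<omega><..N t \<omega>}. v / \<mu> * r (Y k \<omega>))"
    by (simp only:) (rule prod.union_disjoint, auto)
  moreover have "exp (- (v - \<mu>) * (t - u)) = exp (- (v - \<mu>) * (t - s)) * exp (- (v - \<mu>) * (s - u))"
    by (simp flip: exp_add add: algebra_simps)
  ultimately have "likelihood_quotient \<mu> r N Y (\<lambda>_. v) u t \<omega> =
      likelihood_quotient \<mu> r N Y (\<lambda>_. v) s t \<omega> * likelihood_quotient \<mu> r N Y (\<lambda>_. v) u s \<omega>"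
    unfolding likelihood_quotient_def by (simp only: ac_simps)
  then show ?thesis
    unfolding ell_def using likelihood_quotient_nonneg[OF assms(5)] by (simp add: ennreal_mult)
qed

lemma measurable_ell:
  assumes "0 \<le> t"
  shows "(\<lambda>(\<omega>, u). ell v t u \<omega> * indicator {0..t} u) \<in> borel_measurable (obs \<Otimes>\<^sub>M borel)"
proof -
  have Nobs: "N q \<in> obs \<rightarrow>\<^sub>M count_space UNIV" if "0 \<le> q" for q
    unfolding obs_def using that by (intro measurable_Count) auto
  have K1: "(\<lambda>z. N (max 0 (snd z)) (fst z)) \<in> obs \<Otimes>\<^sub>M borel \<rightarrow>\<^sub>M count_space UNIV"
  proof -
    have "(\<lambda>(\<omega>, u). N (max 0 u) \<omega> - N 0 \<omega>) \<in> obs \<Otimes>\<^sub>M borel \<rightarrow>\<^sub>M count_space UNIV"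
    proof (rule measurable_count_joint)
      fix q :: real assume "0 \<le> q"
      note Nobs[OF this, measurable] Nobs[of 0, measurable]
      show "(\<lambda>\<omega>. N q \<omega> - N 0 \<omega>) \<in> obs \<rightarrow>\<^sub>M count_space UNIV" by measurable
    qed auto
    then show ?thesis
      by (subst (asm) measurable_cong[where g = "\<lambda>z. N (max 0 (snd z)) (fst z)"])
        (auto simp: space_pair_measure N_zero)
  qed
  have K2: "(\<lambda>z. N t (fst z)) \<in> obs \<Otimes>\<^sub>M borel \<rightarrow>\<^sub>M count_space UNIV"
    by (rule measurable_compose[OF measurable_fst Nobs[OF assms]])
  have y: "(\<lambda>z. Y (Suc i) (fst z)) \<in> borel_measurable (obs \<Otimes>\<^sub>M borel)" for i
    by (rule measurable_compose[OF measurable_fst], unfold obs_def, rule measurable_Mark) auto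
  define Q where "Q = (\<lambda>z. \<Prod>i\<in>{N (max 0 (snd z)) (fst z)..<N t (fst z)}. v / \<mu> * r (Y (Suc i) (fst z)))"
  have [measurable]: "Q \<in> borel_measurable (obs \<Otimes>\<^sub>M borel)"
    unfolding Q_def using K1 K2 y by (rule measurable_mark_product)
  have "(\<lambda>z. ennreal (exp (- (v - \<mu>) * (t - snd z)) * Q z) * indicator {0..t} (snd z))
      \<in> borel_measurable (obs \<Otimes>\<^sub>M borel)"
    by measurable
  also have "?this \<longleftrightarrow> ?thesis"
    by (intro measurable_cong)
      (auto simp: Q_def ell_def likelihood_quotient_shift max_def split: split_indicator)
  finally show ?thesis .
qed

section \<open>The posterior odds of each post-change rate\<close>

definition \<eta> :: "real measure" where "\<eta> = distr M borel \<theta>"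

lemma prob_space_\<eta>: "prob_space \<eta>"
  unfolding \<eta>_def using \<theta>(1) by (rule prob_space_distr)

lemma sets_\<eta> [measurable_cong, simp]: "sets \<eta> = sets borel" and space_\<eta> [simp]: "space \<eta> = UNIV"
  by (simp_all add: \<eta>_def)

lemma sets_\<gamma> [measurable_cong, simp]: "sets \<gamma> = sets borel" and space_\<gamma> [simp]: "space \<gamma> = UNIV"
  using \<Lambda>_distr by (auto dest: arg_cong[of _ _ sets] arg_cong[of _ _ space])

lemma prob_space_\<gamma>: "prob_space \<gamma>"
  unfolding \<Lambda>_distr[symmetric] using \<Lambda> by (rule prob_space_distr)

text \<open>
The unnormalised posterior weight of \<open>\<Lambda> = v\<close> together with a change by time \<open>t\<close>.
\<close>

definition odds_mass :: "real \<Rightarrow> real \<Rightarrow> 'a \<Rightarrow> ennreal" where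
  "odds_mass v t \<omega> = ennreal (measure \<gamma> {v}) * (\<integral>\<^sup>+u. ell v t u \<omega> * indicator {0..t} u \<partial>\<eta>)"

text \<open>
The part of the weight that stems from a change in \<open>(s, t]\<close>.
\<close>

definition odds_input :: "real \<Rightarrow> real \<Rightarrow> real \<Rightarrow> 'a \<Rightarrow> ennreal" where
  "odds_input v s t \<omega> = ennreal (measure \<gamma> {v}) * (\<integral>\<^sup>+u. ell v t u \<omega> * indicator {s<..t} u \<partial>\<eta>)"

text \<open>
The version of \<open>odds_mass\<close> that is measurable for the observed filtration.
\<close>

definition path_odds_mass :: "real \<Rightarrow> real \<Rightarrow> 'a \<Rightarrow> ennreal" where
  "path_odds_mass v t \<omega> = ennreal (measure \<gamma> {v}) * (\<integral>\<^sup>+u. path_quotient v t u \<omega> * indicator {0..t} u \<partial>\<eta>)"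

lemma measurable_ell_section:
  assumes "0 \<le> t" "\<omega> \<in> space M"
  shows "(\<lambda>u. ell v t u \<omega> * indicator {0..t} u) \<in> borel_measurable borel"
  using measurable_compose[OF measurable_Pair1' measurable_ell[OF assms(1), of v], of \<omega>] assms(2)
  by simp

text \<open>
Split the integral over the change time at \<open>s\<close>: for a change before \<open>s\<close> the factor \<open>L\<^sub>t / L\<^sub>s\<close> can be
taken out, a change after \<open>s\<close> contributes the inhomogeneity.
\<close>

lemma odds_mass_recursion:
  assumes "\<omega> \<in> space M" "0 \<le> s" "s \<le> t" "0 \<le> v"
  shows "odds_mass v t \<omega> = ell v t s \<omega> * odds_mass v s \<omega> + odds_input v s t \<omega>"
proof -
  have [measurable]: "(\<lambda>u. ell v t u \<omega> * indicator {0..t} u) \<in> borel_measurable borel"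
    "(\<lambda>u. ell v s u \<omega> * indicator {0..s} u) \<in> borel_measurable borel"
    using assms by (auto intro!: measurable_ell_section)
  have m1: "(\<lambda>u. (ell v t u \<omega> * indicator {0..t} u) * indicator {s<..t} u) \<in> borel_measurable borel"
    by measurable
  have "(\<lambda>u. (ell v t u \<omega> * indicator {0..t} u) * indicator {s<..t} u) = (\<lambda>u. ell v t u \<omega> * indicator {s<..t} u)"
    using assms by (auto simp: fun_eq_iff split: split_indicator)
  with m1 have [measurable]: "(\<lambda>u. ell v t u \<omega> * indicator {s<..t} u) \<in> borel_measurable borel"
    by simp
  have "(\<integral>\<^sup>+u. ell v t u \<omega> * indicator {0..t} u \<partial>\<eta>)
      = (\<integral>\<^sup>+u. ell v t s \<omega> * (ell v s u \<omega> * indicator {0..s} u) + ell v t u \<omega> * indicator {s<..t} u \<partial>\<eta>)"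
  proof (rule nn_integral_cong)
    fix u
    consider "u \<in> {0..s}" | "u \<in> {s<..t}" | "u \<notin> {0..t}" by fastforce
    then show "ell v t u \<omega> * indicator {0..t} u
      = ell v t s \<omega> * (ell v s u \<omega> * indicator {0..s} u) + ell v t u \<omega> * indicator {s<..t} u"
    proof cases
      case 1
      then have "ell v t u \<omega> = ell v t s \<omega> * ell v s u \<omega>"
        using assms by (intro ell_chain) auto
      then show ?thesis using 1 assms by simp
    next
      case 2
      then show ?thesis using assms by simp
    next
      case 3
      then have "u \<notin> {0..s}" "u \<notin> {s<..t}" using assms by auto
      then show ?thesis using 3 by (simp add: indicator_simps del: atLeastAtMost_iff greaterThanAtMost_iff)
    qed
  qed
  also have "\<dots> = ell v t s \<omega> * (\<integral>\<^sup>+u. ell v s u \<omega> * indicator {0..s} u \<partial>\<eta>)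
      + (\<integral>\<^sup>+u. ell v t u \<omega> * indicator {s<..t} u \<partial>\<eta>)"
    by (subst nn_integral_add) (auto simp: nn_integral_cmult)
  finally show ?thesis
    by (simp add: odds_mass_def odds_input_def distrib_left ac_simps)
qed

lemma measurable_odds_mass:
  assumes "0 \<le> t" shows "odds_mass v t \<in> borel_measurable obs"
proof -
  interpret \<eta>: prob_space \<eta> by (rule prob_space_\<eta>)
  have [measurable]: "(\<lambda>(\<omega>, u). ell v t u \<omega> * indicator {0..t} u) \<in> borel_measurable (obs \<Otimes>\<^sub>M \<eta>)"
    using measurable_ell[OF assms, of v] by (simp cong: measurable_cong_sets sets_pair_measure_cong)
  show ?thesis
    unfolding odds_mass_def [abs_def] by measurable
qed

lemma measurable_path_odds_mass:
  assumes "0 \<le> t" shows "path_odds_mass v t \<in> borel_measurable (F (ennreal t))"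
proof -
  interpret \<eta>: prob_space \<eta> by (rule prob_space_\<eta>)
  have [measurable]: "(\<lambda>(\<omega>, u). path_quotient v t u \<omega>) \<in> borel_measurable (F (ennreal t) \<Otimes>\<^sub>M \<eta>)"
    using measurable_path_quotient[OF assms, of v] by (simp cong: measurable_cong_sets sets_pair_measure_cong)
  show ?thesis
    unfolding path_odds_mass_def [abs_def] by measurable
qed

lemma AE_path_odds_mass:
  assumes "0 \<le> t"
  shows "AE \<omega> in M. \<forall>v. path_odds_mass v t \<omega> = odds_mass v t \<omega>"
  using AE_path_quotient[OF assms]
proof eventually_elim
  fix \<omega> assume "\<forall>u\<in>{0..t}. \<forall>v. path_quotient v t u \<omega> = ell v t u \<omega>"
  then have "path_quotient v t u \<omega> * indicator {0..t} u = ell v t u \<omega> * indicator {0..t} u" for u v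
    by (cases "u \<in> {0..t}") auto
  then show "\<forall>v. path_odds_mass v t \<omega> = odds_mass v t \<omega>"
    by (simp only: path_odds_mass_def odds_mass_def simp_thms)
qed

section \<open>The measure under which the change happens\<close>

abbreviation G where "G \<equiv> enlarged_filtration (space M) F \<theta> \<Lambda>"

lemma G_generator: "sets (F t) \<union> {\<theta> -` A \<inter> space M | A. A \<in> sets borel} \<union> {\<Lambda> -` A \<inter> space M | A. A \<in> sets borel} \<subseteq> events"
  using subalgebra_F[of t] \<theta>(1) \<Lambda> by (auto simp: subalgebra_def)

lemma space_G [simp]: "space (G t) = space M"
  unfolding enlarged_filtration_def
  by (rule space_measure_of) (use G_generator[of t] sets.sets_into_space in blast)

lemma sets_G: "sets (G t) = sigma_sets (space M)
    (sets (F t) \<union> {\<theta> -` A \<inter> space M | A. A \<in> sets borel} \<union> {\<Lambda> -` A \<inter> space M | A. A \<in> sets borel})"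
  unfolding enlarged_filtration_def
  by (rule sets_measure_of) (use G_generator[of t] sets.sets_into_space in blast)

lemma sets_G_events: "sets (G t) \<subseteq> events"
  unfolding sets_G by (rule sets.sigma_sets_subset[OF G_generator])

lemma sets_F_G: "sets (F t) \<subseteq> sets (G t)"
  unfolding sets_G by (auto intro: sigma_sets.Basic)

lemma sets_G_mono: "s \<le> t \<Longrightarrow> sets (G s) \<subseteq> sets (G t)"
  unfolding sets_G using sets_F_mono[of s t] by (intro sigma_sets_mono') blast

lemma \<theta>_G [measurable]: "\<theta> \<in> borel_measurable (G t)"
  by (rule measurableI) (auto simp: sets_G intro!: sigma_sets.Basic)

lemma \<Lambda>_G [measurable]: "\<Lambda> \<in> borel_measurable (G t)"
  by (rule measurableI) (auto simp: sets_G intro!: sigma_sets.Basic)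

lemma sets_G_P: "sets (G t) \<subseteq> sets P"
  unfolding P_sets by (rule sets_G_mono) simp

lemma \<theta>_P [measurable]: "\<theta> \<in> borel_measurable P" and \<Lambda>_P [measurable]: "\<Lambda> \<in> borel_measurable P"
  by (rule measurable_mono_sets[OF \<theta>_G _ sets_G_P] measurable_mono_sets[OF \<Lambda>_G _ sets_G_P],
      simp add: P_space)+

lemma subalgebra_P: "subalgebra P (F t)"
  using sets_F_G[of t] sets_G_P[of t] by (auto simp: subalgebra_def P_space)

lemma sets_F_P: "A \<in> sets (F t) \<Longrightarrow> A \<in> sets P"
  using sets_F_G sets_G_P by blast

lemma sets_F_events: "A \<in> sets (F t) \<Longrightarrow> A \<in> events"
  using sets_F_subset_obs obs_events by blast

lemma P_emeasure:
  assumes "0 \<le> t" "A \<in> sets (G (ennreal t))"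
  shows "emeasure P A = (\<integral>\<^sup>+\<omega>\<in>A. ennreal (disorder_density \<mu> r N Y \<Lambda> \<theta> t \<omega>) \<partial>M)"
  using P_density[OF assms] by (simp add: r_def [abs_def])

text \<open>
Before the change the density is one.
\<close>

lemma P_before_change:
  assumes "0 \<le> t" "A \<in> sets (G (ennreal t))" "\<And>\<omega>. \<omega> \<in> A \<Longrightarrow> t < \<theta> \<omega>"
  shows "emeasure P A = emeasure M A"
proof -
  have "emeasure P A = (\<integral>\<^sup>+\<omega>\<in>A. 1 \<partial>M)"
    unfolding P_emeasure[OF assms(1,2)] using assms(3)
    by (intro nn_integral_cong) (fastforce simp: disorder_density_def split: split_indicator)
  then show ?thesis
    using assms(2) sets_G_events by (simp add: subset_iff)
qed

text \<open>
At time zero the density is one everywhere: a change at time zero has not produced any factor yet.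
\<close>

lemma prob_space_P: "prob_space P"
proof
  have sp: "space M \<in> sets (G (ennreal 0))" using sets.top[of "G (ennreal 0)"] by simp
  have "emeasure P (space P) = (\<integral>\<^sup>+\<omega>\<in>space M. ennreal (disorder_density \<mu> r N Y \<Lambda> \<theta> 0 \<omega>) \<partial>M)"
    unfolding P_space by (rule P_emeasure[OF _ sp]) simp
  also have "\<dots> = (\<integral>\<^sup>+\<omega>. 1 \<partial>M)"
  proof (rule nn_integral_cong)
    fix \<omega> assume "\<omega> \<in> space M"
    then show "ennreal (disorder_density \<mu> r N Y \<Lambda> \<theta> 0 \<omega>) * indicator (space M) \<omega> = 1"
      using \<theta>(2)[of \<omega>]
      by (auto simp: disorder_density_def likelihood_quotient_def dest: order_antisym)
  qed
  finally show "emeasure P (space P) = 1" by (simp add: emeasure_space_1)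
qed

definition survival :: "real \<Rightarrow> real" where
  "survival t = prob {\<omega> \<in> space M. t < \<theta> \<omega>}"

lemma survival_eq:
  assumes "0 \<le> t"
  shows "survival t = (1 - p) * exp (- lam * t)"
proof -
  note \<theta>(1) [measurable]
  have "prob {\<omega> \<in> space M. 0 < \<theta> \<omega>} = 1 - prob {\<omega> \<in> space M. \<not> 0 < \<theta> \<omega>}"
    using prob_neg[of "\<lambda>\<omega>. \<not> 0 < \<theta> \<omega>"] by simp
  also have "{\<omega> \<in> space M. \<not> 0 < \<theta> \<omega>} = {\<omega> \<in> space M. \<theta> \<omega> = 0}"
    using \<theta>(2) by force
  finally have pos: "prob {\<omega> \<in> space M. 0 < \<theta> \<omega>} = 1 - p"
    using \<theta>_zero by simp
  have "{\<omega> \<in> space M. t < \<theta> \<omega> \<and> 0 < \<theta> \<omega>} = {\<omega> \<in> space M. t < \<theta> \<omega>}"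
    using assms by auto
  then have "survival t / (1 - p) = exp (- lam * t)"
    using \<theta>_exp[OF assms] unfolding cond_prob_def pos survival_def by simp
  then show ?thesis using p by (simp add: field_simps)
qed

lemma survival_pos: "0 \<le> t \<Longrightarrow> 0 < survival t"
  using survival_eq p by simp

lemma indep_obs_change:
  assumes "E \<in> sets obs" "C \<in> sets borel"
  shows "prob (E \<inter> (\<theta> -` C \<inter> space M)) = prob E * prob (\<theta> -` C \<inter> space M)"
proof (rule indep_alg)
  show "\<theta> -` C \<inter> space M \<in> sets (alg {Change})"
    using measurable_sets[OF measurable_Change, of "{Change}" C] assms by simp
qed (use assms in \<open>auto simp: obs_def all_sources_def\<close>)

text \<open>
Since \<open>\<theta>\<close> is independent of the observations, an observed event and the absence of a change up to \<open>t\<close>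
factorise. As the survival probability is positive, an event observed by time \<open>t\<close> that is null for \<open>P\<close> is
also null for the reference measure.
\<close>

lemma P_no_change:
  assumes "0 \<le> t" "A \<in> sets (F (ennreal t))"
  shows "emeasure P (A \<inter> {\<omega> \<in> space M. t < \<theta> \<omega>}) = ennreal (survival t) * emeasure M A"
proof -
  have A: "A \<in> sets (G (ennreal t))" "A \<in> sets obs" "A \<subseteq> space M"
    using assms sets_F_G sets_F_subset_obs sets.sets_into_space[of A "F (ennreal t)"] by auto
  have "{\<omega> \<in> space (G (ennreal t)). t < \<theta> \<omega>} \<in> sets (G (ennreal t))"
    by measurable
  then have "emeasure P (A \<inter> {\<omega> \<in> space M. t < \<theta> \<omega>}) = emeasure M (A \<inter> {\<omega> \<in> space M. t < \<theta> \<omega>})"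
    using A assms by (intro P_before_change[of t]) auto
  also have "{\<omega> \<in> space M. t < \<theta> \<omega>} = \<theta> -` {t<..} \<inter> space M" by auto
  also have "emeasure M (A \<inter> (\<theta> -` {t<..} \<inter> space M)) = ennreal (prob A * prob (\<theta> -` {t<..} \<inter> space M))"
    using indep_obs_change[OF A(2), of "{t<..}"] by (simp add: emeasure_eq_measure)
  also have "\<theta> -` {t<..} \<inter> space M = {\<omega> \<in> space M. t < \<theta> \<omega>}" by auto
  finally show ?thesis
    by (simp add: survival_def emeasure_eq_measure ennreal_mult mult.commute)
qed

lemma indep_rate:
  assumes "E \<in> sets (alg (all_sources - {Rate}))" "C \<in> sets borel"
  shows "prob (E \<inter> (\<Lambda> -` C \<inter> space M)) = prob E * prob (\<Lambda> -` C \<inter> space M)"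
proof (rule indep_alg)
  show "\<Lambda> -` C \<inter> space M \<in> sets (alg {Rate})"
    using measurable_sets[OF measurable_Rate, of "{Rate}" C] assms by simp
qed (use assms in \<open>auto simp: all_sources_def\<close>)

text \<open>
On \<open>{\<Lambda> = v}\<close> the density is the quotient with constant rate \<open>v\<close>. First \<open>\<Lambda>\<close> is integrated out, then
\<open>\<theta>\<close>; both are independent of what remains.
\<close>

lemma P_change_rate:
  assumes t: "0 \<le> t" and A: "A \<in> sets (F (ennreal t))"
  shows "emeasure P (A \<inter> {\<omega> \<in> space M. \<theta> \<omega> \<le> t \<and> \<Lambda> \<omega> = v}) = (\<integral>\<^sup>+\<omega>\<in>A. odds_mass v t \<omega> \<partial>M)"
proof -
  let ?B = "A \<inter> {\<omega> \<in> space M. \<theta> \<omega> \<le> t \<and> \<Lambda> \<omega> = v}"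
  let ?A' = "alg (all_sources - {Rate})"
  define g where "g = (\<lambda>(\<omega>, u). indicator A \<omega> * (ell v t u \<omega> * indicator {0..t} u))"
  have AG: "A \<in> sets (G (ennreal t))" and Aobs [measurable]: "A \<in> sets obs" and Asp: "A \<subseteq> space M"
    using A sets_F_G sets_F_subset_obs sets.sets_into_space[of A "F (ennreal t)"] by auto
  have "{\<omega> \<in> space (G (ennreal t)). \<theta> \<omega> \<le> t \<and> \<Lambda> \<omega> = v} \<in> sets (G (ennreal t))"
    by measurable
  with AG have BG: "?B \<in> sets (G (ennreal t))" by auto
  have subA': "subalgebra M ?A'" by (intro subalgebra_alg) auto
  have obsA': "sets obs \<subseteq> sets ?A'"
    unfolding obs_def by (intro sets_alg_mono) (auto simp: all_sources_def)
  note measurable_ell[OF t, of v, measurable]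
  have g [measurable]: "g \<in> borel_measurable (obs \<Otimes>\<^sub>M borel)"
  proof -
    define h where "h = (\<lambda>(\<omega>, u). ell v t u \<omega> * indicator {0..t} u)"
    have [measurable]: "h \<in> borel_measurable (obs \<Otimes>\<^sub>M borel)"
      unfolding h_def by (rule measurable_ell[OF t])
    have "g = (\<lambda>z. indicator A (fst z) * h z)"
      by (auto simp: g_def h_def)
    then show ?thesis by simp
  qed
  have g': "(\<lambda>\<omega>. g (\<omega>, \<theta> \<omega>)) \<in> borel_measurable ?A'"
  proof -
    have "\<theta> \<in> borel_measurable ?A'"
      by (rule measurable_Change) (auto simp: all_sources_def)
    moreover have "(\<lambda>\<omega>. \<omega>) \<in> ?A' \<rightarrow>\<^sub>M obs"
      by (rule measurable_mono_sets[OF measurable_ident_sets[OF refl] _ obsA']) simp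
    ultimately have "(\<lambda>\<omega>. (\<omega>, \<theta> \<omega>)) \<in> ?A' \<rightarrow>\<^sub>M obs \<Otimes>\<^sub>M borel"
      by (intro measurable_Pair)
    then show ?thesis by (rule measurable_compose[OF _ g])
  qed
  note g'[measurable]
  have "emeasure P ?B = (\<integral>\<^sup>+\<omega>. (\<lambda>(\<omega>, x). g (\<omega>, \<theta> \<omega>) * indicator {v} x) (\<omega>, \<Lambda> \<omega>) \<partial>M)"
    unfolding P_emeasure[OF t BG]
  proof (rule nn_integral_cong)
    fix \<omega> assume "\<omega> \<in> space M"
    moreover have "likelihood_quotient \<mu> r N Y \<Lambda> (\<theta> \<omega>) t \<omega> = likelihood_quotient \<mu> r N Y (\<lambda>_. v) (\<theta> \<omega>) t \<omega>"
      if "\<Lambda> \<omega> = v"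
      using that by (simp add: likelihood_quotient_def)
    ultimately show "ennreal (disorder_density \<mu> r N Y \<Lambda> \<theta> t \<omega>) * indicator ?B \<omega>
      = (\<lambda>(\<omega>, x). g (\<omega>, \<theta> \<omega>) * indicator {v} x) (\<omega>, \<Lambda> \<omega>)"
      using \<theta>(2)[of \<omega>] by (auto simp: g_def disorder_density_def ell_def split: split_indicator)
  qed
  also have "\<dots> = (\<integral>\<^sup>+\<omega>. (\<integral>\<^sup>+x. (\<lambda>(\<omega>, x). g (\<omega>, \<theta> \<omega>) * indicator {v} x) (\<omega>, x) \<partial>distr M borel \<Lambda>) \<partial>M)"
    using indep_rate by (intro nn_integral_indep_freeze[OF subA' \<Lambda>]) (auto simp: split_beta')
  also have "\<dots> = (\<integral>\<^sup>+\<omega>. g (\<omega>, \<theta> \<omega>) * ennreal (measure \<gamma> {v}) \<partial>M)"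
  proof -
    interpret \<gamma>: prob_space \<gamma> by (rule prob_space_\<gamma>)
    show ?thesis
      unfolding \<Lambda>_distr by (simp add: nn_integral_cmult \<gamma>.emeasure_eq_measure)
  qed
  also have "\<dots> = (\<integral>\<^sup>+\<omega>. g (\<omega>, \<theta> \<omega>) \<partial>M) * ennreal (measure \<gamma> {v})"
    by (rule nn_integral_multc) (rule measurable_from_subalg[OF subA' g'])
  also have "(\<integral>\<^sup>+\<omega>. g (\<omega>, \<theta> \<omega>) \<partial>M) = (\<integral>\<^sup>+\<omega>. (\<integral>\<^sup>+u. g (\<omega>, u) \<partial>\<eta>) \<partial>M)"
    unfolding \<eta>_def by (rule nn_integral_indep_freeze[OF subalgebra_obs \<theta>(1) indep_obs_change g])
  also have "\<dots> * ennreal (measure \<gamma> {v}) = (\<integral>\<^sup>+\<omega>. (\<integral>\<^sup>+u. g (\<omega>, u) \<partial>\<eta>) * ennreal (measure \<gamma> {v}) \<partial>M)"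
  proof (rule nn_integral_multc[symmetric])
    interpret \<eta>: prob_space \<eta> by (rule prob_space_\<eta>)
    have "g \<in> borel_measurable (obs \<Otimes>\<^sub>M \<eta>)"
      using g by (simp cong: measurable_cong_sets sets_pair_measure_cong)
    then have "(\<lambda>\<omega>. \<integral>\<^sup>+u. g (\<omega>, u) \<partial>\<eta>) \<in> borel_measurable obs" by measurable
    then show "(\<lambda>\<omega>. \<integral>\<^sup>+u. g (\<omega>, u) \<partial>\<eta>) \<in> borel_measurable M"
      by (rule measurable_from_subalg[OF subalgebra_obs])
  qed
  also have "\<dots> = (\<integral>\<^sup>+\<omega>\<in>A. odds_mass v t \<omega> \<partial>M)"
    by (intro nn_integral_cong) (auto simp: g_def odds_mass_def mult.commute split: split_indicator)
  finally show ?thesis .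
qed

end

section \<open>The posterior odds for finitely many rates\<close>

locale discrete_poisson_disorder = poisson_disorder +
  fixes k :: nat
  assumes discrete: "discrete_with_atoms \<gamma> k"
begin

abbreviation V where "V \<equiv> atoms \<gamma>"

lemma finite_V: "finite V" and card_V: "card V = k"
  using discrete by (auto simp: discrete_with_atoms_def)

lemma V_borel [measurable]: "V \<in> sets borel"
  by (intro borel_closed finite_imp_closed finite_V)

lemma V_pos:
  assumes "v \<in> V" shows "0 < v"
proof (rule ccontr)
  assume "\<not> 0 < v"
  interpret \<gamma>: prob_space \<gamma> by (rule prob_space_\<gamma>)
  have "AE x in \<gamma>. x \<noteq> v"
    using \<Lambda>_pos by (rule AE_mp) (use \<open>\<not> 0 < v\<close> in auto)
  then have "measure \<gamma> {v} = 0"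
    by (subst \<gamma>.prob_eq_0) auto
  then show False using assms by (simp add: atoms_def)
qed

lemma V_nonempty: "V \<noteq> {}"
proof
  assume "V = {}"
  interpret \<gamma>: prob_space \<gamma> by (rule prob_space_\<gamma>)
  have "AE x in \<gamma>. x \<in> V" using discrete by (simp add: discrete_with_atoms_def)
  then show False using \<open>V = {}\<close> \<gamma>.AE_False by simp
qed

lemma k_pos: "0 < k"
  using finite_V V_nonempty card_V card_gt_0_iff by metis

lemma AE_rate_atom: "AE \<omega> in P. \<Lambda> \<omega> \<in> V"
proof -
  have "AE x in distr M borel \<Lambda>. x \<in> V"
    using discrete unfolding \<Lambda>_distr by (simp add: discrete_with_atoms_def)
  then have AE_M: "AE \<omega> in M. \<Lambda> \<omega> \<in> V"
    using \<Lambda> by (subst (asm) AE_distr_iff) auto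
  let ?B = "{\<omega> \<in> space M. \<Lambda> \<omega> \<notin> V}"
  have "{\<omega> \<in> space (G (ennreal 0)). \<Lambda> \<omega> \<notin> V} \<in> sets (G (ennreal 0))" by measurable
  then have B: "?B \<in> sets (G (ennreal 0))" by simp
  have "emeasure P ?B = (\<integral>\<^sup>+\<omega>\<in>?B. ennreal (disorder_density \<mu> r N Y \<Lambda> \<theta> 0 \<omega>) \<partial>M)"
    by (rule P_emeasure[OF _ B]) simp
  also have "\<dots> = (\<integral>\<^sup>+\<omega>. 0 \<partial>M)"
    using AE_M by (intro nn_integral_cong_AE) (auto split: split_indicator)
  finally have "?B \<in> null_sets P"
    using B sets_G_P by (intro null_setsI) auto
  then show ?thesis by (rule AE_I') (auto simp: P_space)
qed

lemma P_split:
  assumes t: "0 \<le> t" and A: "A \<in> sets (F (ennreal t))"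
  shows "emeasure P (A \<inter> {\<omega> \<in> space M. \<theta> \<omega> \<le> t}) = (\<Sum>v\<in>V. \<integral>\<^sup>+\<omega>\<in>A. odds_mass v t \<omega> \<partial>M)"
proof -
  have AP [measurable]: "A \<in> sets P" using A by (rule sets_F_P)
  have sp: "space P = space M" by (rule P_space)
  have [measurable]: "{\<omega> \<in> space M. \<theta> \<omega> \<le> t} \<in> sets P"
    "{\<omega> \<in> space M. \<theta> \<omega> \<le> t \<and> \<Lambda> \<omega> = v} \<in> sets P" for v
    unfolding sp[symmetric] by measurable
  have "emeasure P (A \<inter> {\<omega> \<in> space M. \<theta> \<omega> \<le> t})
      = emeasure P (\<Union>v\<in>V. A \<inter> {\<omega> \<in> space M. \<theta> \<omega> \<le> t \<and> \<Lambda> \<omega> = v})"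
    using AE_rate_atom finite_V by (intro emeasure_eq_AE sets.finite_UN) auto
  also have "\<dots> = (\<Sum>v\<in>V. emeasure P (A \<inter> {\<omega> \<in> space M. \<theta> \<omega> \<le> t \<and> \<Lambda> \<omega> = v}))"
    using finite_V by (subst sum_emeasure) (auto simp: disjoint_family_on_def)
  finally show ?thesis
    using P_change_rate[OF t A] by simp
qed

text \<open>
The integral of the weight is a probability under \<open>P\<close>, hence at most one.
\<close>

lemma AE_odds_mass_finite:
  assumes "0 \<le> t"
  shows "AE \<omega> in M. odds_mass v t \<omega> < \<infinity>"
proof -
  interpret P: prob_space P by (rule prob_space_P)
  have "(\<integral>\<^sup>+\<omega>. odds_mass v t \<omega> \<partial>M) = (\<integral>\<^sup>+\<omega>\<in>space M. odds_mass v t \<omega> \<partial>M)"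
    by (intro nn_integral_cong) auto
  also have "\<dots> = emeasure P (space M \<inter> {\<omega> \<in> space M. \<theta> \<omega> \<le> t \<and> \<Lambda> \<omega> = v})"
    using sets.top[of "F (ennreal t)"] by (intro P_change_rate[OF assms, symmetric]) simp
  also have "\<dots> < \<infinity>"
    by (simp add: less_top[symmetric])
  finally have "AE \<omega> in M. odds_mass v t \<omega> \<noteq> \<infinity>"
    using measurable_from_subalg[OF subalgebra_obs measurable_odds_mass[OF assms]]
    by (intro nn_integral_PInf_AE) auto
  then show ?thesis by (simp add: less_top)
qed

text \<open>
The density of \<open>P\<close> with respect to the reference measure on the events observed up to \<open>t\<close>.
\<close>

definition total_mass :: "real \<Rightarrow> 'a \<Rightarrow> ennreal" where
  "total_mass t \<omega> = (\<Sum>v\<in>V. path_odds_mass v t \<omega>) + ennreal (survival t)"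

lemma measurable_total_mass: "0 \<le> t \<Longrightarrow> total_mass t \<in> borel_measurable (F (ennreal t))"
  unfolding total_mass_def [abs_def] using measurable_path_odds_mass
  by (intro borel_measurable_add borel_measurable_sum) auto

lemma P_on_F:
  assumes t: "0 \<le> t" and A: "A \<in> sets (F (ennreal t))"
  shows "emeasure P A = (\<integral>\<^sup>+\<omega>\<in>A. total_mass t \<omega> \<partial>M)"
proof -
  note measurable_from_subalg[OF subalgebra_F measurable_path_odds_mass[OF t], measurable]
  have AP [measurable]: "A \<in> sets P" and Asp: "A \<subseteq> space M" and AM [measurable]: "A \<in> events"
    using sets_F_P[OF A] sets_F_events[OF A] sets.sets_into_space[OF A] by auto
  have sp: "space P = space M" by (rule P_space)
  have [measurable]: "{\<omega> \<in> space M. \<theta> \<omega> \<le> t} \<in> sets P" "{\<omega> \<in> space M. t < \<theta> \<omega>} \<in> sets P"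
    unfolding sp[symmetric] by measurable
  have "A = (A \<inter> {\<omega> \<in> space M. \<theta> \<omega> \<le> t}) \<union> (A \<inter> {\<omega> \<in> space M. t < \<theta> \<omega>})"
    using Asp by auto
  then have "emeasure P A = emeasure P (A \<inter> {\<omega> \<in> space M. \<theta> \<omega> \<le> t}) + emeasure P (A \<inter> {\<omega> \<in> space M. t < \<theta> \<omega>})"
    by (subst plus_emeasure) auto
  also have "\<dots> = (\<Sum>v\<in>V. \<integral>\<^sup>+\<omega>\<in>A. odds_mass v t \<omega> \<partial>M) + ennreal (survival t) * emeasure M A"
    by (simp only: P_split[OF t A] P_no_change[OF t A])
  also have "(\<Sum>v\<in>V. \<integral>\<^sup>+\<omega>\<in>A. odds_mass v t \<omega> \<partial>M) = (\<Sum>v\<in>V. \<integral>\<^sup>+\<omega>\<in>A. path_odds_mass v t \<omega> \<partial>M)"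
    using AE_path_odds_mass[OF t] by (intro sum.cong refl nn_integral_cong_AE) auto
  also have "\<dots> = (\<integral>\<^sup>+\<omega>. (\<Sum>v\<in>V. path_odds_mass v t \<omega> * indicator A \<omega>) \<partial>M)"
    by (rule nn_integral_sum[symmetric]) auto
  also have "\<dots> + ennreal (survival t) * emeasure M A
      = (\<integral>\<^sup>+\<omega>. (\<Sum>v\<in>V. path_odds_mass v t \<omega> * indicator A \<omega>) + ennreal (survival t) * indicator A \<omega> \<partial>M)"
    by (subst nn_integral_add) (auto simp: nn_integral_cmult_indicator)
  also have "\<dots> = (\<integral>\<^sup>+\<omega>\<in>A. total_mass t \<omega> \<partial>M)"
    by (simp add: total_mass_def distrib_right sum_distrib_right)
  finally show ?thesis .
qed

lemma nn_integral_P_F: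
  assumes t: "0 \<le> t" and h: "h \<in> borel_measurable (F (ennreal t))"
  shows "(\<integral>\<^sup>+\<omega>. h \<omega> \<partial>P) = (\<integral>\<^sup>+\<omega>. total_mass t \<omega> * h \<omega> \<partial>M)"
proof -
  let ?F = "F (ennreal t)"
  let ?RP = "restr_to_subalg P ?F" and ?RM = "restr_to_subalg M ?F"
  note measurable_total_mass[OF t, measurable] h[measurable]
  have sR: "sets ?RP = sets ?F" "sets ?RM = sets ?F"
    using sets_restr_to_subalg[OF subalgebra_P] sets_restr_to_subalg[OF subalgebra_F] by auto
  have mR: "borel_measurable ?RP = borel_measurable ?F" "borel_measurable ?RM = borel_measurable ?F"
    using sR by (auto intro!: measurable_cong_sets)
  have "?RP = density ?RM (total_mass t)"
  proof (rule measure_eqI)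
    fix A assume "A \<in> sets ?RP"
    then have A [measurable]: "A \<in> sets ?F" by (simp add: sR)
    have "emeasure ?RP A = (\<integral>\<^sup>+\<omega>. total_mass t \<omega> * indicator A \<omega> \<partial>M)"
      using P_on_F[OF t A] by (simp add: emeasure_restr_to_subalg[OF subalgebra_P A])
    also have "\<dots> = (\<integral>\<^sup>+\<omega>. total_mass t \<omega> * indicator A \<omega> \<partial>?RM)"
      using A by (intro nn_integral_subalgebra2[OF subalgebra_F, symmetric]) measurable
    also have "\<dots> = emeasure (density ?RM (total_mass t)) A"
      using A by (subst emeasure_density) (auto simp: sR mR measurable_total_mass[OF t])
    finally show "emeasure ?RP A = emeasure (density ?RM (total_mass t)) A" .
  qed (simp add: sR)
  moreover have "(\<integral>\<^sup>+\<omega>. h \<omega> \<partial>P) = (\<integral>\<^sup>+\<omega>. h \<omega> \<partial>?RP)"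
    by (rule nn_integral_subalgebra2[OF subalgebra_P h, symmetric])
  ultimately have "(\<integral>\<^sup>+\<omega>. h \<omega> \<partial>P) = (\<integral>\<^sup>+\<omega>. total_mass t \<omega> * h \<omega> \<partial>?RM)"
    by (simp only:) (rule nn_integral_density, auto simp: mR measurable_total_mass[OF t] h)
  also have "\<dots> = (\<integral>\<^sup>+\<omega>. total_mass t \<omega> * h \<omega> \<partial>M)"
    by (intro nn_integral_subalgebra2[OF subalgebra_F]) measurable
  finally show ?thesis .
qed

lemma AE_P_iff_M:
  assumes t: "0 \<le> t" and Q: "{\<omega> \<in> space M. Q \<omega>} \<in> sets (F (ennreal t))"
  shows "(AE \<omega> in P. Q \<omega>) \<longleftrightarrow> (AE \<omega> in M. Q \<omega>)"
proof -
  let ?B = "{\<omega> \<in> space M. \<not> Q \<omega>}"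
  have "?B = space (F (ennreal t)) - {\<omega> \<in> space M. Q \<omega>}" by auto
  then have B: "?B \<in> sets (F (ennreal t))" using Q by (metis sets.compl_sets)
  then have BM: "?B \<in> events" "?B \<in> sets P"
    using sets_F_P[OF B] sets_F_events[OF B] by auto
  have "emeasure P ?B = 0 \<longleftrightarrow> emeasure M ?B = 0"
  proof
    assume *: "emeasure P ?B = 0"
    have "ennreal (survival t) * emeasure M ?B \<le> emeasure P ?B"
      unfolding P_no_change[OF t B, symmetric] using BM by (intro emeasure_mono) auto
    then have "ennreal (survival t) * emeasure M ?B = 0" using * by simp
    then show "emeasure M ?B = 0" using survival_pos[OF t] by simp
  next
    assume *: "emeasure M ?B = 0"
    have "AE \<omega> in M. \<omega> \<notin> ?B"
      using * BM by (intro AE_not_in null_setsI) auto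
    then have "(\<integral>\<^sup>+\<omega>\<in>?B. total_mass t \<omega> \<partial>M) = (\<integral>\<^sup>+\<omega>. 0 \<partial>M)"
      by (intro nn_integral_cong_AE) (auto split: split_indicator)
    then show "emeasure P ?B = 0"
      using P_on_F[OF t B] by simp
  qed
  then show ?thesis
    using BM by (simp add: AE_iff_measurable[of ?B] P_space)
qed

definition posterior_rate :: "real \<Rightarrow> real \<Rightarrow> 'a \<Rightarrow> real" where
  "posterior_rate v t \<omega> = enn2real (path_odds_mass v t \<omega> / total_mass t \<omega>)"

lemma measurable_posterior_rate:
  "0 \<le> t \<Longrightarrow> posterior_rate v t \<in> borel_measurable (F (ennreal t))"
  unfolding posterior_rate_def [abs_def]
  using measurable_total_mass measurable_path_odds_mass by measurable

lemma total_mass_pos: "0 \<le> t \<Longrightarrow> 0 < total_mass t \<omega>"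
  unfolding total_mass_def using survival_pos[of t]
  by (metis add_nonneg_pos ennreal_less_zero_iff zero_le)

lemma AE_total_mass_finite:
  assumes "0 \<le> t" shows "AE \<omega> in M. total_mass t \<omega> < \<infinity>"
proof -
  have "AE \<omega> in M. \<forall>v\<in>V. odds_mass v t \<omega> < \<infinity>"
    using AE_odds_mass_finite[OF assms] by (intro AE_finite_allI finite_V)
  then show ?thesis
    using AE_path_odds_mass[OF assms]
    by eventually_elim (simp add: total_mass_def finite_V)
qed

lemma posterior_rate_le_1:
  assumes "0 \<le> t" "v \<in> V"
  shows "ennreal (posterior_rate v t \<omega>) = path_odds_mass v t \<omega> / total_mass t \<omega>"
    and "posterior_rate v t \<omega> \<le> 1"
proof -
  have "path_odds_mass v t \<omega> \<le> total_mass t \<omega>"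
    unfolding total_mass_def using assms finite_V
    by (intro order_trans[OF member_le_sum[of v V "\<lambda>v. path_odds_mass v t \<omega>"]]) auto
  then have "path_odds_mass v t \<omega> / total_mass t \<omega> \<le> total_mass t \<omega> / total_mass t \<omega>"
    by (rule divide_right_mono_ennreal)
  also have "\<dots> \<le> 1"
    using total_mass_pos[OF assms(1), of \<omega>]
    by (cases "total_mass t \<omega> = \<top>") (auto simp: ennreal_divide_self less_top)
  finally have le: "path_odds_mass v t \<omega> / total_mass t \<omega> \<le> 1" .
  then show eq: "ennreal (posterior_rate v t \<omega>) = path_odds_mass v t \<omega> / total_mass t \<omega>"
    unfolding posterior_rate_def using le_less_trans[OF le ennreal_one_less_top] by simp
  show "posterior_rate v t \<omega> \<le> 1"
    using le unfolding eq[symmetric] by simp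
qed

text \<open>
Bayes' formula: the weight of \<open>v\<close> relative to the total mass. Dividing in \<^typ>\<open>ennreal\<close> before passing to
reals keeps the quotient in \<open>[0, 1]\<close> on the exceptional null set as well, which yields integrability.
\<close>

lemma cond_exp_rate:
  assumes t: "0 \<le> t" and v: "v \<in> V"
  shows "AE \<omega> in P. real_cond_exp P (F (ennreal t)) (indicator {\<omega> \<in> space M. \<theta> \<omega> \<le> t \<and> \<Lambda> \<omega> = v}) \<omega>
    = posterior_rate v t \<omega>"
proof -
  interpret P: prob_space P by (rule prob_space_P)
  interpret PF: sigma_finite_subalgebra P "F (ennreal t)"
    by (rule P.subalgebra_sigma_finite[OF subalgebra_P])
  let ?B = "{\<omega> \<in> space M. \<theta> \<omega> \<le> t \<and> \<Lambda> \<omega> = v}"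
  note measurable_posterior_rate[OF t, measurable] measurable_total_mass[OF t, measurable]
    measurable_path_odds_mass[OF t, measurable]
  have sp: "space P = space M" by (rule P_space)
  have B [measurable]: "?B \<in> sets P" unfolding sp[symmetric] by measurable
  have gP [measurable]: "posterior_rate v t \<in> borel_measurable P"
    by (rule measurable_from_subalg[OF subalgebra_P]) measurable
  show ?thesis
  proof (rule PF.real_cond_exp_charact)
    show "integrable P (indicator ?B :: _ \<Rightarrow> real)"
      by (rule P.integrable_const_bound[where B = 1]) (auto split: split_indicator)
    show "integrable P (posterior_rate v t)"
      using posterior_rate_le_1(2)[OF t v]
      by (intro P.integrable_const_bound[where B = 1]) (auto simp: posterior_rate_def)
    fix A assume A [measurable]: "A \<in> sets (F (ennreal t))"
    have AP [measurable]: "A \<in> sets P" using A by (rule sets_F_P)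
    have "(\<integral>\<^sup>+\<omega>. ennreal (indicator ?B \<omega>) * indicator A \<omega> \<partial>P) = emeasure P (A \<inter> ?B)"
    proof -
      have "(\<integral>\<^sup>+\<omega>. ennreal (indicator ?B \<omega>) * indicator A \<omega> \<partial>P) = (\<integral>\<^sup>+\<omega>. indicator (A \<inter> ?B) \<omega> \<partial>P)"
        by (rule nn_integral_cong) (auto split: split_indicator)
      then show ?thesis by simp
    qed
    also have "\<dots> = (\<integral>\<^sup>+\<omega>\<in>A. odds_mass v t \<omega> \<partial>M)"
      by (rule P_change_rate[OF t A])
    also have "\<dots> = (\<integral>\<^sup>+\<omega>. total_mass t \<omega> * (path_odds_mass v t \<omega> / total_mass t \<omega> * indicator A \<omega>) \<partial>M)"
    proof (rule nn_integral_cong_AE)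
      show "AE \<omega> in M. odds_mass v t \<omega> * indicator A \<omega>
        = total_mass t \<omega> * (path_odds_mass v t \<omega> / total_mass t \<omega> * indicator A \<omega>)"
        using AE_total_mass_finite[OF t] AE_path_odds_mass[OF t]
      proof eventually_elim
        fix \<omega> assume "total_mass t \<omega> < \<infinity>" "\<forall>v. path_odds_mass v t \<omega> = odds_mass v t \<omega>"
        moreover have "total_mass t \<omega> \<noteq> 0" using total_mass_pos[OF t, of \<omega>] by simp
        ultimately have "total_mass t \<omega> * (path_odds_mass v t \<omega> / total_mass t \<omega>) = odds_mass v t \<omega>"
          by (simp add: ennreal_times_divide mult.commute[of "total_mass t \<omega>"] ennreal_mult_divide_eq)
        then show "odds_mass v t \<omega> * indicator A \<omega>
            = total_mass t \<omega> * (path_odds_mass v t \<omega> / total_mass t \<omega> * indicator A \<omega>)"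
          by (simp only: mult.assoc[symmetric])
      qed
    qed
    also have "\<dots> = (\<integral>\<^sup>+\<omega>. path_odds_mass v t \<omega> / total_mass t \<omega> * indicator A \<omega> \<partial>P)"
      by (rule nn_integral_P_F[OF t, symmetric]) measurable
    finally have "(\<integral>\<^sup>+\<omega>. ennreal (indicator ?B \<omega>) * indicator A \<omega> \<partial>P)
      = (\<integral>\<^sup>+\<omega>. ennreal (posterior_rate v t \<omega>) * indicator A \<omega> \<partial>P)"
      by (simp only: posterior_rate_le_1(1)[OF t v])
    then show "(LINT \<omega>:A|P. indicator ?B \<omega>) = (LINT \<omega>:A|P. posterior_rate v t \<omega>)"
      by (subst (1 2) P.set_lebesgue_integral_indicator) (auto simp: posterior_rate_def)
  qed measurable
qed

lemma cond_exp_moment: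
  assumes t: "0 \<le> t"
  shows "AE \<omega> in P. real_cond_exp P (F (ennreal t)) (\<lambda>\<omega>. (\<Lambda> \<omega> - \<mu>) ^ j * indicator {\<omega>. \<theta> \<omega> \<le> t} \<omega>) \<omega>
    = (\<Sum>v\<in>V. (v - \<mu>) ^ j * posterior_rate v t \<omega>)"
proof -
  interpret P: prob_space P by (rule prob_space_P)
  interpret PF: sigma_finite_subalgebra P "F (ennreal t)"
    by (rule P.subalgebra_sigma_finite[OF subalgebra_P])
  let ?B = "\<lambda>v. {\<omega> \<in> space M. \<theta> \<omega> \<le> t \<and> \<Lambda> \<omega> = v}"
  let ?f = "\<lambda>\<omega>. (\<Lambda> \<omega> - \<mu>) ^ j * indicator {\<omega>. \<theta> \<omega> \<le> t} \<omega> :: real"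
  have sp: "space P = space M" by (rule P_space)
  have B [measurable]: "?B v \<in> sets P" for v unfolding sp[symmetric] by measurable
  have f [measurable]: "?f \<in> borel_measurable P"
    unfolding indicator_def by measurable
  have int: "integrable P (indicator (?B v) :: _ \<Rightarrow> real)" for v
    by (rule P.integrable_const_bound[where B = 1]) (auto split: split_indicator)
  have "AE \<omega> in P. ?f \<omega> = (\<Sum>v\<in>V. (v - \<mu>) ^ j * indicator (?B v) \<omega>)"
    using AE_rate_atom AE_space
  proof eventually_elim
    fix \<omega> assume *: "\<Lambda> \<omega> \<in> V" "\<omega> \<in> space P"
    have "(\<Sum>v\<in>V. (v - \<mu>) ^ j * indicator (?B v) \<omega>) = (\<Sum>v\<in>V. if v = \<Lambda> \<omega> then ?f \<omega> else 0)"
      using * by (intro sum.cong) (auto simp: sp split: split_indicator)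
    then show "?f \<omega> = (\<Sum>v\<in>V. (v - \<mu>) ^ j * indicator (?B v) \<omega>)"
      using * finite_V by simp
  qed
  then have "AE \<omega> in P. real_cond_exp P (F (ennreal t)) ?f \<omega>
      = real_cond_exp P (F (ennreal t)) (\<lambda>\<omega>. \<Sum>v\<in>V. (v - \<mu>) ^ j * indicator (?B v) \<omega>) \<omega>"
    by (rule PF.real_cond_exp_cong) measurable
  moreover have "AE \<omega> in P. real_cond_exp P (F (ennreal t)) (\<lambda>\<omega>. \<Sum>v\<in>V. (v - \<mu>) ^ j * indicator (?B v) \<omega>) \<omega>
      = (\<Sum>v\<in>V. real_cond_exp P (F (ennreal t)) (\<lambda>\<omega>. (v - \<mu>) ^ j * indicator (?B v) \<omega>) \<omega>)"
    using int by (intro PF.real_cond_exp_sum) auto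
  moreover have "AE \<omega> in P. \<forall>v\<in>V. real_cond_exp P (F (ennreal t)) (\<lambda>\<omega>. (v - \<mu>) ^ j * indicator (?B v) \<omega>) \<omega>
      = (v - \<mu>) ^ j * real_cond_exp P (F (ennreal t)) (indicator (?B v)) \<omega>"
    using int by (intro AE_finite_allI finite_V PF.real_cond_exp_cmult)
  moreover have "AE \<omega> in P. \<forall>v\<in>V. real_cond_exp P (F (ennreal t)) (indicator (?B v)) \<omega> = posterior_rate v t \<omega>"
    using cond_exp_rate[OF t] by (intro AE_finite_allI finite_V)
  ultimately show ?thesis
    by eventually_elim simp
qed

text \<open>
In the quotient that defines the statistic the total mass cancels, and \<open>1 - \<Pi>\<close> leaves the survival
probability. The equality holds almost surely under the reference measure too, since both sides are observed at
time \<open>t\<close>.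
\<close>

lemma odds_moment_formula:
  assumes \<phi>: "odds_moment_version M P F \<mu> \<Lambda> \<theta> j \<phi>" and t: "0 \<le> t"
  shows "AE \<omega> in M. \<phi> t \<omega> = (\<Sum>v\<in>V. (v - \<mu>) ^ j * (enn2real (odds_mass v t \<omega>) / survival t))"
proof -
  let ?R = "\<lambda>\<omega>. \<Sum>v\<in>V. (v - \<mu>) ^ j * (enn2real (path_odds_mass v t \<omega>) / survival t)"
  note measurable_path_odds_mass[OF t, measurable] measurable_total_mass[OF t, measurable]
  have \<phi>F [measurable]: "\<phi> t \<in> borel_measurable (F (ennreal t))"
    and \<phi>P: "AE \<omega> in P. \<phi> t \<omega> =
           real_cond_exp P (F (ennreal t)) (\<lambda>\<omega>. (\<Lambda> \<omega> - \<mu>) ^ j * indicator {\<omega>. \<theta> \<omega> \<le> t} \<omega>) \<omega>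
             / (1 - posterior P F \<theta> t \<omega>)"
    using \<phi> t by (auto simp: odds_moment_version_def)
  have fin: "AE \<omega> in P. total_mass t \<omega> < \<infinity>"
  proof (subst AE_P_iff_M[OF t])
    have "{\<omega> \<in> space (F (ennreal t)). total_mass t \<omega> < \<infinity>} \<in> sets (F (ennreal t))" by measurable
    then show "{\<omega> \<in> space M. total_mass t \<omega> < \<infinity>} \<in> sets (F (ennreal t))" by simp
  qed (rule AE_total_mass_finite[OF t])
  have post: "AE \<omega> in P. posterior P F \<theta> t \<omega> = (\<Sum>v\<in>V. posterior_rate v t \<omega>)"
    using cond_exp_moment[OF t, of 0] by (simp add: posterior_def)
  have "AE \<omega> in P. \<phi> t \<omega> = ?R \<omega>"
    using \<phi>P fin post cond_exp_moment[OF t, of j]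
  proof eventually_elim
    fix \<omega>
    assume eq: "\<phi> t \<omega> = real_cond_exp P (F (ennreal t)) (\<lambda>\<omega>. (\<Lambda> \<omega> - \<mu>) ^ j * indicator {\<omega>. \<theta> \<omega> \<le> t} \<omega>) \<omega>
             / (1 - posterior P F \<theta> t \<omega>)"
      "posterior P F \<theta> t \<omega> = (\<Sum>v\<in>V. posterior_rate v t \<omega>)"
      "real_cond_exp P (F (ennreal t)) (\<lambda>\<omega>. (\<Lambda> \<omega> - \<mu>) ^ j * indicator {\<omega>. \<theta> \<omega> \<le> t} \<omega>) \<omega>
        = (\<Sum>v\<in>V. (v - \<mu>) ^ j * posterior_rate v t \<omega>)"
      and fin: "total_mass t \<omega> < \<infinity>"
    define a where "a v = enn2real (path_odds_mass v t \<omega>)" for v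
    define D where "D = (\<Sum>v\<in>V. a v) + survival t"
    have a: "path_odds_mass v t \<omega> = ennreal (a v)" "0 \<le> a v" if "v \<in> V" for v
      using fin that finite_V unfolding a_def total_mass_def by (auto simp: less_top[symmetric])
    have D: "total_mass t \<omega> = ennreal D"
      unfolding total_mass_def D_def using a survival_pos[OF t]
      by (simp add: sum_ennreal sum_nonneg)
    have D_pos: "0 < D"
      unfolding D_def using a survival_pos[OF t] by (intro add_nonneg_pos sum_nonneg) auto
    have rate: "posterior_rate v t \<omega> = a v / D" if "v \<in> V" for v
      unfolding posterior_rate_def D a(1)[OF that] using a(2)[OF that] D_pos
      by (simp add: divide_ennreal)
    have "(\<Sum>v\<in>V. posterior_rate v t \<omega>) = (\<Sum>v\<in>V. a v) / D"
      using rate by (simp add: sum_divide_distrib)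
    then have "1 - (\<Sum>v\<in>V. posterior_rate v t \<omega>) = survival t / D"
      using D_pos by (simp add: D_def field_simps)
    moreover have "(\<Sum>v\<in>V. (v - \<mu>) ^ j * posterior_rate v t \<omega>) = (\<Sum>v\<in>V. (v - \<mu>) ^ j * a v) / D"
      using rate by (simp add: sum_divide_distrib)
    ultimately have "\<phi> t \<omega> = (\<Sum>v\<in>V. (v - \<mu>) ^ j * a v) / survival t"
      unfolding eq using D_pos by simp
    then show "\<phi> t \<omega> = ?R \<omega>"
      by (simp add: a_def sum_divide_distrib)
  qed
  also have "?this \<longleftrightarrow> (AE \<omega> in M. \<phi> t \<omega> = ?R \<omega>)"
  proof (rule AE_P_iff_M[OF t])
    have "{\<omega> \<in> space (F (ennreal t)). \<phi> t \<omega> = ?R \<omega>} \<in> sets (F (ennreal t))" by measurable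
    then show "{\<omega> \<in> space M. \<phi> t \<omega> = ?R \<omega>} \<in> sets (F (ennreal t))" by simp
  qed
  finally show ?thesis
    using AE_path_odds_mass[OF t] by eventually_elim simp
qed

end

section \<open>The future is independent of the observed past\<close>

text \<open>
An intersection-stable generator of the \<open>\<sigma>\<close>-algebra of an integer-valued process.
\<close>

definition cylinders :: "'a set \<Rightarrow> 'i set \<Rightarrow> ('i \<Rightarrow> 'a \<Rightarrow> 'b) \<Rightarrow> 'a set set" where
  "cylinders \<Omega> I Z = {{\<omega> \<in> \<Omega>. \<forall>i\<in>T. Z i \<omega> \<in> B i} | T B. finite T \<and> T \<subseteq> I}"

lemma Int_stable_cylinders: "Int_stable (cylinders \<Omega> I Z)"
proof (rule Int_stableI)
  fix a b assume "a \<in> cylinders \<Omega> I Z" "b \<in> cylinders \<Omega> I Z"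
  then obtain T B T' B' where *: "finite T" "T \<subseteq> I" "finite T'" "T' \<subseteq> I"
    "a = {\<omega> \<in> \<Omega>. \<forall>i\<in>T. Z i \<omega> \<in> B i}" "b = {\<omega> \<in> \<Omega>. \<forall>i\<in>T'. Z i \<omega> \<in> B' i}"
    unfolding cylinders_def by blast
  define C where "C i = (if i \<in> T then B i else UNIV) \<inter> (if i \<in> T' then B' i else UNIV)" for i
  have "a \<inter> b = {\<omega> \<in> \<Omega>. \<forall>i\<in>T \<union> T'. Z i \<omega> \<in> C i}"
    unfolding *(5,6) C_def by auto
  then show "a \<inter> b \<in> cylinders \<Omega> I Z"
    unfolding cylinders_def using *(1-4)
    by (intro CollectI exI[of _ "T \<union> T'"] exI[of _ C]) simp
qed

lemma generated_algebra_cylinders: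
  "sets (generated_algebra \<Omega> I Z (count_space UNIV)) \<subseteq> sigma_sets \<Omega> (cylinders \<Omega> I Z)"
  unfolding sets_generated_algebra
proof (rule sigma_sets_mono', rule UN_least)
  fix i assume "i \<in> I"
  show "{Z i -` A \<inter> \<Omega> | A. A \<in> sets (count_space UNIV)} \<subseteq> cylinders \<Omega> I Z"
  proof safe
    fix A
    have "Z i -` A \<inter> \<Omega> = {\<omega> \<in> \<Omega>. \<forall>j\<in>{i}. Z j \<omega> \<in> A}" by auto
    then show "Z i -` A \<inter> \<Omega> \<in> cylinders \<Omega> I Z"
      unfolding cylinders_def using \<open>i \<in> I\<close>
      by (intro CollectI exI[of _ "{i}"] exI[of _ "\<lambda>_. A"]) auto
  qed
qed

context poisson_disorder
begin

definition past :: "real \<Rightarrow> 'a measure" where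
  "past s = generated_algebra (space M) {0..s} N (count_space UNIV)"

definition future :: "real \<Rightarrow> 'a measure" where
  "future s = generated_algebra (space M) {s..} (\<lambda>u \<omega>. N u \<omega> - N s \<omega>) (count_space UNIV)"

lemma space_past [simp]: "space (past s) = space M" and space_future [simp]: "space (future s) = space M"
  by (simp_all add: past_def future_def)

lemma measurable_past: "0 \<le> u \<Longrightarrow> u \<le> s \<Longrightarrow> N u \<in> past s \<rightarrow>\<^sub>M count_space UNIV"
  unfolding past_def by (intro measurable_generated_algebra) auto

lemma measurable_future: "s \<le> u \<Longrightarrow> (\<lambda>\<omega>. N u \<omega> - N s \<omega>) \<in> future s \<rightarrow>\<^sub>M count_space UNIV"
  unfolding future_def by (rule measurable_generated_algebra) auto

lemma past_future_Count:
  assumes "0 \<le> s"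
  shows "sets (past s) \<subseteq> sets (alg {Count})" "sets (future s) \<subseteq> sets (alg {Count})"
proof -
  show "sets (past s) \<subseteq> sets (alg {Count})"
    unfolding past_def by (intro sets_generated_algebra_subset measurable_Count) auto
  have [measurable]: "N u \<in> alg {Count} \<rightarrow>\<^sub>M count_space UNIV" if "s \<le> u" for u
    using that assms by (intro measurable_Count) auto
  show "sets (future s) \<subseteq> sets (alg {Count})"
    unfolding future_def
  proof (intro sets_generated_algebra_subset)
    fix u assume "u \<in> {s..}"
    then have [measurable]: "N u \<in> alg {Count} \<rightarrow>\<^sub>M count_space UNIV" "N s \<in> alg {Count} \<rightarrow>\<^sub>M count_space UNIV"
      using assms by (auto intro!: measurable_Count)
    show "(\<lambda>\<omega>. N u \<omega> - N s \<omega>) \<in> alg {Count} \<rightarrow>\<^sub>M count_space UNIV" by measurable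
  qed simp
qed

lemma alg_events: "J \<subseteq> all_sources \<Longrightarrow> sets (alg J) \<subseteq> events"
  using subalgebra_alg by (simp add: subalgebra_def)

text \<open>
Refine the time points of both events to a common grid that contains \<open>0\<close> and \<open>s\<close>. The past event is
then a function of the increments before \<open>s\<close> and the future event one of the increments after \<open>s\<close>;
as \<open>N\<close> takes integer values, such functions are automatically measurable.
\<close>

lemma indep_cylinders:
  assumes s: "0 \<le> s" and T: "finite T" "T \<subseteq> {0..s}" and T': "finite T'" "T' \<subseteq> {s..}"
  shows "prob ({\<omega> \<in> space M. \<forall>u\<in>T. N u \<omega> \<in> B u} \<inter> {\<omega> \<in> space M. \<forall>u\<in>T'. N u \<omega> - N s \<omega> \<in> B' u})
    = prob {\<omega> \<in> space M. \<forall>u\<in>T. N u \<omega> \<in> B u} * prob {\<omega> \<in> space M. \<forall>u\<in>T'. N u \<omega> - N s \<omega> \<in> B' u}"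
proof -
  define W where "W = insert 0 (insert s (T \<union> T'))"
  define ts where "ts = sorted_list_of_set W"
  define n where "n = length ts - 1"
  have finW: "finite W" using T T' by (simp add: W_def)
  have set_ts: "set ts = W" and dist: "distinct ts" and sort: "sorted ts"
    using finW by (auto simp: ts_def)
  have strict: "ts ! i < ts ! j" if "i < j" "j < length ts" for i j
    using sorted_wrt_nth_less[of "(<)" ts, OF _ that] strict_sorted_list_of_set[of W] by (simp add: ts_def)
  have W0: "0 \<le> w" if "w \<in> W" for w
    using that T(2) T'(2) s by (force simp: W_def)
  have len: "0 < length ts"
    using set_ts by (auto simp: W_def)
  have nth_mono: "ts ! i \<le> ts ! j" if "i \<le> j" "j < length ts" for i j
    using sort that by (rule sorted_nth_mono)
  have idx: "\<exists>i<length ts. ts ! i = w" if "w \<in> W" for w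
    using that set_ts by (metis in_set_conv_nth)
  have nth0: "0 \<le> ts ! i" if "i < length ts" for i
    using that W0 set_ts nth_mem by blast
  obtain i0 where "i0 < length ts" "ts ! i0 = 0" using idx[of 0] by (auto simp: W_def)
  then have first: "ts ! 0 = 0" using nth_mono[of 0 i0] nth0[of 0] len by simp
  obtain J where J: "J < length ts" "ts ! J = s" using idx[of s] by (auto simp: W_def)
  have Jn: "J \<le> n" using J(1) by (simp add: n_def)
  define D where "D = (\<lambda>i \<omega>. N (ts ! Suc i) \<omega> - N (ts ! i) \<omega>)"
  have ind: "indep_vars (\<lambda>_. count_space UNIV) D {..<n}"
  proof -
    have "mono_on {..n} (\<lambda>i. ts ! i)"
    proof (rule mono_onI)
      fix i j assume ij: "i \<le> j" and "j \<in> {..n}"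
      then have "j \<le> length ts - 1" by (simp add: n_def)
      then have "j < length ts" using len by linarith
      with ij show "ts ! i \<le> ts ! j" by (rule nth_mono)
    qed
    then show ?thesis
      using N first unfolding poisson_process_def D_def by auto
  qed
  have step: "N (ts ! i) \<omega> \<le> N (ts ! j) \<omega>" if "\<omega> \<in> space M" "i \<le> j" "j < length ts" for i j \<omega>
    using that nth0[of i] by (intro N_mono nth_mono) auto
  have tele: "N (ts ! j) \<omega> - N (ts ! i) \<omega> = (\<Sum>l\<in>{i..<j}. D l \<omega>)"
    if "\<omega> \<in> space M" "i \<le> j" "j < length ts" for i j \<omega>
    using that(2,3)
  proof (induction j rule: dec_induct)
    case (step j)
    have "N (ts ! i) \<omega> \<le> N (ts ! j) \<omega>" "N (ts ! j) \<omega> \<le> N (ts ! Suc j) \<omega>"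
      using \<open>\<And>\<omega> i j. \<omega> \<in> space M \<Longrightarrow> i \<le> j \<Longrightarrow> j < length ts \<Longrightarrow> N (ts ! i) \<omega> \<le> N (ts ! j) \<omega>\<close>[OF that(1)]
        step by auto
    then show ?case using step by (simp add: D_def)
  qed simp
  \<comment> \<open>\<open>J\<close> is the position of \<open>s\<close> in the grid; it separates past from future.\<close>
  have "\<forall>u\<in>T. \<exists>j\<le>J. ts ! j = u"
  proof
    fix u assume u: "u \<in> T"
    obtain j where j: "j < length ts" "ts ! j = u" using idx[of u] u by (auto simp: W_def)
    have "j \<le> J" using strict[of J j] j J u T(2) by (force simp: not_le[symmetric])
    then show "\<exists>j\<le>J. ts ! j = u" using j by blast
  qed
  then obtain f where f: "\<And>u. u \<in> T \<Longrightarrow> f u \<le> J" "\<And>u. u \<in> T \<Longrightarrow> ts ! f u = u" by metis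
  have "\<forall>u\<in>T'. \<exists>j<length ts. J \<le> j \<and> ts ! j = u"
  proof
    fix u assume u: "u \<in> T'"
    obtain j where j: "j < length ts" "ts ! j = u" using idx[of u] u by (auto simp: W_def)
    have "J \<le> j" using strict[of j J] j J u T'(2) by (force simp: not_le[symmetric])
    then show "\<exists>j<length ts. J \<le> j \<and> ts ! j = u" using j by blast
  qed
  then obtain f' where f': "\<And>u. u \<in> T' \<Longrightarrow> f' u < length ts" "\<And>u. u \<in> T' \<Longrightarrow> J \<le> f' u"
    "\<And>u. u \<in> T' \<Longrightarrow> ts ! f' u = u" by metis
  define E where "E = {g \<in> {..<J} \<rightarrow>\<^sub>E (UNIV :: nat set). \<forall>u\<in>T. (\<Sum>l\<in>{0..<f u}. g l) \<in> B u}"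
  define E' where "E' = {g \<in> {J..<n} \<rightarrow>\<^sub>E (UNIV :: nat set). \<forall>u\<in>T'. (\<Sum>l\<in>{J..<f' u}. g l) \<in> B' u}"
  have var: "indep_var (PiM {..<J} (\<lambda>_. count_space UNIV)) (\<lambda>\<omega>. restrict (\<lambda>i. D i \<omega>) {..<J})
     (PiM {J..<n} (\<lambda>_. count_space UNIV)) (\<lambda>\<omega>. restrict (\<lambda>i. D i \<omega>) {J..<n})"
    using Jn by (intro indep_var_restrict[OF ind]) auto
  have N1: "(\<Sum>l\<in>{0..<f u}. restrict (\<lambda>i. D i \<omega>) {..<J} l) = N u \<omega>" if "\<omega> \<in> space M" "u \<in> T" for u \<omega>
  proof -
    have "(\<Sum>l\<in>{0..<f u}. restrict (\<lambda>i. D i \<omega>) {..<J} l) = (\<Sum>l\<in>{0..<f u}. D l \<omega>)"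
      using f(1)[OF that(2)] by (intro sum.cong) auto
    then show ?thesis
      using tele[of \<omega> 0 "f u"] f[OF that(2)] J(1) first N_zero[OF that(1)] that(1) by simp
  qed
  have "\<omega> \<in> (\<lambda>\<omega>. restrict (\<lambda>i. D i \<omega>) {..<J}) -` E \<longleftrightarrow> (\<forall>u\<in>T. N u \<omega> \<in> B u)" if "\<omega> \<in> space M" for \<omega>
    unfolding E_def vimage_eq mem_Collect_eq using N1[OF that] by (simp cong: ball_cong)
  then have eq1: "(\<lambda>\<omega>. restrict (\<lambda>i. D i \<omega>) {..<J}) -` E \<inter> space M = {\<omega> \<in> space M. \<forall>u\<in>T. N u \<omega> \<in> B u}"
    by blast
  have N2: "(\<Sum>l\<in>{J..<f' u}. restrict (\<lambda>i. D i \<omega>) {J..<n} l) = N u \<omega> - N s \<omega>"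
    if "\<omega> \<in> space M" "u \<in> T'" for u \<omega>
  proof -
    have "f' u \<le> n" using f'(1)[OF that(2)] unfolding n_def by linarith
    then have "(\<Sum>l\<in>{J..<f' u}. restrict (\<lambda>i. D i \<omega>) {J..<n} l) = (\<Sum>l\<in>{J..<f' u}. D l \<omega>)"
      by (intro sum.cong) auto
    then show ?thesis
      using tele[of \<omega> J "f' u"] f'[OF that(2)] J(2) that(1) by simp
  qed
  have "\<omega> \<in> (\<lambda>\<omega>. restrict (\<lambda>i. D i \<omega>) {J..<n}) -` E' \<longleftrightarrow> (\<forall>u\<in>T'. N u \<omega> - N s \<omega> \<in> B' u)"
    if "\<omega> \<in> space M" for \<omega>
    unfolding E'_def vimage_eq mem_Collect_eq using N2[OF that] by (simp cong: ball_cong)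
  then have eq2: "(\<lambda>\<omega>. restrict (\<lambda>i. D i \<omega>) {J..<n}) -` E' \<inter> space M = {\<omega> \<in> space M. \<forall>u\<in>T'. N u \<omega> - N s \<omega> \<in> B' u}"
    by blast
  have "prob ((\<lambda>\<omega>. (restrict (\<lambda>i. D i \<omega>) {..<J}, restrict (\<lambda>i. D i \<omega>) {J..<n})) -` (E \<times> E') \<inter> space M)
    = prob ((\<lambda>\<omega>. restrict (\<lambda>i. D i \<omega>) {..<J}) -` E \<inter> space M) * prob ((\<lambda>\<omega>. restrict (\<lambda>i. D i \<omega>) {J..<n}) -` E' \<inter> space M)"
    by (rule indep_varD[OF var]) (auto simp: count_space_PiM_finite E_def E'_def)
  moreover have "(\<lambda>\<omega>. (restrict (\<lambda>i. D i \<omega>) {..<J}, restrict (\<lambda>i. D i \<omega>) {J..<n})) -` (E \<times> E') \<inter> space M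
    = ((\<lambda>\<omega>. restrict (\<lambda>i. D i \<omega>) {..<J}) -` E \<inter> space M) \<inter> ((\<lambda>\<omega>. restrict (\<lambda>i. D i \<omega>) {J..<n}) -` E' \<inter> space M)"
    by auto
  ultimately show ?thesis
    unfolding eq1 eq2 by simp
qed

lemma indep_past_future:
  assumes s: "0 \<le> s" and A: "A \<in> sets (past s)" and B: "B \<in> sets (future s)"
  shows "prob (A \<inter> B) = prob A * prob B"
proof -
  let ?C = "cylinders (space M) {0..s} N" and ?C' = "cylinders (space M) {s..} (\<lambda>u \<omega>. N u \<omega> - N s \<omega>)"
  have "indep_set ?C ?C'"
  proof (rule indep_setI)
    show "?C \<subseteq> events"
    proof
      fix a assume "a \<in> ?C"
      then obtain T B where *: "finite T" "T \<subseteq> {0..s}" "a = {\<omega> \<in> space M. \<forall>u\<in>T. N u \<omega> \<in> B u}"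
        unfolding cylinders_def by blast
      have "{\<omega> \<in> space M. N u \<omega> \<in> B u} \<in> events" if "u \<in> T" for u
      proof -
        have [measurable]: "N u \<in> M \<rightarrow>\<^sub>M count_space UNIV" using that *(2) by (intro N_meas) auto
        show ?thesis by measurable
      qed
      then show "a \<in> events" unfolding *(3) using *(1) by (intro sets.sets_Collect_finite_All)
    qed
    show "?C' \<subseteq> events"
    proof
      fix a assume "a \<in> ?C'"
      then obtain T B where *: "finite T" "T \<subseteq> {s..}" "a = {\<omega> \<in> space M. \<forall>u\<in>T. N u \<omega> - N s \<omega> \<in> B u}"
        unfolding cylinders_def by blast
      have "{\<omega> \<in> space M. N u \<omega> - N s \<omega> \<in> B u} \<in> events" if "u \<in> T" for u
      proof -
        have [measurable]: "N u \<in> M \<rightarrow>\<^sub>M count_space UNIV" "N s \<in> M \<rightarrow>\<^sub>M count_space UNIV"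
          using that *(2) s by (auto intro!: N_meas)
        show ?thesis by measurable
      qed
      then show "a \<in> events" unfolding *(3) using *(1) by (intro sets.sets_Collect_finite_All)
    qed
    fix a b assume "a \<in> ?C" "b \<in> ?C'"
    then show "prob (a \<inter> b) = prob a * prob b"
      unfolding cylinders_def using indep_cylinders[OF s] by fast
  qed
  then have "indep_set (sigma_sets (space M) ?C) (sigma_sets (space M) ?C')"
    by (rule indep_set_sigma_sets) (rule Int_stable_cylinders)+
  then show ?thesis
    by (rule indep_setD) (use A B generated_algebra_cylinders in \<open>unfold past_def future_def, blast+\<close>)
qed

text \<open>
The four families (past and future of \<open>N\<close>, two disjoint groups of other sources) are independent: the
sources among themselves by assumption, past and future of \<open>N\<close> by the previous lemma. Both generators are
intersection-stable, so independence passes to the generated \<open>\<sigma>\<close>-algebras.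
\<close>

lemma indep_blocks:
  assumes s: "0 \<le> s" and J: "J \<subseteq> all_sources - {Count}" "J' \<subseteq> all_sources - {Count}" "J \<inter> J' = {}"
    and A: "A \<in> sigma_sets (space M) {a \<inter> b | a b. a \<in> sets (past s) \<and> b \<in> sets (alg J)}"
    and B: "B \<in> sigma_sets (space M) {a \<inter> b | a b. a \<in> sets (future s) \<and> b \<in> sets (alg J')}"
  shows "prob (A \<inter> B) = prob A * prob B"
proof -
  have Count: "Count \<in> all_sources" by (simp add: all_sources_def)
  have stable: "Int_stable {a \<inter> b | a b. a \<in> sets S \<and> b \<in> sets S'}" for S S' :: "'a measure"
  proof (rule Int_stableI)
    fix x y assume "x \<in> {a \<inter> b | a b. a \<in> sets S \<and> b \<in> sets S'}" "y \<in> {a \<inter> b | a b. a \<in> sets S \<and> b \<in> sets S'}"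
    then obtain a b a' b' where *: "x = a \<inter> b" "y = a' \<inter> b'" "a \<in> sets S" "b \<in> sets S'" "a' \<in> sets S" "b' \<in> sets S'"
      by blast
    then have "x \<inter> y = (a \<inter> a') \<inter> (b \<inter> b')" "a \<inter> a' \<in> sets S" "b \<inter> b' \<in> sets S'" by auto
    then show "x \<inter> y \<in> {a \<inter> b | a b. a \<in> sets S \<and> b \<in> sets S'}" by blast
  qed
  note PF = past_future_Count[OF s]
  have ev: "sets (alg {Count}) \<subseteq> events" "sets (alg J) \<subseteq> events" "sets (alg J') \<subseteq> events"
    using J Count by (auto intro!: alg_events)
  have "indep_set {a \<inter> b | a b. a \<in> sets (past s) \<and> b \<in> sets (alg J)}
      {a \<inter> b | a b. a \<in> sets (future s) \<and> b \<in> sets (alg J')}"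
  proof (rule indep_setI)
    show "{a \<inter> b | a b. a \<in> sets (past s) \<and> b \<in> sets (alg J)} \<subseteq> events"
      "{a \<inter> b | a b. a \<in> sets (future s) \<and> b \<in> sets (alg J')} \<subseteq> events"
      using PF ev by (blast intro: sets.Int)+
    fix x y assume "x \<in> {a \<inter> b | a b. a \<in> sets (past s) \<and> b \<in> sets (alg J)}"
      "y \<in> {a \<inter> b | a b. a \<in> sets (future s) \<and> b \<in> sets (alg J')}"
    then obtain a b a' b' where *: "x = a \<inter> b" "y = a' \<inter> b'"
      "a \<in> sets (past s)" "b \<in> sets (alg J)" "a' \<in> sets (future s)" "b' \<in> sets (alg J')"
      by blast
    have C: "a \<in> sets (alg {Count})" "a' \<in> sets (alg {Count})" "a \<inter> a' \<in> sets (alg {Count})"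
      using * PF by auto
    have bb: "b \<inter> b' \<in> sets (alg (J \<union> J'))"
      using * sets_alg_mono[of J "J \<union> J'"] sets_alg_mono[of J' "J \<union> J'"] by auto
    have "x \<inter> y = (a \<inter> a') \<inter> (b \<inter> b')" using * by auto
    also have "prob \<dots> = prob (a \<inter> a') * prob (b \<inter> b')"
      by (rule indep_alg[OF _ _ _ C(3) bb]) (use J Count in auto)
    also have "prob (a \<inter> a') = prob a * prob a'"
      by (rule indep_past_future[OF s *(3,5)])
    also have "prob (b \<inter> b') = prob b * prob b'"
      by (rule indep_alg[OF _ _ _ *(4,6)]) (use J in auto)
    also have "prob a * prob a' * (prob b * prob b') = (prob a * prob b) * (prob a' * prob b')"
      by simp
    also have "prob a * prob b = prob x"
      unfolding *(1) by (rule indep_alg[OF _ _ _ C(1) *(4), symmetric]) (use J Count in auto)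
    also have "prob a' * prob b' = prob y"
      unfolding *(2) by (rule indep_alg[OF _ _ _ C(2) *(6), symmetric]) (use J Count in auto)
    finally show "prob (x \<inter> y) = prob x * prob y" .
  qed
  then have "indep_set (sigma_sets (space M) {a \<inter> b | a b. a \<in> sets (past s) \<and> b \<in> sets (alg J)})
      (sigma_sets (space M) {a \<inter> b | a b. a \<in> sets (future s) \<and> b \<in> sets (alg J')})"
    by (rule indep_set_sigma_sets) (rule stable)+
  then show ?thesis using A B by (rule indep_setD)
qed

definition join :: "'a measure \<Rightarrow> 'a measure \<Rightarrow> 'a measure" where
  "join S S' = sigma (space M) {a \<inter> b | a b. a \<in> sets S \<and> b \<in> sets S'}"

lemma join:
  assumes "space S = space M" "space S' = space M"
  shows space_join: "space (join S S') = space M"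
    and sets_join: "sets (join S S') = sigma_sets (space M) {a \<inter> b | a b. a \<in> sets S \<and> b \<in> sets S'}"
    and left_join: "sets S \<subseteq> sets (join S S')"
    and right_join: "sets S' \<subseteq> sets (join S S')"
proof -
  have sub: "{a \<inter> b | a b. a \<in> sets S \<and> b \<in> sets S'} \<subseteq> Pow (space M)"
    using sets.sets_into_space[of _ S] assms by blast
  show "space (join S S') = space M"
    unfolding join_def by (rule space_measure_of[OF sub])
  show sets: "sets (join S S') = sigma_sets (space M) {a \<inter> b | a b. a \<in> sets S \<and> b \<in> sets S'}"
    unfolding join_def by (rule sets_measure_of[OF sub])
  show "sets S \<subseteq> sets (join S S')"
  proof
    fix a assume a: "a \<in> sets S"
    then have "a = a \<inter> space S'" using sets.sets_into_space[OF a] assms by auto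
    with a show "a \<in> sets (join S S')"
      unfolding sets by (intro sigma_sets.Basic) blast
  qed
  show "sets S' \<subseteq> sets (join S S')"
  proof
    fix a assume a: "a \<in> sets S'"
    then have "a = space S \<inter> a" using sets.sets_into_space[OF a] assms by auto
    with a show "a \<in> sets (join S S')"
      unfolding sets by (intro sigma_sets.Basic) blast
  qed
qed

text \<open>
On \<open>{N\<^sub>s = n}\<close> the path of \<open>X\<close> up to \<open>s\<close> involves only the first \<open>n\<close> marks.
\<close>

lemma F_restricted:
  assumes s: "0 \<le> s" and E: "E \<in> sets (F (ennreal s))"
  shows "E \<inter> {\<omega> \<in> space M. N s \<omega> = n} \<in> sets (join (past s) (alg ({Start} \<union> Mark ` {1..n})))"
    (is "_ \<inter> ?H \<in> sets ?Q")
proof -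
  have spQ: "space ?Q = space M" by (simp add: space_join)
  have NQ: "N u \<in> ?Q \<rightarrow>\<^sub>M count_space UNIV" if "0 \<le> u" "u \<le> s" for u
    by (rule measurable_mono_sets[OF measurable_past[OF that]]) (simp_all add: space_join left_join right_join)
  have X0Q: "X\<^sub>0 \<in> borel_measurable ?Q"
    by (rule measurable_mono_sets[OF measurable_Start[of "{Start} \<union> Mark ` {1..n}"]]) (simp_all add: space_join left_join right_join)
  have YQ: "Y k \<in> borel_measurable ?Q" if "k \<in> {1..n}" for k
    using that
    by (intro measurable_mono_sets[OF measurable_Mark[of k "{Start} \<union> Mark ` {1..n}"]]) (simp_all add: space_join left_join right_join)
  have "?H = N s -` {n} \<inter> space ?Q" unfolding spQ by auto
  then have H: "?H \<in> sets ?Q"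
    using measurable_sets[OF NQ[OF s order_refl], of "{n}"] by simp
  have "E \<in> sigma_sets (space M) (\<Union>u\<in>{u. 0 \<le> u \<and> ennreal u \<le> ennreal s}. {X u -` A \<inter> space M | A. A \<in> sets borel})"
    using E by (simp add: natural_filtration_def sets_generated_algebra)
  then show ?thesis
  proof (induction rule: sigma_sets.induct)
    case (Basic a)
    then obtain u A where u: "0 \<le> u" "u \<le> s" and A: "A \<in> sets borel" "a = X u -` A \<inter> space M"
      using s by (auto simp: ennreal_le_iff)
    define X' where "X' = (\<lambda>\<omega>. X\<^sub>0 \<omega> + (\<Sum>k = 1..min (N u \<omega>) n. Y k \<omega>))"
    have "(\<lambda>\<omega>. X\<^sub>0 \<omega> + (\<Sum>k = 1..min m n. Y k \<omega>)) \<in> borel_measurable ?Q" for m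
      using X0Q YQ by (intro borel_measurable_add borel_measurable_sum) auto
    from measurable_compose_countable[OF this NQ[OF u]]
    have X': "X' \<in> borel_measurable ?Q" unfolding X'_def .
    have "X' \<omega> = X u \<omega>" if "\<omega> \<in> ?H" for \<omega>
      using that N_mono[of \<omega> u s] u by (simp add: X'_def compound_process_def min_absorb1)
    then have "a \<inter> ?H = (X' -` A \<inter> space ?Q) \<inter> ?H"
      unfolding A(2) spQ by auto
    then show ?case
      using measurable_sets[OF X' A(1)] H by simp
  next
    case Empty
    then show ?case by simp
  next
    case (Compl a)
    have "(space M - a) \<inter> ?H = ?H - a \<inter> ?H" by auto
    then show ?case using Compl H by (simp only: sets.Diff)
  next
    case (Union a)
    have "(\<Union>i. a i) \<inter> ?H = (\<Union>i. a i \<inter> ?H)" by auto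
    also have "\<dots> \<in> sets ?Q"
      using Union.IH by (intro sets.countable_UN image_subsetI)
    finally show ?case .
  qed
qed

definition marks_after :: "nat \<Rightarrow> 'a \<Rightarrow> nat \<Rightarrow> real ^ 'd" where
  "marks_after n \<omega> = (\<lambda>i. Y (Suc (i + n)) \<omega>)"

lemma measurable_marks_after:
  "marks_after n \<in> alg (Mark ` {Suc n..}) \<rightarrow>\<^sub>M PiM UNIV (\<lambda>_. borel)"
  unfolding marks_after_def [abs_def]
  by (intro measurable_PiM_single') (auto intro!: measurable_Mark)

text \<open>
Because the marks are independent and identically distributed, skipping the first \<open>n\<close> of them does not
change the law of the sequence.
\<close>

lemma law_marks_after:
  "distr M (PiM UNIV (\<lambda>_. borel)) (marks_after n) = PiM UNIV (\<lambda>_. \<beta>\<^sub>0)"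
proof -
  define Y' where "Y' i = Y (Suc (i + n))" for i
  have Y' [measurable]: "Y' i \<in> borel_measurable M" for i
    unfolding Y'_def by (rule Y) simp
  have sub: "(\<Union>j. {Mark (Suc (j + n))}) \<subseteq> all_sources"
    by (auto simp: all_sources_def)
  have "indep_sets (\<lambda>j. sigma_sets (space M) (\<Union>i\<in>{Mark (Suc (j + n))}. sets (src i))) UNIV"
    by (rule indep_sets_collect_sigma[OF indep_sets_mono_index[OF sub indep_src]])
      (auto simp: sets.Int_stable disjoint_family_on_def)
  moreover have "sets (src (Mark (Suc (j + n)))) = {Y' j -` A \<inter> space M | A. A \<in> sets borel}" for j
    unfolding src_def Y'_def by (simp add: sets_vimage_algebra2)
  ultimately have "indep_vars (\<lambda>_. borel) Y' UNIV"
    unfolding indep_vars_def by (simp add: Y')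
  then have "distr M (PiM UNIV (\<lambda>_. borel)) (\<lambda>\<omega>. \<lambda>i\<in>UNIV. Y' i \<omega>) = PiM UNIV (\<lambda>i. distr M borel (Y' i))"
    by (subst (asm) indep_vars_iff_distr_eq_PiM) (auto intro: Y')
  moreover have "distr M borel (Y' i) = \<beta>\<^sub>0" for i
    unfolding Y'_def by (rule Y_distr) simp
  ultimately show ?thesis
    by (simp add: marks_after_def [abs_def] Y'_def restrict_def)
qed

text \<open>
A functional of the increments of \<open>N\<close> after \<open>s\<close> and of the marks after the \<open>N\<^sub>s\<close>-th one is independent of
the observations up to \<open>s\<close>. The number of skipped marks is random and belongs to the past, so split
according to \<open>N\<^sub>s = n\<close>: there the past uses only the first \<open>n\<close> marks and the functional only the later
ones, and the law of the functional does not depend on \<open>n\<close>. Summation over \<open>n\<close> gives the claim.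
\<close>

lemma future_functional:
  fixes \<Psi> :: "'a \<times> (nat \<Rightarrow> real ^ 'd) \<Rightarrow> 'b"
  assumes s: "0 \<le> s" and \<Psi>: "\<Psi> \<in> future s \<Otimes>\<^sub>M PiM UNIV (\<lambda>_. borel) \<rightarrow>\<^sub>M S"
  defines "\<xi> \<equiv> \<lambda>\<omega>. \<Psi> (\<omega>, marks_after (N s \<omega>) \<omega>)"
  shows measurable_future_functional: "\<xi> \<in> M \<rightarrow>\<^sub>M S"
    and indep_future_functional: "\<And>E C. E \<in> sets (F (ennreal s)) \<Longrightarrow> C \<in> sets S \<Longrightarrow>
      prob (E \<inter> (\<xi> -` C \<inter> space M)) = prob E * prob (\<xi> -` C \<inter> space M)"
proof -
  define \<xi>' where "\<xi>' n \<omega> = \<Psi> (\<omega>, marks_after n \<omega>)" for n \<omega>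
  let ?B = "\<lambda>n. alg (Mark ` {Suc n..})"
  have marks: "Mark ` {Suc n..} \<subseteq> all_sources - {Count}" for n
    by (auto simp: all_sources_def)
  have \<xi>'Q: "\<xi>' n \<in> join (future s) (?B n) \<rightarrow>\<^sub>M S" for n
  proof -
    have "(\<lambda>\<omega>. \<omega>) \<in> join (future s) (?B n) \<rightarrow>\<^sub>M future s"
      by (rule measurable_mono_sets[OF measurable_ident_sets[OF refl]]) (simp_all add: space_join left_join right_join)
    moreover have "marks_after n \<in> join (future s) (?B n) \<rightarrow>\<^sub>M PiM UNIV (\<lambda>_. borel)"
      by (rule measurable_mono_sets[OF measurable_marks_after]) (simp_all add: space_join left_join right_join)
    ultimately show ?thesis
      unfolding \<xi>'_def by (intro measurable_compose[OF measurable_Pair \<Psi>])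
  qed
  have subF: "subalgebra M (future s)"
    using past_future_Count(2)[OF s] alg_events[of "{Count}"] by (auto simp: subalgebra_def all_sources_def)
  have subB: "subalgebra M (?B n)" for n
    using marks by (intro subalgebra_alg) auto
  have subQ: "subalgebra M (join (future s) (?B n))" for n
  proof -
    have "{a \<inter> b | a b. a \<in> sets (future s) \<and> b \<in> sets (?B n)} \<subseteq> events"
      using subF subB[of n] by (auto simp: subalgebra_def)
    then show ?thesis
      unfolding subalgebra_def by (simp add: join sets.sigma_sets_subset)
  qed
  have \<xi>'M: "\<xi>' n \<in> M \<rightarrow>\<^sub>M S" for n
    by (rule measurable_from_subalg[OF subQ \<xi>'Q])
  have Ns: "N s \<in> M \<rightarrow>\<^sub>M count_space UNIV" by (rule N_meas[OF s])
  have \<xi>_eq: "\<xi> = (\<lambda>\<omega>. \<xi>' (N s \<omega>) \<omega>)"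
    by (simp add: \<xi>_def \<xi>'_def)
  show \<xi>M: "\<xi> \<in> M \<rightarrow>\<^sub>M S"
    unfolding \<xi>_eq by (rule measurable_compose_countable[OF \<xi>'M Ns])
  have law: "prob (\<xi>' n -` C \<inter> space M) = prob (\<xi>' 0 -` C \<inter> space M)" if C: "C \<in> sets S" for n C
  proof -
    have "emeasure M (\<xi>' m -` C \<inter> space M)
      = (\<integral>\<^sup>+\<omega>. (\<integral>\<^sup>+y. indicator C (\<Psi> (\<omega>, y)) \<partial>PiM UNIV (\<lambda>_. \<beta>\<^sub>0)) \<partial>M)" for m
    proof -
      have "emeasure M (\<xi>' m -` C \<inter> space M) = (\<integral>\<^sup>+\<omega>. indicator (\<xi>' m -` C \<inter> space M) \<omega> \<partial>M)"
        using measurable_sets[OF \<xi>'M C] by simp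
      also have "\<dots> = (\<integral>\<^sup>+\<omega>. indicator C (\<Psi> (\<omega>, marks_after m \<omega>)) \<partial>M)"
        by (rule nn_integral_cong) (auto simp: \<xi>'_def split: split_indicator)
      also have "\<dots> = (\<integral>\<^sup>+\<omega>. (\<integral>\<^sup>+y. indicator C (\<Psi> (\<omega>, y)) \<partial>distr M (PiM UNIV (\<lambda>_. borel)) (marks_after m)) \<partial>M)"
      proof (rule nn_integral_indep_freeze[OF subF])
        show "marks_after m \<in> M \<rightarrow>\<^sub>M PiM UNIV (\<lambda>_. borel)"
          by (rule measurable_from_subalg[OF subB measurable_marks_after])
        show "(\<lambda>z. indicator C (\<Psi> z)) \<in> borel_measurable (future s \<Otimes>\<^sub>M PiM UNIV (\<lambda>_. borel))"
          by (rule measurable_compose[OF \<Psi> borel_measurable_indicator[OF C]])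
        fix E D assume "E \<in> sets (future s)" "D \<in> sets (PiM (UNIV :: nat set) (\<lambda>_. borel :: (real ^ 'd) measure))"
        then have E: "E \<in> sets (alg {Count})" and D: "marks_after m -` D \<inter> space M \<in> sets (?B m)"
          using past_future_Count(2)[OF s] measurable_sets[OF measurable_marks_after, of D m] by auto
        show "prob (E \<inter> (marks_after m -` D \<inter> space M)) = prob E * prob (marks_after m -` D \<inter> space M)"
          by (rule indep_alg[OF _ _ _ E D]) (auto simp: all_sources_def)
      qed
      finally show ?thesis by (simp only: law_marks_after)
    qed
    then show ?thesis by (simp add: measure_def)
  qed
  fix E C assume E: "E \<in> sets (F (ennreal s))" and C: "C \<in> sets S"
  define H where "H n = {\<omega> \<in> space M. N s \<omega> = n}" for n
  have [measurable]: "E \<in> events" by (rule sets_F_events[OF E])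
  have Hm [measurable]: "H n \<in> events" for n
    using measurable_sets[OF Ns, of "{n}"] by (simp add: H_def vimage_def Int_def conj_commute)
  have [measurable]: "\<xi>' n -` C \<inter> space M \<in> events" for n by (rule measurable_sets[OF \<xi>'M C])
  have split: "(\<lambda>n. prob (D \<inter> H n \<inter> (\<xi>' n -` C \<inter> space M))) sums prob (D \<inter> (\<xi> -` C \<inter> space M))"
    if [measurable]: "D \<in> events" for D
  proof -
    have "(\<lambda>n. prob (D \<inter> H n \<inter> (\<xi>' n -` C \<inter> space M))) sums prob (\<Union>n. D \<inter> H n \<inter> (\<xi>' n -` C \<inter> space M))"
    proof (rule finite_measure_UNION[OF image_subsetI])
      show "disjoint_family (\<lambda>n. D \<inter> H n \<inter> (\<xi>' n -` C \<inter> space M))"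
        by (auto simp: disjoint_family_on_def H_def)
    qed measurable
    also have "(\<Union>n. D \<inter> H n \<inter> (\<xi>' n -` C \<inter> space M)) = D \<inter> (\<xi> -` C \<inter> space M)"
      by (auto simp: H_def \<xi>_eq)
    finally show ?thesis .
  qed
  have total: "(\<lambda>n. prob (D \<inter> H n)) sums prob D" if [measurable]: "D \<in> events" for D
  proof -
    have "(\<lambda>n. prob (D \<inter> H n)) sums prob (\<Union>n. D \<inter> H n)"
    proof (rule finite_measure_UNION[OF image_subsetI])
      show "disjoint_family (\<lambda>n. D \<inter> H n)"
        by (auto simp: disjoint_family_on_def H_def)
    qed measurable
    also have "(\<Union>n. D \<inter> H n) = D"
      using sets.sets_into_space[OF that] by (auto simp: H_def)
    finally show ?thesis .
  qed
  let ?q = "prob (\<xi>' 0 -` C \<inter> space M)"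
  have block: "prob (D \<inter> H n \<inter> (\<xi>' n -` C \<inter> space M)) = prob (D \<inter> H n) * ?q"
    if D: "D \<in> sets (F (ennreal s))" for D n
  proof -
    have 1: "D \<inter> H n \<in> sigma_sets (space M) {a \<inter> b | a b. a \<in> sets (past s) \<and> b \<in> sets (alg ({Start} \<union> Mark ` {1..n}))}"
      using F_restricted[OF s D, of n] by (simp add: join H_def)
    have 2: "\<xi>' n -` C \<inter> space M \<in> sigma_sets (space M) {a \<inter> b | a b. a \<in> sets (future s) \<and> b \<in> sets (?B n)}"
      using measurable_sets[OF \<xi>'Q C, of n] by (simp add: join)
    have "prob (D \<inter> H n \<inter> (\<xi>' n -` C \<inter> space M)) = prob (D \<inter> H n) * prob (\<xi>' n -` C \<inter> space M)"
      by (rule indep_blocks[OF s _ _ _ 1 2]) (auto simp: all_sources_def)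
    then show ?thesis by (simp only: law[OF C, of n])
  qed
  have factor: "prob (D \<inter> (\<xi> -` C \<inter> space M)) = prob D * ?q" if D: "D \<in> sets (F (ennreal s))" for D
  proof -
    have ev: "D \<in> events" by (rule sets_F_events[OF D])
    have "(\<lambda>n. prob (D \<inter> H n) * ?q) sums (prob D * ?q)"
      by (rule sums_mult2[OF total[OF ev]])
    with split[OF ev] show ?thesis
      unfolding block[OF D] by (rule sums_unique2)
  qed
  have "prob (\<xi> -` C \<inter> space M) = ?q"
    using factor[of "space M"] sets.top[of "F (ennreal s)"]
    by (simp add: prob_space Int_absorb1)
  then show "prob (E \<inter> (\<xi> -` C \<inter> space M)) = prob E * prob (\<xi> -` C \<inter> space M)"
    using factor[OF E] by simp
qed

end

context poisson_disorder
begin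

section \<open>The Markov property\<close>

text \<open>
The coefficients of the affine recursion for the weights of all \<open>v \<in> A\<close>, written as a functional of the
future increments and the future marks \<open>y\<close>.
\<close>

definition update_input :: "real set \<Rightarrow> real \<Rightarrow> real \<Rightarrow> 'a \<times> (nat \<Rightarrow> real ^ 'd) \<Rightarrow> real \<Rightarrow> ennreal \<times> ennreal" where
  "update_input A s t = (\<lambda>(\<omega>, y). \<lambda>v\<in>A.
     (ennreal (exp (- (v - \<mu>) * (t - s)) * (\<Prod>i\<in>{0..<N t \<omega> - N s \<omega>}. v / \<mu> * r (y i))),
      ennreal (measure \<gamma> {v}) * (\<integral>\<^sup>+u. ennreal (exp (- (v - \<mu>) * (t - u)) *
        (\<Prod>i\<in>{N (max s u) \<omega> - N s \<omega>..<N t \<omega> - N s \<omega>}. v / \<mu> * r (y i))) * indicator {s<..t} u \<partial>\<eta>)))"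

lemma measurable_update_input:
  assumes s: "0 \<le> s" "s \<le> t"
  shows "update_input A s t \<in> future s \<Otimes>\<^sub>M PiM UNIV (\<lambda>_. borel) \<rightarrow>\<^sub>M PiM A (\<lambda>_. borel \<Otimes>\<^sub>M borel)"
proof -
  let ?S = "future s \<Otimes>\<^sub>M PiM UNIV (\<lambda>_::nat. borel :: (real ^ 'd) measure)"
  interpret \<eta>: prob_space \<eta> by (rule prob_space_\<eta>)
  have K: "(\<lambda>z. N t (fst z) - N s (fst z)) \<in> ?S \<rightarrow>\<^sub>M count_space UNIV"
    by (rule measurable_compose[OF measurable_fst measurable_future[OF s(2)]])
  have y: "(\<lambda>z. snd z i) \<in> borel_measurable ?S" for i
    by (rule measurable_compose[OF measurable_snd measurable_component_singleton]) simp
  have m1: "(\<lambda>z. \<Prod>i\<in>{0..<N t (fst z) - N s (fst z)}. w * r (snd z i)) \<in> borel_measurable ?S" for w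
    by (rule measurable_mark_product[OF _ K y]) simp
  have m2: "(\<lambda>z. \<integral>\<^sup>+u. ennreal (exp (- (v - \<mu>) * (t - u)) *
        (\<Prod>i\<in>{N (max s u) (fst z) - N s (fst z)..<N t (fst z) - N s (fst z)}. v / \<mu> * r (snd z i))) * indicator {s<..t} u \<partial>\<eta>)
      \<in> borel_measurable ?S" for v
  proof (rule \<eta>.borel_measurable_nn_integral)
    have fs: "(\<lambda>z. (fst (fst z), snd z)) \<in> ?S \<Otimes>\<^sub>M \<eta> \<rightarrow>\<^sub>M future s \<Otimes>\<^sub>M borel"
      by measurable
    have K1: "(\<lambda>z. N (max s (snd z)) (fst (fst z)) - N s (fst (fst z))) \<in> ?S \<Otimes>\<^sub>M \<eta> \<rightarrow>\<^sub>M count_space UNIV"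
      using measurable_compose[OF fs measurable_count_joint[OF space_future s(1) measurable_future]] by simp
    have K2: "(\<lambda>z. N t (fst (fst z)) - N s (fst (fst z))) \<in> ?S \<Otimes>\<^sub>M \<eta> \<rightarrow>\<^sub>M count_space UNIV"
      by (rule measurable_compose[OF measurable_fst K])
    have y': "(\<lambda>z. snd (fst z) i) \<in> borel_measurable (?S \<Otimes>\<^sub>M \<eta>)" for i
      by (rule measurable_compose[OF measurable_fst y])
    define Q where "Q = (\<lambda>z :: ('a \<times> (nat \<Rightarrow> real ^ 'd)) \<times> real.
      \<Prod>i\<in>{N (max s (snd z)) (fst (fst z)) - N s (fst (fst z))..<N t (fst (fst z)) - N s (fst (fst z))}. v / \<mu> * r (snd (fst z) i))"
    have [measurable]: "Q \<in> borel_measurable (?S \<Otimes>\<^sub>M \<eta>)"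
      unfolding Q_def using K1 K2 y' by (rule measurable_mark_product)
    have [measurable]: "(snd :: _ \<Rightarrow> real) \<in> borel_measurable (?S \<Otimes>\<^sub>M \<eta>)"
      using measurable_snd[of ?S \<eta>] by (simp cong: measurable_cong_sets)
    have "(\<lambda>z. ennreal (exp (- (v - \<mu>) * (t - snd z)) * Q z) * indicator {s<..t} (snd z)) \<in> borel_measurable (?S \<Otimes>\<^sub>M \<eta>)"
      by measurable
    then show "(\<lambda>(z, u). ennreal (exp (- (v - \<mu>) * (t - u)) *
        (\<Prod>i\<in>{N (max s u) (fst z) - N s (fst z)..<N t (fst z) - N s (fst z)}. v / \<mu> * r (snd z i))) * indicator {s<..t} u)
      \<in> borel_measurable (?S \<Otimes>\<^sub>M \<eta>)"
      unfolding Q_def split_beta' .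
  qed
  have c1: "(\<lambda>z. ennreal (exp (- (v - \<mu>) * (t - s)) * (\<Prod>i\<in>{0..<N t (fst z) - N s (fst z)}. v / \<mu> * r (snd z i))))
      \<in> borel_measurable ?S" for v
    by (rule measurable_compose[OF borel_measurable_times[OF borel_measurable_const m1] measurable_ennreal])
  note c2 = borel_measurable_times_ennreal[OF borel_measurable_const m2]
  show ?thesis
    unfolding update_input_def split_beta'
    by (rule measurable_restrict, rule measurable_Pair, rule c1, rule c2)
qed

lemma update_input_eq:
  assumes \<omega>: "\<omega> \<in> space M" and s: "0 \<le> s" "s \<le> t"
  shows "update_input A s t (\<omega>, marks_after (N s \<omega>) \<omega>) = (\<lambda>v\<in>A. (ell v t s \<omega>, odds_input v s t \<omega>))"
proof -
  have shift: "(\<Prod>i\<in>{N u \<omega> - N s \<omega>..<N t \<omega> - N s \<omega>}. v / \<mu> * r (Y (Suc (i + N s \<omega>)) \<omega>))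
      = (\<Prod>i\<in>{N u \<omega>..<N t \<omega>}. v / \<mu> * r (Y (Suc i) \<omega>))" if "s \<le> u" "u \<le> t" for u v
  proof -
    have "N s \<omega> \<le> N u \<omega>" "N u \<omega> \<le> N t \<omega>" using that s \<omega> by (auto intro: N_mono)
    then show ?thesis
      using prod.shift_bounds_nat_ivl[of "\<lambda>i. v / \<mu> * r (Y (Suc i) \<omega>)" "N u \<omega> - N s \<omega>" "N s \<omega>" "N t \<omega> - N s \<omega>"]
      by simp
  qed
  have "ennreal (exp (- (v - \<mu>) * (t - s)) * (\<Prod>i\<in>{0..<N t \<omega> - N s \<omega>}. v / \<mu> * r (Y (Suc (i + N s \<omega>)) \<omega>))) = ell v t s \<omega>" for v
    using shift[of s v] s by (simp add: ell_def likelihood_quotient_shift)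
  moreover have "(\<integral>\<^sup>+u. ennreal (exp (- (v - \<mu>) * (t - u)) *
        (\<Prod>i\<in>{N (max s u) \<omega> - N s \<omega>..<N t \<omega> - N s \<omega>}. v / \<mu> * r (Y (Suc (i + N s \<omega>)) \<omega>))) * indicator {s<..t} u \<partial>\<eta>)
     = (\<integral>\<^sup>+u. ell v t u \<omega> * indicator {s<..t} u \<partial>\<eta>)" for v
  proof (rule nn_integral_cong)
    fix u
    show "ennreal (exp (- (v - \<mu>) * (t - u)) *
        (\<Prod>i\<in>{N (max s u) \<omega> - N s \<omega>..<N t \<omega> - N s \<omega>}. v / \<mu> * r (Y (Suc (i + N s \<omega>)) \<omega>))) * indicator {s<..t} u
      = ell v t u \<omega> * indicator {s<..t} u"
    proof (cases "u \<in> {s<..t}")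
      case True
      then have "max s u = u" "s \<le> u" "u \<le> t" by auto
      then show ?thesis
        by (simp only: shift ell_def likelihood_quotient_shift)
    qed simp
  qed
  ultimately show ?thesis
    by (simp add: update_input_def marks_after_def odds_input_def)
qed

end

context discrete_poisson_disorder
begin

lemma joint_process_markov:
  fixes \<Phi> :: "nat \<Rightarrow> real \<Rightarrow> 'a \<Rightarrow> real"
  assumes \<Phi>: "\<And>j. odds_moment_version M P F \<mu> \<Lambda> \<theta> j (\<Phi> j)"
  shows "markov_process M F (Pi\<^sub>M {..<k} (\<lambda>_. borel)) (joint_process k \<Phi>)"
  unfolding markov_process_def
proof (intro conjI allI impI)
  let ?S = "Pi\<^sub>M {..<k} (\<lambda>_::nat. borel :: real measure)"
  have adapted: "joint_process k \<Phi> t \<in> F (ennreal t) \<rightarrow>\<^sub>M ?S" if "0 \<le> t" for t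
    unfolding joint_process_def [abs_def] using \<Phi> that
    by (intro measurable_restrict) (auto simp: odds_moment_version_def)
  then show "joint_process k \<Phi> t \<in> F (ennreal t) \<rightarrow>\<^sub>M ?S" if "0 \<le> t" for t
    using that .
  fix s t :: real and B assume s: "0 \<le> s" "s \<le> t" and B: "B \<in> sets ?S"
  then have t: "0 \<le> t" by simp
  have "\<forall>v\<in>V. \<exists>q :: nat \<Rightarrow> real. \<forall>w\<in>V. (\<Sum>l<k. q l * (w - \<mu>) ^ l) = (if w = v then 1 else 0)"
    using moments_invertible[of V "\<lambda>v. v - \<mu>"] finite_V card_V by (auto simp: inj_on_def)
  then obtain q :: "real \<Rightarrow> nat \<Rightarrow> real" where
    q: "\<And>v w. v \<in> V \<Longrightarrow> w \<in> V \<Longrightarrow> (\<Sum>l<k. q v l * (w - \<mu>) ^ l) = (if w = v then 1 else 0)"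
    by metis
  define T where "T = Pi\<^sub>M V (\<lambda>_. borel \<Otimes>\<^sub>M borel :: (ennreal \<times> ennreal) measure)"
  define \<xi> where "\<xi> = (\<lambda>\<omega>. update_input V s t (\<omega>, marks_after (N s \<omega>) \<omega>))"
  \<comment> \<open>Recover the weights at \<open>s\<close> by interpolation, apply the recursion, and take moments again.\<close>
  define upd where "upd = (\<lambda>(z, x). \<lambda>j\<in>{..<k}. \<Sum>v\<in>V. (v - \<mu>) ^ j *
    (enn2real (fst (x v) * ennreal (survival s * (\<Sum>l<k. q v l * z l)) + snd (x v :: ennreal \<times> ennreal)) / survival t))"
  have upd: "upd \<in> ?S \<Otimes>\<^sub>M T \<rightarrow>\<^sub>M ?S"
  proof -
    have x: "(\<lambda>z. snd z v) \<in> ?S \<Otimes>\<^sub>M T \<rightarrow>\<^sub>M borel \<Otimes>\<^sub>M borel" if "v \<in> V" for v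
      unfolding T_def using that
      by (intro measurable_compose[OF measurable_snd measurable_component_singleton])
    have z: "(\<lambda>z. fst z l) \<in> borel_measurable (?S \<Otimes>\<^sub>M T)" if "l \<in> {..<k}" for l
      using that by (intro measurable_compose[OF measurable_fst measurable_component_singleton])
    have "(\<lambda>z. (v - \<mu>) ^ j * (enn2real (fst (snd z v) * ennreal (survival s * (\<Sum>l<k. q v l * fst z l)) + snd (snd z v)) / survival t))
      \<in> borel_measurable (?S \<Otimes>\<^sub>M T)" if v: "v \<in> V" for v j
    proof -
      have [measurable]: "(\<lambda>z. \<Sum>l<k. q v l * fst z l) \<in> borel_measurable (?S \<Otimes>\<^sub>M T)"
        using z by (intro borel_measurable_sum borel_measurable_times) auto
      have [measurable]: "(\<lambda>z. fst (snd z v)) \<in> borel_measurable (?S \<Otimes>\<^sub>M T)"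
        "(\<lambda>z. snd (snd z v)) \<in> borel_measurable (?S \<Otimes>\<^sub>M T)"
        using measurable_compose[OF x[OF v] measurable_fst] measurable_compose[OF x[OF v] measurable_snd] by auto
      show ?thesis by measurable
    qed
    then show ?thesis
      unfolding upd_def split_beta' by (intro measurable_restrict borel_measurable_sum)
  qed
  have eq: "AE \<omega> in M. joint_process k \<Phi> t \<omega> = upd (joint_process k \<Phi> s \<omega>, \<xi> \<omega>)"
  proof -
    have "AE \<omega> in M. \<forall>j. \<Phi> j u \<omega> = (\<Sum>v\<in>V. (v - \<mu>) ^ j * (enn2real (odds_mass v u \<omega>) / survival u))"
      if "0 \<le> u" for u
      using odds_moment_formula[OF \<Phi> that] by (simp add: AE_all_countable)
    from this[OF s(1)] this[OF t]
    moreover have "AE \<omega> in M. \<forall>v\<in>V. odds_mass v s \<omega> < \<infinity>"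
      using AE_odds_mass_finite[OF s(1)] by (intro AE_finite_allI finite_V)
    ultimately show ?thesis
      using AE_space
    proof eventually_elim
      fix \<omega> assume \<omega>: "\<omega> \<in> space M" and fin: "\<forall>v\<in>V. odds_mass v s \<omega> < \<infinity>"
        and at_s: "\<forall>j. \<Phi> j s \<omega> = (\<Sum>v\<in>V. (v - \<mu>) ^ j * (enn2real (odds_mass v s \<omega>) / survival s))"
        and at_t: "\<forall>j. \<Phi> j t \<omega> = (\<Sum>v\<in>V. (v - \<mu>) ^ j * (enn2real (odds_mass v t \<omega>) / survival t))"
      have inv: "(\<Sum>l<k. q v l * \<Phi> l s \<omega>) = enn2real (odds_mass v s \<omega>) / survival s" if v: "v \<in> V" for v
      proof -
        have "(\<Sum>l<k. q v l * \<Phi> l s \<omega>)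
          = (\<Sum>w\<in>V. (\<Sum>l<k. q v l * (w - \<mu>) ^ l) * (enn2real (odds_mass w s \<omega>) / survival s))"
          unfolding at_s[rule_format] sum_distrib_left sum_distrib_right
          by (subst sum.swap) (simp only: mult.assoc)
        also have "\<dots> = (\<Sum>w\<in>V. if w = v then enn2real (odds_mass w s \<omega>) / survival s else 0)"
          using q[OF v] by (intro sum.cong) auto
        finally show ?thesis using finite_V v by simp
      qed
      have "odds_mass v t \<omega> = fst (\<xi> \<omega> v) * ennreal (survival s * (\<Sum>l<k. q v l * joint_process k \<Phi> s \<omega> l)) + snd (\<xi> \<omega> v)"
        if v: "v \<in> V" for v
      proof -
        have "(\<Sum>l<k. q v l * joint_process k \<Phi> s \<omega> l) = (\<Sum>l<k. q v l * \<Phi> l s \<omega>)"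
          by (intro sum.cong) (auto simp: joint_process_def)
        then have "survival s * (\<Sum>l<k. q v l * joint_process k \<Phi> s \<omega> l) = enn2real (odds_mass v s \<omega>)"
          using inv[OF v] survival_pos[OF s(1)] by simp
        then show ?thesis
          using odds_mass_recursion[OF \<omega> s, of v] V_pos[OF v] fin v
          by (simp add: \<xi>_def update_input_eq[OF \<omega> s])
      qed
      then show "joint_process k \<Phi> t \<omega> = upd (joint_process k \<Phi> s \<omega>, \<xi> \<omega>)"
        using at_t by (simp add: upd_def joint_process_def [of k \<Phi> t] fun_eq_iff)
    qed
  qed
  have Z': "joint_process k \<Phi> t \<in> M \<rightarrow>\<^sub>M ?S"
    by (rule measurable_from_subalg[OF subalgebra_F adapted[OF t]])
  note \<Psi> = measurable_update_input[OF s, of V, folded T_def]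
  show "AE \<omega> in M. real_cond_exp M (F (ennreal s)) (\<lambda>\<omega>. indicator B (joint_process k \<Phi> t \<omega>)) \<omega> =
           real_cond_exp M (vimage_algebra (space M) (joint_process k \<Phi> s) ?S) (\<lambda>\<omega>. indicator B (joint_process k \<Phi> t \<omega>)) \<omega>"
    using indep_future_functional[OF s(1) \<Psi>] measurable_future_functional[OF s(1) \<Psi>]
    by (intro markov_step[OF subalgebra_F adapted[OF s(1)] Z' B _ _ upd eq]) (auto simp: \<xi>_def)
qed

end

section \<open>The penalty as a running cost\<close>

lemma (in prob_space) time_fubini:
  assumes "(\<lambda>(t, \<omega>). h t \<omega>) \<in> borel_measurable (lborel \<Otimes>\<^sub>M M)"
  shows "(\<integral>\<^sup>+\<omega>. (\<integral>\<^sup>+t. h t \<omega> \<partial>lborel) \<partial>M) = (\<integral>\<^sup>+t. (\<integral>\<^sup>+\<omega>. h t \<omega> \<partial>M) \<partial>lborel)"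
proof -
  interpret pair_sigma_finite lborel M ..
  show ?thesis using Fubini[OF assms] by simp
qed

text \<open>
Solves for \<open>pen\<close> an identity without subtractions; \<open>q\<close> may be infinite, and then so is \<open>pen\<close>.
\<close>

lemma ennreal_rearrange:
  assumes "pen + ennreal b * n = ennreal a + ennreal b * q" "n < \<infinity>" "0 \<le> a" "0 < b"
  shows "enn2ereal pen = ereal a + ereal b * (enn2ereal q - enn2ereal n)"
proof -
  obtain n' where n: "n = ennreal n'" "0 \<le> n'" using assms(2) by (cases n) auto
  show ?thesis
  proof (cases q)
    case (real q')
    then have fin: "pen + ennreal (b * n') = ennreal (a + b * q')"
      using assms n by (simp add: ennreal_mult[symmetric] ennreal_plus[symmetric] del: ennreal_plus)
    then have "pen \<noteq> \<top>" by auto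
    then obtain x where x: "pen = ennreal x" "0 \<le> x" by (cases pen) auto
    have "ennreal (x + b * n') = ennreal (a + b * q')"
      using fin x n assms(4) by simp
    then have "x + b * n' = a + b * q'"
      using x n real assms(3,4) by (subst (asm) ennreal_inj) auto
    then show ?thesis
      using x n real by (simp add: enn2ereal_ennreal algebra_simps)
  next
    case top
    then have "pen + ennreal (b * n') = \<top>"
      using assms n by (simp add: ennreal_mult[symmetric] ennreal_mult_top)
    then have "pen = \<top>" by simp
    then show ?thesis
      using top n assms(4) by (simp add: enn2ereal_ennreal)
  qed
qed

text \<open>
Truncated subtraction makes both sides vanish for \<open>\<tau> \<le> a\<close>.
\<close>

lemma delay_eq_integral:
  assumes "0 \<le> a"
  shows "\<tau> - ennreal a = (\<integral>\<^sup>+t. indicator {t. a \<le> t \<and> ennreal t < \<tau>} t \<partial>lborel)"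
proof (cases \<tau>)
  case (real x)
  have "{t. a \<le> t \<and> ennreal t < \<tau>} = {a..<x}"
    using assms real by (auto simp: ennreal_less_iff)
  then show ?thesis
    using real assms by (cases "a \<le> x") (auto simp: ennreal_minus emeasure_lborel_Ico ennreal_neg)
next
  case top
  have "{t. a \<le> t \<and> ennreal t < \<tau>} = {a..}" using top by auto
  moreover have "emeasure lborel {a..} = \<infinity>"
  proof (rule ccontr)
    assume "emeasure lborel {a..} \<noteq> \<infinity>"
    then obtain x where x: "emeasure lborel {a..} = ennreal x" "0 \<le> x"
      by (cases "emeasure lborel {a..}") auto
    obtain n where n: "x < real n" using reals_Archimedean2 by blast
    have "ennreal (real n) \<le> emeasure lborel {a..}"
      using emeasure_mono[of "{a..a + real n}" "{a..}" lborel] by simp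
    then show False using x n by simp
  qed
  ultimately show ?thesis using top by simp
qed

text \<open>
This turns the discount factor at \<open>\<tau>\<close> into a running cost, including the case \<open>\<tau> = \<infinity>\<close>.
\<close>

lemma discounted_time:
  fixes \<rho> :: real
  assumes \<rho>: "0 < \<rho>"
  shows "(\<integral>\<^sup>+t\<in>{t. 0 \<le> t \<and> ennreal t < \<tau>}. ennreal (\<rho> * exp (- \<rho> * t)) \<partial>lborel)
    + (if \<tau> = \<infinity> then 0 else ennreal (exp (- \<rho> * enn2real \<tau>))) = 1"
proof -
  have deriv: "((\<lambda>t. - exp (- \<rho> * t)) has_real_derivative \<rho> * exp (- \<rho> * t)) (at t)" for t
    by (auto intro!: derivative_eq_intros)
  show ?thesis
  proof (cases \<tau>)
    case (real x)
    have "(\<integral>\<^sup>+t\<in>{t. 0 \<le> t \<and> ennreal t < \<tau>}. ennreal (\<rho> * exp (- \<rho> * t)) \<partial>lborel)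
        = (\<integral>\<^sup>+t. ennreal (\<rho> * exp (- \<rho> * t)) * indicator {0..x} t \<partial>lborel)"
      using AE_lborel_singleton[of x] real
      by (intro nn_integral_cong_AE) (auto simp: ennreal_less_iff split: split_indicator)
    also have "\<dots> = ennreal (- exp (- \<rho> * x) - - exp (- \<rho> * 0))"
      using \<rho> real deriv by (intro nn_integral_FTC_Icc) (auto intro: has_field_derivative_at_within)
    finally show ?thesis
      using real \<rho> by (simp add: ennreal_plus[symmetric] del: ennreal_plus)
  next
    case top
    have "filterlim (\<lambda>t. - \<rho> * t) at_bot at_top"
      using \<rho> by (intro filterlim_tendsto_neg_mult_at_bot[OF tendsto_const] filterlim_ident) simp
    then have "((\<lambda>t. exp (- \<rho> * t)) \<longlongrightarrow> 0) at_top"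
      by (rule filterlim_compose[OF exp_at_bot])
    then have lim: "((\<lambda>t. - exp (- \<rho> * t)) \<longlongrightarrow> 0) at_top"
      using tendsto_minus by fastforce
    have "(\<integral>\<^sup>+t\<in>{t. 0 \<le> t \<and> ennreal t < \<tau>}. ennreal (\<rho> * exp (- \<rho> * t)) \<partial>lborel)
        = (\<integral>\<^sup>+t. ennreal (\<rho> * exp (- \<rho> * t)) * indicator {0..} t \<partial>lborel)"
      using top by (intro nn_integral_cong) (auto split: split_indicator)
    also have "\<dots> = ennreal (0 - - exp (- \<rho> * 0))"
      using \<rho> deriv by (intro nn_integral_FTC_atLeast[OF _ _ _ lim]) auto
    finally show ?thesis using top by simp
  qed
qed

lemma dyadic_between:
  fixes x y :: real
  assumes "0 \<le> x" "x < y"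
  shows "\<exists>n i :: nat. x \<le> real i / 2 ^ n \<and> real i / 2 ^ n < y"
proof -
  obtain n where n: "(1/2) ^ n < y - x"
    using real_arch_pow_inv[of "y - x" "1/2"] assms by auto
  define i where "i = nat \<lceil>x * 2 ^ n\<rceil>"
  have "0 \<le> x * 2 ^ n" using assms by simp
  then have i: "x * 2 ^ n \<le> real i" "real i < x * 2 ^ n + 1"
    unfolding i_def by linarith+
  have "real i / 2 ^ n < x + (1/2) ^ n"
    using i(2) by (simp add: field_simps power_divide)
  then show ?thesis
    using i(1) n by (intro exI[of _ n] exI[of _ i]) (auto simp: field_simps)
qed

context discrete_poisson_disorder
begin

lemma stopping_time_events:
  assumes \<tau>: "stopping_time F \<tau>"
  shows "{\<omega> \<in> space M. \<tau> \<omega> \<le> t} \<in> sets (F t)" "{\<omega> \<in> space M. t < \<tau> \<omega>} \<in> sets (F t)"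
  using stopping_timeD[OF \<tau>, of t] stopping_timeD2[OF \<tau>, of t]
  by (auto simp: pred_def)

lemma stopping_time_measurable:
  assumes \<tau>: "stopping_time F \<tau>"
  shows "\<tau> \<in> borel_measurable (F \<infinity>)"
proof (rule measurable_stopping_time[OF \<tau>])
  show "sets (F t) \<subseteq> sets (F \<infinity>)" for t by (rule sets_F_mono) simp
qed simp

text \<open>
As \<open>n\<close> grows, the events that some multiple of \<open>2\<^sup>-\<^sup>n\<close> lies in \<open>[\<tau>, \<theta>)\<close> increase to
\<open>{\<tau> < \<theta>}\<close>. Splitting each of them according to the first such multiple \<open>q\<close> gives pieces that are known at \<open>q\<close> and lie in \<open>{q < \<theta>}\<close>,
where the density is one.
\<close>

lemma P_eq_M_before_change:
  assumes \<tau>: "stopping_time F \<tau>"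
  shows "emeasure P {\<omega> \<in> space M. \<tau> \<omega> < ennreal (\<theta> \<omega>)} = emeasure M {\<omega> \<in> space M. \<tau> \<omega> < ennreal (\<theta> \<omega>)}"
proof -
  define q where "q n i = real i / 2 ^ n" for n i :: nat
  define A where "A n i = {\<omega> \<in> space M. \<tau> \<omega> \<le> ennreal (q n i) \<and> q n i < \<theta> \<omega>}" for n i
  have AG: "A n i \<in> sets (G (ennreal (q n i)))" for n i
  proof -
    have "{\<omega> \<in> space (G (ennreal (q n i))). q n i < \<theta> \<omega>} \<in> sets (G (ennreal (q n i)))"
      by measurable
    moreover have "{\<omega> \<in> space M. \<tau> \<omega> \<le> ennreal (q n i)} \<in> sets (G (ennreal (q n i)))"
      using stopping_time_events(1)[OF \<tau>] sets_F_G by blast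
    moreover have "A n i = {\<omega> \<in> space M. \<tau> \<omega> \<le> ennreal (q n i)} \<inter> {\<omega> \<in> space (G (ennreal (q n i))). q n i < \<theta> \<omega>}"
      by (auto simp: A_def)
    ultimately show ?thesis by simp
  qed
  have DG: "disjointed (A n) i \<in> sets (G (ennreal (q n i)))" for n i
  proof -
    have "A n j \<in> sets (G (ennreal (q n i)))" if "j \<le> i" for j
    proof -
      have "q n j \<le> q n i" using that by (simp add: q_def divide_right_mono)
      then show ?thesis
        using AG[of n j] sets_G_mono[OF ennreal_leI] by blast
    qed
    then show ?thesis
      unfolding disjointed_def by (intro sets.Diff sets.finite_UN) auto
  qed
  have Deq: "emeasure P (disjointed (A n) i) = emeasure M (disjointed (A n) i)" for n i
    by (rule P_before_change[OF _ DG]) (auto simp: q_def disjointed_def A_def)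
  have DP: "disjointed (A n) i \<in> sets P" and DM: "disjointed (A n) i \<in> events" for n i
    using DG sets_G_P sets_G_events by blast+
  define B where "B n = (\<Union>i. A n i)" for n
  have AP: "A n i \<in> sets P" and AM: "A n i \<in> events" for n i
    using AG sets_G_P sets_G_events by blast+
  have BP: "B n \<in> sets P" and BM: "B n \<in> events" for n
    unfolding B_def using AP AM by blast+
  have B: "emeasure P (B n) = emeasure M (B n)" for n
  proof -
    have "range (disjointed (A n)) \<subseteq> sets P" "range (disjointed (A n)) \<subseteq> events"
      using DP DM by blast+
    from this[THEN suminf_emeasure, OF disjoint_family_disjointed]
    show ?thesis
      unfolding B_def UN_disjointed_eq Deq by simp
  qed
  have inc: "incseq B"
  proof (rule incseq_SucI)
    fix n
    show "B n \<le> B (Suc n)"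
    proof
      fix \<omega> assume "\<omega> \<in> B n"
      then obtain i where i: "\<omega> \<in> A n i" by (auto simp: B_def)
      have "q n i = q (Suc n) (2 * i)" by (simp add: q_def)
      then have "\<omega> \<in> A (Suc n) (2 * i)" using i by (simp only: A_def)
      then show "\<omega> \<in> B (Suc n)" by (auto simp: B_def)
    qed
  qed
  have U: "(\<Union>n. B n) = {\<omega> \<in> space M. \<tau> \<omega> < ennreal (\<theta> \<omega>)}"
  proof (intro set_eqI iffI)
    fix \<omega> assume "\<omega> \<in> (\<Union>n. B n)"
    then obtain n i where "\<omega> \<in> space M" "\<tau> \<omega> \<le> ennreal (q n i)" "q n i < \<theta> \<omega>"
      by (auto simp: B_def A_def)
    moreover have "0 \<le> q n i" by (simp add: q_def)
    ultimately show "\<omega> \<in> {\<omega> \<in> space M. \<tau> \<omega> < ennreal (\<theta> \<omega>)}"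
      by (auto intro: le_less_trans ennreal_lessI)
  next
    fix \<omega> assume \<omega>: "\<omega> \<in> {\<omega> \<in> space M. \<tau> \<omega> < ennreal (\<theta> \<omega>)}"
    then have "\<tau> \<omega> < \<top>" by (auto intro: less_trans)
    then obtain x where x: "\<tau> \<omega> = ennreal x" "0 \<le> x" by (cases "\<tau> \<omega>") auto
    then have "x < \<theta> \<omega>" using \<omega> \<theta>(2)[of \<omega>] by (simp add: ennreal_less_iff)
    then obtain n i where "x \<le> q n i" "q n i < \<theta> \<omega>"
      using dyadic_between[OF x(2)] unfolding q_def by blast
    then have "\<omega> \<in> A n i" using \<omega> x by (auto simp: A_def intro: ennreal_leI)
    then show "\<omega> \<in> (\<Union>n. B n)" by (auto simp: B_def)
  qed
  have "emeasure P (\<Union>n. B n) = (SUP n. emeasure P (B n))"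
    using BP inc by (intro SUP_emeasure_incseq[symmetric]) auto
  also have "\<dots> = emeasure M (\<Union>n. B n)"
    unfolding B using BM inc by (intro SUP_emeasure_incseq) auto
  finally show ?thesis unfolding U .
qed

text \<open>
Conditionally on the observations, \<open>\<theta>\<close> exceeds the observed value of \<open>\<tau>\<close> with probability
\<open>survival \<tau>\<close>.
\<close>

lemma M_stop_before_change:
  assumes \<tau>: "stopping_time F \<tau>"
  shows "emeasure M {\<omega> \<in> space M. \<tau> \<omega> < ennreal (\<theta> \<omega>)}
    = ennreal (1 - p) * (\<integral>\<^sup>+\<omega>. (if \<tau> \<omega> = \<infinity> then 0 else ennreal (exp (- lam * enn2real (\<tau> \<omega>)))) \<partial>M)"
proof -
  note \<theta>(1) [measurable]
  have \<tau>obs [measurable]: "\<tau> \<in> borel_measurable obs"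
    by (rule measurable_mono_sets[OF stopping_time_measurable[OF \<tau>]]) (simp_all add: sets_F_subset_obs)
  have \<tau>M [measurable]: "\<tau> \<in> borel_measurable M"
    by (rule measurable_from_subalg[OF subalgebra_obs \<tau>obs])
  have "emeasure M {\<omega> \<in> space M. \<tau> \<omega> < ennreal (\<theta> \<omega>)}
    = (\<integral>\<^sup>+\<omega>. indicator {\<omega> \<in> space M. \<tau> \<omega> < ennreal (\<theta> \<omega>)} \<omega> \<partial>M)"
    by (rule nn_integral_indicator[symmetric]) measurable
  also have "\<dots> = (\<integral>\<^sup>+\<omega>. (\<lambda>(\<omega>, u). if \<tau> \<omega> < ennreal u then 1 else 0) (\<omega>, \<theta> \<omega>) \<partial>M)"
    by (rule nn_integral_cong) (auto split: split_indicator)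
  also have "\<dots> = (\<integral>\<^sup>+\<omega>. (\<integral>\<^sup>+u. (\<lambda>(\<omega>, u). if \<tau> \<omega> < ennreal u then 1 else 0) (\<omega>, u) \<partial>distr M borel \<theta>) \<partial>M)"
  proof (rule nn_integral_indep_freeze[OF subalgebra_obs \<theta>(1) indep_obs_change])
    have [measurable]: "(\<lambda>z. \<tau> (fst z)) \<in> borel_measurable (obs \<Otimes>\<^sub>M borel)"
      by (rule measurable_compose[OF measurable_fst \<tau>obs])
    have [measurable]: "(\<lambda>z. ennreal (snd z)) \<in> borel_measurable (obs \<Otimes>\<^sub>M borel)"
      by (rule measurable_compose[OF measurable_snd measurable_ennreal])
    have "(\<lambda>z. if \<tau> (fst z) < ennreal (snd z) then 1 else 0 :: ennreal) \<in> borel_measurable (obs \<Otimes>\<^sub>M borel)"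
      by measurable
    then show "(\<lambda>(\<omega>, u). if \<tau> \<omega> < ennreal u then 1 else 0 :: ennreal) \<in> borel_measurable (obs \<Otimes>\<^sub>M borel)"
      unfolding split_beta' .
  qed
  also have "\<dots> = (\<integral>\<^sup>+\<omega>. ennreal (1 - p) * (if \<tau> \<omega> = \<infinity> then 0 else ennreal (exp (- lam * enn2real (\<tau> \<omega>)))) \<partial>M)"
  proof (rule nn_integral_cong)
    fix \<omega>
    have "(\<integral>\<^sup>+u. (\<lambda>(\<omega>, u). if \<tau> \<omega> < ennreal u then 1 else 0) (\<omega>, u) \<partial>distr M borel \<theta>)
      = (\<integral>\<^sup>+u. indicator {u. \<tau> \<omega> < ennreal u} u \<partial>distr M borel \<theta>)"
      by (rule nn_integral_cong) (auto split: split_indicator)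
    also have "\<dots> = emeasure (distr M borel \<theta>) {u. \<tau> \<omega> < ennreal u}"
      by (rule nn_integral_indicator) simp
    also have "\<dots> = emeasure M {\<omega>' \<in> space M. \<tau> \<omega> < ennreal (\<theta> \<omega>')}"
      by (subst emeasure_distr) (auto intro!: arg_cong[where f = "emeasure M"])
    also have "\<dots> = ennreal (1 - p) * (if \<tau> \<omega> = \<infinity> then 0 else ennreal (exp (- lam * enn2real (\<tau> \<omega>))))"
    proof (cases "\<tau> \<omega>")
      case (real x)
      then have "{\<omega>' \<in> space M. \<tau> \<omega> < ennreal (\<theta> \<omega>')} = {\<omega>' \<in> space M. x < \<theta> \<omega>'}"
        by (auto simp: ennreal_less_iff)
      then have "emeasure M {\<omega>' \<in> space M. \<tau> \<omega> < ennreal (\<theta> \<omega>')} = ennreal (survival x)"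
        by (simp add: survival_def emeasure_eq_measure)
      then show ?thesis
        using real p survival_eq[of x] by (simp add: ennreal_mult)
    qed (simp add: top_unique)
    finally show "(\<integral>\<^sup>+u. (\<lambda>(\<omega>, u). if \<tau> \<omega> < ennreal u then 1 else 0) (\<omega>, u) \<partial>distr M borel \<theta>)
      = ennreal (1 - p) * (if \<tau> \<omega> = \<infinity> then 0 else ennreal (exp (- lam * enn2real (\<tau> \<omega>))))" .
  qed
  also have "\<dots> = ennreal (1 - p) * (\<integral>\<^sup>+\<omega>. (if \<tau> \<omega> = \<infinity> then 0 else ennreal (exp (- lam * enn2real (\<tau> \<omega>)))) \<partial>M)"
    by (rule nn_integral_cmult) measurable
  finally show ?thesis .
qed

text \<open>
The event \<open>{\<tau> < \<theta>}\<close> has probability \<open>(1 - p) E\<close> with \<open>E = E\<^sub>0[e\<^sup>-\<^sup>\<lambda>\<^sup>\<tau>]\<close>, and \<open>1 - E\<close> is \<open>\<lambda>\<close> times the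
expected discounted time up to \<open>\<tau>\<close>, which accounts for the constant \<open>\<lambda> / c\<close> in the running cost. All
statements about the statistic hold almost surely for each fixed time only; so each cost is first turned into
a time integral of expectations by Fubini, and then compared at a fixed time.
\<close>

lemma penalty_eq_running_cost:
  fixes \<Phi> :: "nat \<Rightarrow> real \<Rightarrow> 'a \<Rightarrow> real"
  assumes \<Phi>: "odds_moment_version M P F \<mu> \<Lambda> \<theta> 0 (\<Phi> 0)" and \<tau>: "stopping_time F \<tau>"
  defines "g \<equiv> \<lambda>z :: nat \<Rightarrow> real. z 0 - lam / c"
  shows "cost_part M lam (\<lambda>z. - g z) (joint_process k \<Phi>) \<tau> < \<infinity>"
    and "enn2ereal (penalty P c \<theta> \<tau>) =
      ereal (1 - p) + ereal (c * (1 - p)) * running_cost M lam g (joint_process k \<Phi>) \<tau>"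
proof -
  interpret P: prob_space P by (rule prob_space_P)
  define act where "act t \<omega> = (indicator {t. 0 \<le> t \<and> ennreal t < \<tau> \<omega>} t :: ennreal)" for t \<omega>
  define \<phi> where "\<phi> t \<omega> = \<Phi> 0 (max 0 t) \<omega>" for t \<omega>
  \<comment> \<open>Expected cost rate at time \<open>t\<close> and total cost, for a cost \<open>h t x\<close> in state \<open>x\<close>.\<close>
  define w where "w h t = (\<integral>\<^sup>+\<omega>. ennreal (h t (\<phi> t \<omega>)) * act t \<omega> \<partial>M)" for h :: "real \<Rightarrow> real \<Rightarrow> real" and t
  define W where "W h = (\<integral>\<^sup>+t. w h t \<partial>lborel)" for h
  have \<tau>obs [measurable]: "\<tau> \<in> borel_measurable obs"
    by (rule measurable_mono_sets[OF stopping_time_measurable[OF \<tau>]]) (simp_all add: sets_F_subset_obs)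
  have \<tau>M [measurable]: "\<tau> \<in> borel_measurable M"
    by (rule measurable_from_subalg[OF subalgebra_obs \<tau>obs])
  have \<tau>P [measurable]: "\<tau> \<in> borel_measurable P"
    using sets_F_P by (intro measurable_mono_sets[OF stopping_time_measurable[OF \<tau>]]) (auto simp: P_space)
  have \<phi>: "(\<lambda>z. \<phi> (fst z) (snd z)) \<in> borel_measurable (lborel \<Otimes>\<^sub>M M)"
  proof -
    have "(\<lambda>z :: real \<times> 'a. (max 0 (fst z), snd z)) \<in> lborel \<Otimes>\<^sub>M M \<rightarrow>\<^sub>M restrict_space borel {0..} \<Otimes>\<^sub>M M"
      by (intro measurable_Pair measurable_restrict_space2) auto
    moreover have "(\<lambda>(t, \<omega>). \<Phi> 0 t \<omega>) \<in> borel_measurable (restrict_space borel {0..} \<Otimes>\<^sub>M M)"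
      using \<Phi> unfolding odds_moment_version_def by (rule conjunct1)
    ultimately have "(\<lambda>z. case (max 0 (fst z), snd z) of (t, \<omega>) \<Rightarrow> \<Phi> 0 t \<omega>) \<in> borel_measurable (lborel \<Otimes>\<^sub>M M)"
      by (rule measurable_compose)
    then show ?thesis by (simp only: \<phi>_def prod.case)
  qed
  have act: "(\<lambda>z. act (fst z) (snd z)) \<in> borel_measurable (lborel \<Otimes>\<^sub>M M)"
    unfolding act_def indicator_def by measurable
  have act_t: "act t \<in> borel_measurable M" for t
    unfolding act_def [abs_def] indicator_def by measurable
  have integrand: "(\<lambda>(t, \<omega>). ennreal (h t (\<phi> t \<omega>)) * act t \<omega>) \<in> borel_measurable (lborel \<Otimes>\<^sub>M M)"
    if h: "(\<lambda>z. h (fst z) (snd z)) \<in> borel_measurable (borel \<Otimes>\<^sub>M borel)" for h :: "real \<Rightarrow> real \<Rightarrow> real"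
  proof -
    have "(\<lambda>z. (fst z, \<phi> (fst z) (snd z))) \<in> lborel \<Otimes>\<^sub>M M \<rightarrow>\<^sub>M borel \<Otimes>\<^sub>M borel"
      using \<phi> by (intro measurable_Pair) auto
    from measurable_compose[OF this h]
    have "(\<lambda>z. h (fst z) (\<phi> (fst z) (snd z))) \<in> borel_measurable (lborel \<Otimes>\<^sub>M M)" by simp
    from borel_measurable_times_ennreal[OF measurable_compose[OF this measurable_ennreal] act]
    show ?thesis unfolding split_beta' .
  qed
  have W_eq: "(\<integral>\<^sup>+\<omega>. (\<integral>\<^sup>+t\<in>{t. 0 \<le> t \<and> ennreal t < \<tau> \<omega>}. ennreal (h t (\<Phi> 0 t \<omega>)) \<partial>lborel) \<partial>M) = W h"
    if h: "(\<lambda>z. h (fst z) (snd z)) \<in> borel_measurable (borel \<Otimes>\<^sub>M borel)" for h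
  proof -
    have "(\<integral>\<^sup>+\<omega>. (\<integral>\<^sup>+t\<in>{t. 0 \<le> t \<and> ennreal t < \<tau> \<omega>}. ennreal (h t (\<Phi> 0 t \<omega>)) \<partial>lborel) \<partial>M)
      = (\<integral>\<^sup>+\<omega>. (\<integral>\<^sup>+t. ennreal (h t (\<phi> t \<omega>)) * act t \<omega> \<partial>lborel) \<partial>M)"
      by (intro nn_integral_cong) (auto simp: \<phi>_def act_def max_def split: split_indicator)
    also have "\<dots> = W h"
      unfolding W_def w_def by (rule time_fubini[OF integrand[OF h]])
    finally show ?thesis .
  qed
  have \<phi>_M: "\<phi> t \<in> borel_measurable M" for t
    using \<Phi> measurable_from_subalg[OF subalgebra_F] unfolding odds_moment_version_def \<phi>_def by (metis max.cobounded1)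
  have int_t: "(\<lambda>\<omega>. ennreal (h t (\<phi> t \<omega>)) * act t \<omega>) \<in> borel_measurable M"
    if h: "(\<lambda>z. h (fst z) (snd z)) \<in> borel_measurable (borel \<Otimes>\<^sub>M borel)" for h :: "real \<Rightarrow> real \<Rightarrow> real" and t
  proof -
    have "(\<lambda>\<omega>. (t, \<phi> t \<omega>)) \<in> M \<rightarrow>\<^sub>M borel \<Otimes>\<^sub>M borel"
      using \<phi>_M by (intro measurable_Pair) auto
    from measurable_compose[OF this h] have "(\<lambda>\<omega>. h t (\<phi> t \<omega>)) \<in> borel_measurable M" by simp
    from borel_measurable_times_ennreal[OF measurable_compose[OF this measurable_ennreal] act_t] show ?thesis .
  qed
  have w_meas: "w h \<in> borel_measurable lborel"
    if h: "(\<lambda>z. h (fst z) (snd z)) \<in> borel_measurable (borel \<Otimes>\<^sub>M borel)" for h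
    unfolding w_def [abs_def] by (rule borel_measurable_nn_integral[OF integrand[OF h]])

  define e where "e t = exp (- lam * t)" for t
  have e_pos: "0 < e t" for t by (simp add: e_def)
  have e_meas [measurable]: "e \<in> borel_measurable borel" unfolding e_def [abs_def] by measurable
  define a where "a = lam / c"
  have a: "0 < a" using lam_pos c_pos by (simp add: a_def)
  define h1 where "h1 t x = e t * (x - a)" for t x
  define h2 where "h2 t x = e t * (- (x - a))" for t x
  define h3 where "h3 t x = e t * x" for t x
  define h4 where "h4 t (x :: real) = e t * a" for t x
  have h: "(\<lambda>z. h1 (fst z) (snd z)) \<in> borel_measurable (borel \<Otimes>\<^sub>M borel)"
    "(\<lambda>z. h2 (fst z) (snd z)) \<in> borel_measurable (borel \<Otimes>\<^sub>M borel)"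
    "(\<lambda>z. h3 (fst z) (snd z)) \<in> borel_measurable (borel \<Otimes>\<^sub>M borel)"
    "(\<lambda>z. h4 (fst z) (snd z)) \<in> borel_measurable (borel \<Otimes>\<^sub>M borel)"
    unfolding h1_def h2_def h3_def h4_def by measurable

  have formula: "AE \<omega> in M. (\<Sum>v\<in>V. odds_mass v t \<omega>) = ennreal (survival t * \<Phi> 0 t \<omega>) \<and> 0 \<le> \<Phi> 0 t \<omega>"
    if t: "0 \<le> t" for t
  proof -
    have "AE \<omega> in M. \<forall>v\<in>V. odds_mass v t \<omega> < \<infinity>"
      using AE_odds_mass_finite[OF t] by (intro AE_finite_allI finite_V)
    then show ?thesis
      using odds_moment_formula[OF \<Phi> t]
    proof eventually_elim
      fix \<omega> assume fin: "\<forall>v\<in>V. odds_mass v t \<omega> < \<infinity>"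
        and eq: "\<Phi> 0 t \<omega> = (\<Sum>v\<in>V. (v - \<mu>) ^ 0 * (enn2real (odds_mass v t \<omega>) / survival t))"
      have "survival t * \<Phi> 0 t \<omega> = (\<Sum>v\<in>V. enn2real (odds_mass v t \<omega>))"
        using survival_pos[OF t] by (simp add: eq sum_divide_distrib[symmetric])
      moreover have "(\<Sum>v\<in>V. odds_mass v t \<omega>) = (\<Sum>v\<in>V. ennreal (enn2real (odds_mass v t \<omega>)))"
        using fin by (intro sum.cong) auto
      moreover have "0 \<le> \<Phi> 0 t \<omega>"
        unfolding eq using survival_pos[OF t] by (intro sum_nonneg) auto
      ultimately show "(\<Sum>v\<in>V. odds_mass v t \<omega>) = ennreal (survival t * \<Phi> 0 t \<omega>) \<and> 0 \<le> \<Phi> 0 t \<omega>"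
        by (simp add: sum_ennreal)
    qed
  qed
  have nonneg: "AE \<omega> in M. 0 \<le> \<phi> t \<omega>" for t
    using formula[of "max 0 t"] by (auto simp: \<phi>_def)

  \<comment> \<open>This identity avoids differences of costs that may be infinite.\<close>
  have balance: "W h1 + W h4 = W h2 + W h3"
  proof -
    have "w h1 t + w h4 t = w h2 t + w h3 t" for t
    proof -
      have "w h1 t + w h4 t = (\<integral>\<^sup>+\<omega>. ennreal (h1 t (\<phi> t \<omega>)) * act t \<omega> + ennreal (h4 t (\<phi> t \<omega>)) * act t \<omega> \<partial>M)"
        unfolding w_def by (rule nn_integral_add[symmetric]) (intro int_t h)+
      also have "\<dots> = (\<integral>\<^sup>+\<omega>. ennreal (h2 t (\<phi> t \<omega>)) * act t \<omega> + ennreal (h3 t (\<phi> t \<omega>)) * act t \<omega> \<partial>M)"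
      proof (rule nn_integral_cong_AE)
        have "ennreal (h1 t x) + ennreal (h4 t x) = ennreal (h2 t x) + ennreal (h3 t x)" if "0 \<le> x" for x
        proof (cases "a \<le> x")
          case True
          then have "ennreal (h2 t x) = 0"
            using e_pos[of t] by (auto simp: h2_def mult_nonneg_nonpos intro!: ennreal_neg)
          moreover have "ennreal (h1 t x) + ennreal (h4 t x) = ennreal (h1 t x + h4 t x)"
            using True e_pos[of t] a by (intro ennreal_plus[symmetric]) (auto simp: h1_def h4_def)
          moreover have "h1 t x + h4 t x = h3 t x" by (simp add: h1_def h3_def h4_def algebra_simps)
          ultimately show ?thesis by simp
        next
          case False
          then have "ennreal (h1 t x) = 0"
            using e_pos[of t] by (auto simp: h1_def mult_nonneg_nonpos intro!: ennreal_neg)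
          moreover have "ennreal (h2 t x) + ennreal (h3 t x) = ennreal (h2 t x + h3 t x)"
            using False e_pos[of t] that
            by (intro ennreal_plus[symmetric]) (auto simp: h2_def h3_def intro!: mult_nonneg_nonneg)
          moreover have "h2 t x + h3 t x = h4 t x" by (simp add: h2_def h3_def h4_def algebra_simps)
          ultimately show ?thesis by simp
        qed
        then show "AE \<omega> in M. ennreal (h1 t (\<phi> t \<omega>)) * act t \<omega> + ennreal (h4 t (\<phi> t \<omega>)) * act t \<omega>
            = ennreal (h2 t (\<phi> t \<omega>)) * act t \<omega> + ennreal (h3 t (\<phi> t \<omega>)) * act t \<omega>"
          using nonneg[of t] by (auto simp: distrib_right[symmetric])
      qed
      also have "\<dots> = w h2 t + w h3 t"
        unfolding w_def by (rule nn_integral_add) (intro int_t h)+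
      finally show ?thesis .
    qed
    then show ?thesis
      unfolding W_def using w_meas h by (simp add: nn_integral_add[symmetric])
  qed
  have "W h2 \<le> W h4"
    unfolding W_def w_def
  proof (rule nn_integral_mono, rule nn_integral_mono_AE)
    fix t
    have le: "ennreal (h2 t x) \<le> ennreal (h4 t x)" if "0 \<le> x" for x
      using that e_pos[of t] by (intro ennreal_leI) (auto simp: h2_def h4_def)
    show "AE \<omega> in M. ennreal (h2 t (\<phi> t \<omega>)) * act t \<omega> \<le> ennreal (h4 t (\<phi> t \<omega>)) * act t \<omega>"
      using nonneg[of t] by eventually_elim (intro mult_right_mono le, simp_all)
  qed

  define E where "E = (\<integral>\<^sup>+\<omega>. (if \<tau> \<omega> = \<infinity> then 0 else ennreal (exp (- lam * enn2real (\<tau> \<omega>)))) \<partial>M)"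
  have unit: "ennreal c * W h4 + E = 1"
  proof -
    define I where "I \<omega> = (\<integral>\<^sup>+t\<in>{t. 0 \<le> t \<and> ennreal t < \<tau> \<omega>}. ennreal (lam * exp (- lam * t)) \<partial>lborel)" for \<omega>
    define J where "J \<omega> = (if \<tau> \<omega> = \<infinity> then 0 else ennreal (exp (- lam * enn2real (\<tau> \<omega>))))" for \<omega>
    have J: "J \<in> borel_measurable M" unfolding J_def [abs_def] by measurable
    have IJ: "I \<omega> + J \<omega> = 1" for \<omega>
      unfolding I_def J_def by (rule discounted_time[OF lam_pos])
    have "J \<omega> \<noteq> \<top>" for \<omega> by (simp add: J_def)
    then have "I \<omega> = 1 - J \<omega>" for \<omega>
      using ennreal_add_diff_cancel_right[of "J \<omega>" "I \<omega>"] IJ[of \<omega>] by simp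
    then have "I = (\<lambda>\<omega>. 1 - J \<omega>)" by (rule ext)
    then have I: "I \<in> borel_measurable M" using J by simp
    have scale: "ennreal c * (ennreal (exp (- lam * t) * a) * x) = ennreal (lam * exp (- lam * t)) * x" for t x
    proof -
      have "c * (exp (- lam * t) * a) = lam * exp (- lam * t)"
        using c_pos by (simp add: a_def)
      then have "ennreal (lam * exp (- lam * t)) = ennreal (c * (exp (- lam * t) * a))" by (simp only:)
      also have "\<dots> = ennreal c * ennreal (exp (- lam * t) * a)"
        using c_pos a by (intro ennreal_mult) auto
      finally show ?thesis by (simp only: mult.assoc)
    qed
    have "ennreal c * W h4 = (\<integral>\<^sup>+t. ennreal c * w h4 t \<partial>lborel)"
      unfolding W_def by (rule nn_integral_cmult[OF w_meas[OF h(4)], symmetric])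
    also have "\<dots> = (\<integral>\<^sup>+t. (\<integral>\<^sup>+\<omega>. ennreal (lam * exp (- lam * t)) * act t \<omega> \<partial>M) \<partial>lborel)"
    proof (rule nn_integral_cong)
      fix t
      have "ennreal c * w h4 t = (\<integral>\<^sup>+\<omega>. ennreal c * (ennreal (h4 t (\<phi> t \<omega>)) * act t \<omega>) \<partial>M)"
        unfolding w_def by (rule nn_integral_cmult[OF int_t[OF h(4)], symmetric])
      then show "ennreal c * w h4 t = (\<integral>\<^sup>+\<omega>. ennreal (lam * exp (- lam * t)) * act t \<omega> \<partial>M)"
        unfolding h4_def e_def scale .
    qed
    also have "\<dots> = (\<integral>\<^sup>+\<omega>. (\<integral>\<^sup>+t. ennreal (lam * exp (- lam * t)) * act t \<omega> \<partial>lborel) \<partial>M)"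
    proof (rule time_fubini[symmetric])
      have [measurable]: "(\<lambda>z. act (fst z) (snd z)) \<in> borel_measurable (lborel \<Otimes>\<^sub>M M)" by (rule act)
      show "(\<lambda>(t, \<omega>). ennreal (lam * exp (- lam * t)) * act t \<omega>) \<in> borel_measurable (lborel \<Otimes>\<^sub>M M)"
        unfolding split_beta' by measurable
    qed
    also have "\<dots> = (\<integral>\<^sup>+\<omega>. I \<omega> \<partial>M)"
      by (simp only: I_def act_def)
    finally have "ennreal c * W h4 + E = (\<integral>\<^sup>+\<omega>. I \<omega> \<partial>M) + (\<integral>\<^sup>+\<omega>. J \<omega> \<partial>M)"
      by (simp add: E_def J_def)
    also have "\<dots> = (\<integral>\<^sup>+\<omega>. I \<omega> + J \<omega> \<partial>M)"
      by (rule nn_integral_add[symmetric, OF I J])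
    finally show ?thesis by (simp add: IJ emeasure_space_1)
  qed
  then have "ennreal c * W h4 \<noteq> \<top>" by auto
  then have W4_fin: "W h4 < \<infinity>"
    using c_pos by (auto simp: ennreal_mult_eq_top_iff less_top)
  with \<open>W h2 \<le> W h4\<close> have W2_fin: "W h2 < \<infinity>" by (rule le_less_trans)

  have delay: "(\<integral>\<^sup>+\<omega>. (\<tau> \<omega> - ennreal (\<theta> \<omega>)) \<partial>P) = ennreal (1 - p) * W h3"
  proof -
    let ?S = "\<lambda>t \<omega>. indicator {t. \<theta> \<omega> \<le> t \<and> ennreal t < \<tau> \<omega>} t :: ennreal"
    have "(\<integral>\<^sup>+\<omega>. (\<tau> \<omega> - ennreal (\<theta> \<omega>)) \<partial>P) = (\<integral>\<^sup>+\<omega>. (\<integral>\<^sup>+t. ?S t \<omega> \<partial>lborel) \<partial>P)"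
      using \<theta>(2) by (intro nn_integral_cong delay_eq_integral) (simp add: P_space)
    also have "\<dots> = (\<integral>\<^sup>+t. (\<integral>\<^sup>+\<omega>. ?S t \<omega> \<partial>P) \<partial>lborel)"
    proof (rule P.time_fubini)
      show "(\<lambda>(t, \<omega>). ?S t \<omega>) \<in> borel_measurable (lborel \<Otimes>\<^sub>M P)"
        unfolding indicator_def by measurable
    qed
    also have "\<dots> = (\<integral>\<^sup>+t. ennreal (1 - p) * w h3 t \<partial>lborel)"
    proof (rule nn_integral_cong)
      fix t
      show "(\<integral>\<^sup>+\<omega>. ?S t \<omega> \<partial>P) = ennreal (1 - p) * w h3 t"
      proof (cases "0 \<le> t")
        case False
        have "(\<integral>\<^sup>+\<omega>. ?S t \<omega> \<partial>P) = (\<integral>\<^sup>+\<omega>. 0 \<partial>P)"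
          using False \<theta>(2) by (intro nn_integral_cong) (force simp: P_space split: split_indicator)
        moreover have "w h3 t = 0"
          using False by (simp add: w_def act_def)
        ultimately show ?thesis by simp
      next
        case True
        let ?A = "{\<omega> \<in> space M. ennreal t < \<tau> \<omega>}"
        have A: "?A \<in> sets (F (ennreal t))" by (rule stopping_time_events(2)[OF \<tau>])
        have AM [measurable]: "?A \<in> events" by (rule sets_F_events[OF A])
        have sp: "space P = space M" by (rule P_space)
        have [measurable]: "?A \<inter> {\<omega> \<in> space M. \<theta> \<omega> \<le> t} \<in> sets P"
          unfolding sp[symmetric] by measurable
        note measurable_from_subalg[OF subalgebra_obs measurable_odds_mass[OF True], measurable]
        have "(\<integral>\<^sup>+\<omega>. ?S t \<omega> \<partial>P) = (\<integral>\<^sup>+\<omega>. indicator (?A \<inter> {\<omega> \<in> space M. \<theta> \<omega> \<le> t}) \<omega> \<partial>P)"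
          by (intro nn_integral_cong) (auto simp: P_space split: split_indicator)
        also have "\<dots> = (\<Sum>v\<in>V. \<integral>\<^sup>+\<omega>\<in>?A. odds_mass v t \<omega> \<partial>M)"
          by (simp add: P_split[OF True A])
        also have "\<dots> = (\<integral>\<^sup>+\<omega>. (\<Sum>v\<in>V. odds_mass v t \<omega> * indicator ?A \<omega>) \<partial>M)"
          by (rule nn_integral_sum[symmetric]) measurable
        also have "\<dots> = (\<integral>\<^sup>+\<omega>. ennreal (1 - p) * (ennreal (h3 t (\<phi> t \<omega>)) * act t \<omega>) \<partial>M)"
        proof (rule nn_integral_cong_AE)
          show "AE \<omega> in M. (\<Sum>v\<in>V. odds_mass v t \<omega> * indicator ?A \<omega>)
              = ennreal (1 - p) * (ennreal (h3 t (\<phi> t \<omega>)) * act t \<omega>)"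
            using formula[OF True] AE_space
          proof eventually_elim
            fix \<omega> assume \<omega>: "\<omega> \<in> space M"
              and *: "(\<Sum>v\<in>V. odds_mass v t \<omega>) = ennreal (survival t * \<Phi> 0 t \<omega>) \<and> 0 \<le> \<Phi> 0 t \<omega>"
            have "survival t * \<Phi> 0 t \<omega> = (1 - p) * h3 t (\<phi> t \<omega>)"
              using True by (simp add: survival_eq h3_def e_def \<phi>_def)
            then have "(\<Sum>v\<in>V. odds_mass v t \<omega>) = ennreal (1 - p) * ennreal (h3 t (\<phi> t \<omega>))"
              using * p by (simp add: ennreal_mult')
            moreover have "indicator ?A \<omega> = act t \<omega>"
              using \<omega> True by (auto simp: act_def split: split_indicator)
            ultimately show "(\<Sum>v\<in>V. odds_mass v t \<omega> * indicator ?A \<omega>)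
              = ennreal (1 - p) * (ennreal (h3 t (\<phi> t \<omega>)) * act t \<omega>)"
              by (simp only: sum_distrib_right[symmetric] mult.assoc)
          qed
        qed
        also have "\<dots> = ennreal (1 - p) * w h3 t"
          unfolding w_def by (rule nn_integral_cmult[OF int_t[OF h(3)]])
        finally show ?thesis .
      qed
    qed
    also have "\<dots> = ennreal (1 - p) * W h3"
      unfolding W_def by (rule nn_integral_cmult[OF w_meas[OF h(3)]])
    finally show ?thesis .
  qed

  have Z0: "joint_process k \<Phi> t \<omega> 0 = \<Phi> 0 t \<omega>" for t \<omega>
    using k_pos by (simp add: joint_process_def)
  have cost1: "cost_part M lam g (joint_process k \<Phi>) \<tau> = W h1"
    unfolding W_eq[OF h(1), symmetric] cost_part_def g_def Z0 h1_def e_def a_def ..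
  have cost2: "cost_part M lam (\<lambda>z. - g z) (joint_process k \<Phi>) \<tau> = W h2"
    unfolding W_eq[OF h(2), symmetric] cost_part_def g_def Z0 h2_def e_def a_def ..
  show "cost_part M lam (\<lambda>z. - g z) (joint_process k \<Phi>) \<tau> < \<infinity>"
    unfolding cost2 by (rule W2_fin)

  let ?b = "ennreal (c * (1 - p))"
  have b: "?b = ennreal c * ennreal (1 - p)"
    using c_pos p by (simp add: ennreal_mult)
  have pen: "penalty P c \<theta> \<tau> = ennreal (1 - p) * E + ?b * W h3"
    unfolding penalty_def delay P_space P_eq_M_before_change[OF \<tau>] M_stop_before_change[OF \<tau>] E_def b
    by (simp add: mult.assoc)
  have "(penalty P c \<theta> \<tau> + ?b * W h2) + ?b * W h4
    = ennreal (1 - p) * (ennreal c * W h4 + E) + ?b * (W h2 + W h3)"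
    unfolding pen b by (simp add: distrib_left ac_simps)
  also have "\<dots> = (ennreal (1 - p) + ?b * W h1) + ?b * W h4"
    unfolding unit balance[symmetric] by (simp add: distrib_left distrib_right ac_simps)
  finally have "penalty P c \<theta> \<tau> + ?b * W h2 = ennreal (1 - p) + ?b * W h1"
    using ennreal_add_left_cancel[of "?b * W h4"] W4_fin
    by (simp add: add.commute[of _ "?b * W h4"] ennreal_mult_eq_top_iff less_top[symmetric])
  then show "enn2ereal (penalty P c \<theta> \<tau>) =
      ereal (1 - p) + ereal (c * (1 - p)) * running_cost M lam g (joint_process k \<Phi>) \<tau>"
    unfolding running_cost_def cost1 cost2 using W2_fin p c_pos
    by (intro ennreal_rearrange) auto
qed

lemma sufficient_statistic:
  fixes \<Phi> :: "nat \<Rightarrow> real \<Rightarrow> 'a \<Rightarrow> real"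
  assumes \<Phi>: "\<And>j. odds_moment_version M P F \<mu> \<Lambda> \<theta> j (\<Phi> j)"
  shows "markovian_sufficient_statistic M P F p lam c \<theta>
           (\<lambda>p c. 1 - p) (\<lambda>p c. c * (1 - p)) k \<Phi>"
  unfolding markovian_sufficient_statistic_def
proof (intro conjI allI impI)
  show "\<Phi> j t \<in> borel_measurable (F (ennreal t))" if "0 \<le> t" for j t
    using \<Phi>[of j] that by (auto simp: odds_moment_version_def)
  show "markov_process M F (Pi\<^sub>M {..<k} (\<lambda>_. borel)) (joint_process k \<Phi>)"
    by (rule joint_process_markov[OF \<Phi>])
  show "0 < c * (1 - p)" using c_pos p by simp
  show "\<exists>g \<in> borel_measurable (Pi\<^sub>M {..<k} (\<lambda>_. borel)).
        \<forall>\<tau>. stopping_time F \<tau> \<longrightarrow>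
          cost_part M lam (\<lambda>z. - g z) (joint_process k \<Phi>) \<tau> < \<infinity> \<and>
          enn2ereal (penalty P c \<theta> \<tau>) =
            ereal (1 - p) + ereal (c * (1 - p)) * running_cost M lam g (joint_process k \<Phi>) \<tau>"
  proof (intro bexI allI impI conjI)
    fix \<tau> assume "stopping_time F \<tau>"
    note penalty_eq_running_cost[where \<Phi> = \<Phi>, OF \<Phi>[of 0] this]
    then show "cost_part M lam (\<lambda>z. - (z 0 - lam / c)) (joint_process k \<Phi>) \<tau> < \<infinity>"
      "enn2ereal (penalty P c \<theta> \<tau>) = ereal (1 - p)
        + ereal (c * (1 - p)) * running_cost M lam (\<lambda>z. z 0 - lam / c) (joint_process k \<Phi>) \<tau>"
      by blast+
  next
    have [measurable]: "(\<lambda>z. z 0) \<in> borel_measurable (Pi\<^sub>M {..<k} (\<lambda>_. borel :: real measure))"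
      using k_pos by (intro measurable_component_singleton) simp
    show "(\<lambda>z. z 0 - lam / c) \<in> borel_measurable (Pi\<^sub>M {..<k} (\<lambda>_. borel))" by measurable
  qed
qed

end

theorem corollary3p1:
  fixes M P :: "'a measure"
    and p lam \<mu> c :: real
    and \<gamma> :: "real measure"
    and \<beta>\<^sub>0 \<beta>\<^sub>1 :: "(real ^ 'd) measure"
    and X\<^sub>0 :: "'a \<Rightarrow> real ^ 'd"
    and N :: "real \<Rightarrow> 'a \<Rightarrow> nat"
    and Y :: "nat \<Rightarrow> 'a \<Rightarrow> real ^ 'd"
    and \<theta> \<Lambda> :: "'a \<Rightarrow> real"
    and \<Phi> :: "nat \<Rightarrow> real \<Rightarrow> 'a \<Rightarrow> real"
    and k :: nat
  defines "F \<equiv> natural_filtration (space M) (compound_process X\<^sub>0 N Y)"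
  assumes "poisson_disorder M P p lam \<mu> c \<gamma> \<beta>\<^sub>0 \<beta>\<^sub>1 X\<^sub>0 N Y \<theta> \<Lambda>"
    and "\<And>j. odds_moment_version M P F \<mu> \<Lambda> \<theta> j (\<Phi> j)"
    and "discrete_with_atoms \<gamma> k"
  shows "markovian_sufficient_statistic M P F p lam c \<theta>
           (\<lambda>p c. 1 - p) (\<lambda>p c. c * (1 - p)) k \<Phi>"
proof -
  interpret discrete_poisson_disorder M P p lam \<mu> c \<gamma> \<beta>\<^sub>0 \<beta>\<^sub>1 X\<^sub>0 N Y \<theta> \<Lambda> k
    using assms(2,4) by (intro discrete_poisson_disorder.intro discrete_poisson_disorder_axioms.intro)
  show ?thesis
    unfolding F_def using assms(3) by (intro sufficient_statistic) (simp add: F_def)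
qed

end
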